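(* Let $\lambda$ be a singular cardinal and $F$ a filter on a set $I$, and suppose that either (a) there is $\lambda'<\lambda$ such that $F$ is $\kappa$-decomposable for every regular cardinal $\kappa$ with $\lambda'<\kappa<\lambda$; or (b) $\operatorname{cf}\lambda>\omega$ and the set $S=\{\kappa<\lambda : F \text{ is } \kappa^+\text{-decomposable}\}$ is stationary in $\lambda$. Then $F$ is either $\lambda$-decomposable or $\lambda^+$-decomposable. Moreover, if $F=D$ is an ultrafilter, then $D$ is $(\lambda,\lambda)$-regular, and $D$ is either (i) $\lambda$-decomposable, or (ii) $(\lambda',\lambda^+)$-regular for some $\lambda'<\lambda$, or (iii) $\operatorname{cf}\lambda$-decomposable and $(\lambda,\lambda^+)$-regular.
   Context: For a family $F$ of subsets of a set $I$ and an infinite cardinal $\lambda$, a $\lambda$-decomposition for $F$ is a function $f:I\to\lambda$ such that whenever $X\subseteq\lambda$ and $|X|<\lambda$, we have $\{i\in I: f(i)\in X\}\notin F$; $F$ is $\lambda$-decomposable iff such an $f$ exists. An ultrafilter $D$ is $(\mu,\lambda)$-regular iff there is a family of $\lambda$ members of $D$ such that the intersection of any $\mu$ members of the family is empty. *)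

theory Defs
  imports Main
begin

unbundle cardinal_syntax

text \<open>
  Cardinals are the cardinal orders of the library: relations \<open>r\<close> with \<^const>\<open>Card_order\<close> \<open>r\<close>,
  compared by \<open><o\<close>, \<open>\<le>o\<close>, \<open>=o\<close>. The elements of \<open>Field r\<close> are the ordinals below \<open>r\<close>, and
  the successor cardinal is \<^const>\<open>cardSuc\<close>.
\<close>

definition singular_card :: "'l rel \<Rightarrow> bool" where
  "singular_card r \<longleftrightarrow> Cinfinite r \<and> \<not> regularCard r"

text \<open>
  All finite cardinals satisfy \<^const>\<open>regularCard\<close>, since \<^const>\<open>cofinal\<close> asks for strict upper
  bounds; hence the explicit infinity requirement.
\<close>

definition regular_card :: "'l rel \<Rightarrow> bool" where
  "regular_card r \<longleftrightarrow> Cinfinite r \<and> regularCard r"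

definition cofinality :: "'l rel \<Rightarrow> 'l rel" where
  "cofinality r =
     (SOME c. c \<in> card_of ` {A. A \<subseteq> Field r \<and> cofinal A r} \<and>
              (\<forall>B \<subseteq> Field r. cofinal B r \<longrightarrow> c \<le>o |B| ))"

lemma cofinality:
  assumes "Cinfinite r"
  shows "\<exists>A. cofinality r = |A| \<and> A \<subseteq> Field r \<and> cofinal A r"
    and "\<And>B. B \<subseteq> Field r \<Longrightarrow> cofinal B r \<Longrightarrow> cofinality r \<le>o |B|"
proof -
  let ?R = "card_of ` {A. A \<subseteq> Field r \<and> cofinal A r}"
  have "cofinal (Field r) r"
    unfolding cofinal_def
    using assms infinite_Card_order_limit[of r] by (auto simp: cinfinite_def)
  then have "?R \<noteq> {}" by blast
  moreover have "\<forall>c\<in>?R. Card_order c"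
    using card_of_Card_order by blast
  ultimately have "\<exists>c. c \<in> ?R \<and> (\<forall>c'\<in>?R. c \<le>o c')"
    using exists_minim_Card_order[of ?R] by blast
  then have "\<exists>c. c \<in> ?R \<and> (\<forall>B \<subseteq> Field r. cofinal B r \<longrightarrow> c \<le>o |B| )" by blast
  from someI_ex[OF this]
  have *: "cofinality r \<in> ?R \<and> (\<forall>B \<subseteq> Field r. cofinal B r \<longrightarrow> cofinality r \<le>o |B| )"
    unfolding cofinality_def .
  then show "\<exists>A. cofinality r = |A| \<and> A \<subseteq> Field r \<and> cofinal A r" by blast
  from * show "\<And>B. B \<subseteq> Field r \<Longrightarrow> cofinal B r \<Longrightarrow> cofinality r \<le>o |B|" by blast
qed

text \<open>
  The ordinal \<open>a \<in> Field r\<close>, viewed as the well-ordered set of its predecessors.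
\<close>

definition initial_part :: "'l rel \<Rightarrow> 'l \<Rightarrow> 'l rel" where
  "initial_part r a = Restr r (underS r a)"

text \<open>
  Closedness: an ordinal \<open>a > 0\<close> belongs to \<open>C\<close> as soon as \<open>C\<close> is unbounded below \<open>a\<close>. Since
  \<^const>\<open>cofinal\<close> asks for strict upper bounds, its premise forces \<open>a\<close> to be a limit.
\<close>

definition club :: "'l rel \<Rightarrow> 'l set \<Rightarrow> bool" where
  "club r C \<longleftrightarrow> C \<subseteq> Field r \<and> cofinal C r \<and>
     (\<forall>a \<in> Field r. underS r a \<noteq> {} \<and> cofinal (C \<inter> underS r a) (initial_part r a) \<longrightarrow> a \<in> C)"

definition stationary :: "'l rel \<Rightarrow> 'l set \<Rightarrow> bool" where
  "stationary r S \<longleftrightarrow> S \<subseteq> Field r \<and> (\<forall>C. club r C \<longrightarrow> S \<inter> C \<noteq> {})"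

definition filter_on :: "'i set \<Rightarrow> 'i set set \<Rightarrow> bool" where
  "filter_on I F \<longleftrightarrow> F \<subseteq> Pow I \<and> I \<in> F \<and> {} \<notin> F \<and>
     (\<forall>A \<in> F. \<forall>B \<in> F. A \<inter> B \<in> F) \<and> (\<forall>A \<in> F. \<forall>B. A \<subseteq> B \<and> B \<subseteq> I \<longrightarrow> B \<in> F)"

definition ultrafilter_on :: "'i set \<Rightarrow> 'i set set \<Rightarrow> bool" where
  "ultrafilter_on I D \<longleftrightarrow> filter_on I D \<and> (\<forall>A \<subseteq> I. A \<in> D \<or> I - A \<in> D)"

text \<open>The next two notions are intended for infinite cardinals \<open>r\<close>.\<close>

definition decomposition :: "'k rel \<Rightarrow> 'i set \<Rightarrow> 'i set set \<Rightarrow> ('i \<Rightarrow> 'k) \<Rightarrow> bool" where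
  "decomposition r I F f \<longleftrightarrow> f ` I \<subseteq> Field r \<and>
     (\<forall>X \<subseteq> Field r. |X| <o r \<longrightarrow> {i \<in> I. f i \<in> X} \<notin> F)"

definition decomposable :: "'k rel \<Rightarrow> 'i set \<Rightarrow> 'i set set \<Rightarrow> bool" where
  "decomposable r I F \<longleftrightarrow> (\<exists>f. decomposition r I F f)"

text \<open>
  In \<open>regular_uf m n D\<close> the family consists of \<open>n\<close> distinct members of \<open>D\<close>.
\<close>

definition regular_uf :: "'m rel \<Rightarrow> 'n rel \<Rightarrow> 'i set set \<Rightarrow> bool" where
  "regular_uf m n D \<longleftrightarrow>
     (\<exists>E \<subseteq> D. |E| =o n \<and> (\<forall>E' \<subseteq> E. |E'| =o m \<longrightarrow> \<Inter>E' = {}))"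

text \<open>
  The infinite cardinals \<open>\<kappa>\<close> below \<open>r\<close>, as initial ordinals \<open>a \<in> Field r\<close>, for which the family is
  \<open>\<kappa>\<^sup>+\<close>-decomposable.
\<close>

definition succ_decomposable_cards :: "'l rel \<Rightarrow> 'i set \<Rightarrow> 'i set set \<Rightarrow> 'l set" where
  "succ_decomposable_cards r I F =
     {a \<in> Field r. Cinfinite (initial_part r a) \<and> decomposable (cardSuc (initial_part r a)) I F}"

end

theory Submission
  imports Defs "HOL.Filter"
begin

text \<open>
  By Shelah's theorem there are, cofinally in \<open>\<lambda>\<close>, ordinals \<open>H a\<close> whose cofinalities tend to \<open>\<lambda>\<close>, and
  \<open>\<lambda>\<^sup>+\<close> functions cofinal in their product modulo bounded sets; the \<open>H a\<close> arise as an exact upper bound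
  of a sequence in the product of the \<open>a\<^sup>+\<close>. In case (a) \<open>F\<close> is decomposable at the regular cardinal
  \<open>cf (H a)\<close>; in case (b) \<open>H a = a\<^sup>+\<close> for a club of \<open>a\<close>, and the stationary set meets it. Sending \<open>i\<close> to
  the index of a function dominating the sequence of decompositions at \<open>i\<close> gives a function
  \<open>I \<rightarrow> \<lambda>\<^sup>+\<close>. If \<open>F\<close> is neither \<open>\<lambda>\<close>- nor \<open>\<lambda>\<^sup>+\<close>-decomposable, fewer than \<open>\<lambda>\<close> indices suffice on a
  set in \<open>F\<close>, and they bound one of the decompositions there, a contradiction.

  A \<open>\<lambda>\<^sup>+\<close>-decomposable ultrafilter that is not \<open>cf \<lambda>\<close>-decomposable is \<open>(\<lambda>', \<lambda>\<^sup>+)\<close>-regular for some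
  \<open>\<lambda>' < \<lambda>\<close>, by splitting each \<open>\<alpha> < \<lambda>\<^sup>+\<close> into \<open>cf \<lambda>\<close> small pieces. If there is a least unbounded
  function \<open>h\<close> into \<open>\<lambda>\<^sup>+\<close>, small cofinal subsets of the \<open>h i\<close> show \<open>(\<lambda>, \<lambda>\<^sup>+)\<close>-regularity. If there is none,
  descending sequences of functions give, unless \<open>(\<lambda>', \<lambda>\<^sup>+)\<close>-regularity holds, point-finite families
  of every size below \<open>\<lambda>\<close>, and these combine to a \<open>\<lambda>\<close>-decomposition.
\<close>

section \<open>Closed unbounded sets and club guessing\<close>

text \<open>The obstacle is that \<open>F\<close> decomposes over many regular cardinals separately,
  with nothing to link these decompositions. The scale links them: one index below
  \<open>\<lambda>\<^sup>+\<close> controls all large coordinates at once. Exactness ensures that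
  every function below \<open>H\<close> is dominated by a member of the scale, and the large
  cofinality of \<open>H a\<close> lets small sets of indices be bounded at a coordinate. Both rest
  on one principle: a long sequence increasing modulo bounded sets and covered by small sets
  \<open>S a\<close> is trapped below the projection of one of its members. Club guessing enters
  because the failures of trapping occur at coordinates varying with the step; a correct guess
  yields many steps under uniform control, and a pigeonhole moves them to one coordinate. The
  argument consumes three successors above the size of \<open>S a\<close>, which is harmless since a
  singular \<lambda> is a limit cardinal.\<close>

text \<open>
  Ordinals are elements of a type of class \<^class>\<open>wellorder\<close>, and \<open>{..<s}\<close> is the ordinal \<open>s\<close> as a
  set. \<open>cof_above s K\<close> says that the cofinality of \<open>s\<close> exceeds the cardinality of \<open>K\<close>.
\<close>

definition cof_above :: "'o::wellorder \<Rightarrow> 'k set \<Rightarrow> bool" where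
  "cof_above s K \<longleftrightarrow> (\<forall>X \<subseteq> {..<s}. |X| \<le>o |K| \<longrightarrow> (\<exists>b<s. \<forall>x\<in>X. x < b))"

lemma cof_aboveD:
  "cof_above s K \<Longrightarrow> X \<subseteq> {..<s} \<Longrightarrow> |X| \<le>o |K| \<Longrightarrow> \<exists>b<s. \<forall>x\<in>X. x < b"
  unfolding cof_above_def by blast

lemma not_cof_aboveD:
  assumes "\<not> cof_above s K"
  shows "\<exists>X\<subseteq>{..<s}. |X| \<le>o |K| \<and> (\<forall>b<s. \<exists>x\<in>X. b \<le> x)"
proof -
  obtain X where X: "X \<subseteq> {..<s}" "|X| \<le>o |K|" "\<not> (\<exists>b<s. \<forall>x\<in>X. x < b)"
    using assms unfolding cof_above_def by blast
  have "\<exists>x\<in>X. b \<le> x" if "b < s" for b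
  proof (rule ccontr)
    assume "\<not> (\<exists>x\<in>X. b \<le> x)"
    then have "\<forall>x\<in>X. x < b" by (simp add: not_le)
    then show False using X(3) that by blast
  qed
  then show ?thesis using X(1,2) by blast
qed

lemma cof_above_mono:
  "cof_above s K' \<Longrightarrow> |K| \<le>o |K'| \<Longrightarrow> cof_above s K"
  unfolding cof_above_def using ordLeq_transitive by blast

lemma cof_above_image:
  assumes "cof_above s K" "|J| \<le>o |K|" "\<And>j. j \<in> J \<Longrightarrow> g j < s"
  shows "\<exists>b<s. \<forall>j\<in>J. g j < b"
proof -
  have "|g ` J| \<le>o |K|"
    using card_of_image ordLeq_transitive assms(2) by blast
  then show ?thesis
    using cof_aboveD[OF assms(1), of "g ` J"] assms(3) by auto
qed

lemma cof_above_finite: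
  assumes "cof_above s (UNIV :: nat set)" "finite X"
  shows "cof_above s X"
proof (rule cof_above_mono[OF assms(1)])
  have "|X| <o |UNIV :: nat set|"
    by (rule finite_ordLess_infinite[OF card_of_Well_order card_of_Well_order])
      (simp_all add: assms(2) Field_card_of)
  then show "|X| \<le>o |UNIV :: nat set|" by (rule ordLess_imp_ordLeq)
qed

lemma cof_above_two:
  assumes "cof_above s (UNIV :: nat set)" "x < s" "y < s"
  shows "\<exists>b<s. x < b \<and> y < b"
  using cof_aboveD[OF cof_above_finite[OF assms(1), of "{x, y}"], of "{x, y}"] assms(2,3)
    ordLeq_refl[OF card_of_Card_order] by auto

lemma cof_above_nonempty:
  "cof_above s K \<Longrightarrow> \<exists>b. b < s"
  using cof_aboveD[of s K "{}"] card_of_empty by blast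

lemma infinite_nat_ordLeq: "infinite K \<Longrightarrow> |UNIV :: nat set| \<le>o |K|"
  using infinite_iff_card_of_nat by blast

lemma card_of_union_ordLeq:
  "infinite K \<Longrightarrow> |X| \<le>o |K| \<Longrightarrow> |Y| \<le>o |K| \<Longrightarrow> |X \<union> Y| \<le>o |K|"
  using card_of_Un_ordLeq_infinite_Field[of "|K|" X Y]
  by (simp add: card_of_card_order_on Field_card_of)

lemma card_of_insert_ordLeq:
  assumes K: "infinite K" and X: "|X| \<le>o |K|"
  shows "|insert x X| \<le>o |K|"
proof -
  have "|{x}| \<le>o |K|"
    by (rule card_of_singl_ordLeq) (use K in auto)
  then show ?thesis using card_of_union_ordLeq[OF K X, of "{x}"] by simp
qed

lemma card_of_subset_ordLeq: "A \<subseteq> B \<Longrightarrow> |B| \<le>o r \<Longrightarrow> |A| \<le>o r"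
  by (rule ordLeq_transitive[OF card_of_mono1])

section \<open>Recursion, closure points and intersections of clubs\<close>

lemma wellorder_recursion:
  fixes G :: "('o::wellorder \<Rightarrow> 'b) \<Rightarrow> 'o \<Rightarrow> 'b"
  assumes "\<And>f g x. (\<And>z. z < x \<Longrightarrow> f z = g z) \<Longrightarrow> G f x = G g x"
  shows "\<exists>f. \<forall>x. f x = G f x"
proof (rule dependent_wellorder_choice[of "\<lambda>f x r. r = G f x"])
  fix r :: 'b and f g :: "'o \<Rightarrow> 'b" and x :: 'o
  assume "\<And>y. y < x \<Longrightarrow> f y = g y"
  then have "G f x = G g x" by (rule assms)
  then show "(r = G f x) = (r = G g x)" by simp
qed simp

text \<open>The supremum of the iterates of \<open>g\<close> at \<open>x\<close> works: uncountable
  cofinality keeps it below \<open>s\<close>, and by monotonicity every point below it is mapped to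
  at most a later iterate.\<close>

lemma closure_point_above:
  fixes g :: "'o::wellorder \<Rightarrow> 'o"
  assumes cof: "cof_above s (UNIV :: nat set)"
    and g: "\<And>z. z < s \<Longrightarrow> g z < s" "\<And>z. z < s \<Longrightarrow> z < g z"
    and mono: "\<And>z z'. z \<le> z' \<Longrightarrow> z' < s \<Longrightarrow> g z \<le> g z'"
    and x: "x < s"
  obtains y where "x < y" "y < s" "\<And>z. z < y \<Longrightarrow> g z < y"
proof -
  define xs where "xs n = (g ^^ n) x" for n
  have xs: "xs n < s" for n
    by (induction n) (auto simp: xs_def x g)
  have step: "xs (Suc n) = g (xs n)" for n
    by (simp add: xs_def)
  obtain b where b: "b < s" "\<And>n. xs n < b"
    using cof_above_image[OF cof, of "UNIV :: nat set" xs] xs ordLeq_refl[OF card_of_Card_order]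
    by blast
  define y where "y = (LEAST y. \<forall>n. xs n < y)"
  have y: "xs n < y" for n
    unfolding y_def by (rule LeastI2[of _ b]) (use b in auto)
  have "y \<le> b"
    unfolding y_def by (rule Least_le) (use b in auto)
  show ?thesis
  proof
    show "x < y" using y[of 0] by (simp add: xs_def)
    show "y < s" using \<open>y \<le> b\<close> b by auto
    fix z assume "z < y"
    then have "\<not> (\<forall>n. xs n < z)" unfolding y_def using not_less_Least by blast
    then obtain n where "z \<le> xs n" by (auto simp: not_less)
    then have "g z \<le> g (xs n)" using mono xs by blast
    then show "g z < y" using y[of "Suc n"] step[of n] by auto
  qed
qed

text \<open>The first conjunct excludes the least ordinal, for which the second is vacuous.\<close>

definition lim_pt :: "'o::wellorder set \<Rightarrow> 'o \<Rightarrow> bool" where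
  "lim_pt D x \<longleftrightarrow> (\<exists>y. y < x) \<and> (\<forall>y<x. \<exists>z\<in>D. y < z \<and> z < x)"

definition closed_unbounded :: "'o::wellorder \<Rightarrow> 'o set \<Rightarrow> bool" where
  "closed_unbounded s D \<longleftrightarrow>
     D \<subseteq> {..<s} \<and> (\<forall>x<s. \<exists>y\<in>D. x < y) \<and> (\<forall>x<s. lim_pt D x \<longrightarrow> x \<in> D)"

lemma lim_pt_mono: "lim_pt D x \<Longrightarrow> D \<subseteq> D' \<Longrightarrow> lim_pt D' x"
  unfolding lim_pt_def by blast

text \<open>A closure point of a map that jumps past the next element of every \<open>E j\<close> is
  a limit point of each \<open>E j\<close>; since the cofinality of \<open>s\<close> exceeds
  \<open>|J|\<close>, the map stays below \<open>s\<close>.\<close>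

lemma closed_unbounded_Inter:
  fixes s :: "'o::wellorder"
  assumes nat: "cof_above s (UNIV :: nat set)" and J: "cof_above s J"
    and E: "\<And>j. j \<in> J \<Longrightarrow> closed_unbounded s (E j)"
  shows "closed_unbounded s {x. x < s \<and> (\<forall>j\<in>J. x \<in> E j)}"
proof -
  define nx where "nx j z = (LEAST e. e \<in> E j \<and> z < e)" for j z
  have nx: "nx j z \<in> E j \<and> z < nx j z" if j: "j \<in> J" and z: "z < s" for j z
  proof -
    obtain e where "e \<in> E j \<and> z < e" using E[OF j] z unfolding closed_unbounded_def by blast
    then show ?thesis unfolding nx_def by (rule LeastI)
  qed
  have nx_s: "nx j z < s" if "j \<in> J" "z < s" for j z
    using nx[OF that] E[OF that(1)] unfolding closed_unbounded_def by blast
  have nx_mono: "nx j z \<le> nx j z'" if "j \<in> J" "z \<le> z'" "z' < s" for j z z'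
    unfolding nx_def[of j z] by (rule Least_le) (use nx[OF that(1,3)] that(2) in auto)
  define g where "g z = (LEAST b. (\<forall>j\<in>J. nx j z < b) \<and> z < b)" for z
  have ex: "\<exists>b<s. (\<forall>j\<in>J. nx j z < b) \<and> z < b" if z: "z < s" for z
  proof -
    obtain b where b: "b < s" "\<forall>j\<in>J. nx j z < b"
      using cof_above_image[OF J ordLeq_refl[OF card_of_Card_order], of "\<lambda>j. nx j z"] nx_s z
      by blast
    obtain b' where "b' < s" "b < b'" "z < b'" using cof_above_two[OF nat b(1) z] by blast
    then show ?thesis using b by (meson less_trans)
  qed
  have g: "(\<forall>j\<in>J. nx j z < g z) \<and> z < g z" if "z < s" for z
    unfolding g_def by (rule LeastI_ex) (use ex[OF that] in blast)
  have g_s: "g z < s" if z: "z < s" for z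
  proof -
    obtain b where b: "b < s" "(\<forall>j\<in>J. nx j z < b) \<and> z < b" using ex[OF z] by blast
    have "g z \<le> b" unfolding g_def by (rule Least_le) (rule b(2))
    then show ?thesis using b(1) by simp
  qed
  have g_mono: "g z \<le> g z'" if "z \<le> z'" "z' < s" for z z'
    unfolding g_def[of z]
    by (rule Least_le) (use g[OF that(2)] nx_mono that in \<open>meson le_less_trans\<close>)
  show ?thesis
    unfolding closed_unbounded_def
  proof (intro conjI allI impI)
    fix x assume "x < s"
    then obtain y where y: "x < y" "y < s" "\<And>z. z < y \<Longrightarrow> g z < y"
      using closure_point_above[of s g x, OF nat g_s _ g_mono] g by metis
    have "y \<in> E j" if j: "j \<in> J" for j
    proof -
      have "lim_pt (E j) y"
        unfolding lim_pt_def
      proof (intro conjI allI impI)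
        show "\<exists>z. z < y" using y by blast
        fix u assume "u < y"
        then have "u < s" using y by auto
        then show "\<exists>z\<in>E j. u < z \<and> z < y"
          using nx[OF j \<open>u < s\<close>] g[OF \<open>u < s\<close>] y(3)[OF \<open>u < y\<close>] j by (meson less_trans)
      qed
      then show ?thesis using E[OF j] y(2) unfolding closed_unbounded_def by blast
    qed
    then show "\<exists>y\<in>{x. x < s \<and> (\<forall>j\<in>J. x \<in> E j)}. x < y" using y by blast
  next
    fix x assume x: "x < s" "lim_pt {x. x < s \<and> (\<forall>j\<in>J. x \<in> E j)} x"
    have "x \<in> E j" if j: "j \<in> J" for j
      using lim_pt_mono[OF x(2), of "E j"] j E[OF j] x(1) unfolding closed_unbounded_def by blast
    then show "x \<in> {x. x < s \<and> (\<forall>j\<in>J. x \<in> E j)}" using x by blast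
  qed auto
qed

lemma closed_unbounded_Int:
  assumes "cof_above s (UNIV :: nat set)" "closed_unbounded s D" "closed_unbounded s E"
  shows "closed_unbounded s (D \<inter> E)"
proof -
  have "closed_unbounded s {x. x < s \<and> (\<forall>j\<in>UNIV. x \<in> (if j then D else E))}"
    by (rule closed_unbounded_Inter[OF assms(1) cof_above_finite[OF assms(1)]]) (use assms in auto)
  moreover have "{x. x < s \<and> (\<forall>j\<in>UNIV. x \<in> (if j then D else E))} = D \<inter> E"
    using assms(2,3) unfolding closed_unbounded_def by (auto split: if_splits)
  ultimately show ?thesis by simp
qed

text \<open>The successor cardinal as an initial ordinal. If the type has no ordinal of larger
  cardinality the value is unspecified, hence premises such as
  \<open>\<not> |{..<next_card x}| \<le>o |{..<x}|\<close> below.\<close>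

definition next_card :: "'o::wellorder \<Rightarrow> 'o" where
  "next_card x = (LEAST y. \<not> |{..<y}| \<le>o |{..<x}| )"

lemma below_next_card: "y < next_card x \<Longrightarrow> |{..<y}| \<le>o |{..<x}|"
  unfolding next_card_def using not_less_Least by blast

lemma next_card_not_le:
  assumes "\<not> |{..<y}| \<le>o |{..<x}|"
  shows "\<not> |{..<next_card x}| \<le>o |{..<x}|" "next_card x \<le> y"
  unfolding next_card_def by (rule LeastI, fact) (rule Least_le, fact)

text \<open>Regularity of successor cardinals: an unbounded \<open>X\<close> of size at most
  \<open>|{..<x}|\<close> would cover \<open>next_card x\<close> by that many segments, each of at
  most that size.\<close>

lemma cof_above_next_card:
  fixes x :: "'o::wellorder"
  assumes nc: "\<not> |{..<next_card x}| \<le>o |{..<x}|" and inf: "infinite {..<x}"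
  shows "cof_above (next_card x) {..<x}"
  unfolding cof_above_def
proof (intro allI impI)
  fix X assume X: "X \<subseteq> {..<next_card x}" "|X| \<le>o |{..<x}|"
  show "\<exists>b<next_card x. \<forall>y\<in>X. y < b"
  proof (rule ccontr)
    assume "\<not> ?thesis"
    then have "\<exists>y\<in>X. b \<le> y" if "b < next_card x" for b
      using that by (simp add: not_less[symmetric])
    then have sub: "{..<next_card x} \<subseteq> (\<Union>y\<in>X. insert y {..<y})" by (auto simp: le_less)
    have "|\<Union>y\<in>X. insert y {..<y}| \<le>o |{..<x}|"
    proof (rule card_of_UNION_ordLeq_infinite[OF inf X(2)], rule ballI)
      fix y assume "y \<in> X"
      then have "y < next_card x" using X(1) by auto
      then show "|insert y {..<y}| \<le>o |{..<x}|"
        by (rule card_of_insert_ordLeq[OF inf below_next_card])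
    qed
    then show False using nc card_of_subset_ordLeq[OF sub] by blast
  qed
qed

text \<open>The least ordinal creates no new limit points. With it in a club, every ordinal below
  \<open>s\<close> has a largest element of the club at or below it.\<close>

lemma closed_unbounded_insert_least:
  assumes "closed_unbounded s D" "\<And>x. b \<le> x" "b < s"
  shows "closed_unbounded s (insert b D)"
proof -
  have "lim_pt D x" if x: "lim_pt (insert b D) x" for x
    unfolding lim_pt_def
  proof (intro conjI allI impI)
    show "\<exists>y. y < x" using x unfolding lim_pt_def by blast
    fix y assume "y < x"
    then obtain z where z: "z \<in> insert b D" "y < z" "z < x" using x unfolding lim_pt_def by blast
    have "z \<noteq> b" using z(2) assms(2)[of y] by auto
    then show "\<exists>z\<in>D. y < z \<and> z < x" using z by blast
  qed
  then show ?thesis using assms unfolding closed_unbounded_def by blast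
qed

text \<open>
  Shelah's trick: if a guessing sequence fails for a club \<open>E\<close>, replace each of its ladders by the
  set of largest elements of \<open>E\<close> below the rungs. Repeating this along decreasing clubs must stop,
  since each rung can only move down finitely often.
\<close>

theorem club_guessing:
  fixes s p q k :: "'o::wellorder"
  assumes inf: "infinite {..<k}"
    and q: "\<not> |{..<q}| \<le>o |{..<k}|" and p: "cof_above p {..<q}" and s: "cof_above s {..<p}"
  shows "\<exists>C :: 'o \<Rightarrow> 'o set. \<forall>D. closed_unbounded s D \<longrightarrow>
           (\<exists>\<alpha><s. C \<alpha> \<subseteq> D \<and> \<not> |C \<alpha>| \<le>o |{..<k}| )"
proof (rule ccontr)
  assume contr: "\<not> ?thesis"
  have kq: "|{..<k}| \<le>o |{..<q}|"
    using q by (meson card_of_Well_order not_ordLeq_iff_ordLess ordLess_imp_ordLeq)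
  have "q \<le> p"
  proof (rule ccontr)
    assume "\<not> q \<le> p"
    then have "|{..<p}| \<le>o |{..<q}|" by (intro card_of_mono1) auto
    then show False using cof_aboveD[OF p subset_refl] by auto
  qed
  then have qp: "|{..<q}| \<le>o |{..<p}|" by (intro card_of_mono1) auto
  have s_q: "cof_above s {..<q}" using cof_above_mono[OF s qp] .
  have nat_k: "|UNIV :: nat set| \<le>o |{..<k}|" using inf infinite_nat_ordLeq by blast
  have nat_q: "|UNIV :: nat set| \<le>o |{..<q}|" using nat_k kq ordLeq_transitive by blast
  have s_nat: "cof_above s (UNIV :: nat set)" using cof_above_mono[OF s_q nat_q] .
  have p_nat: "cof_above p (UNIV :: nat set)" using cof_above_mono[OF p nat_q] .
  define bt :: 'o where "bt = (LEAST x. True)"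
  have bt: "bt \<le> x" for x unfolding bt_def by (rule Least_le) simp
  have bt_s: "bt < s" using cof_above_nonempty[OF s] bt le_less_trans by blast
  \<comment> \<open>A ladder: a cofinal subset of \<open>\<alpha>\<close> of size at most
    \<open>|{..<q}|\<close>. Where none exists the choice is arbitrary; the argument ends at an
    \<open>\<alpha>\<close> that has one.\<close>
  define c where "c \<alpha> = (SOME c. c \<subseteq> {..<\<alpha>} \<and> |c| \<le>o |{..<q}| \<and> (\<forall>x<\<alpha>. \<exists>y\<in>c. x \<le> y))" for \<alpha> :: 'o
  define drp where "drp E \<gamma> = (LEAST u. \<forall>e\<in>E. e \<le> \<gamma> \<longrightarrow> e \<le> u)" for E and \<gamma> :: 'o
  have drp_le: "drp E \<gamma> \<le> \<gamma>" for E \<gamma> unfolding drp_def by (rule Least_le) simp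
  have drp_ge: "e \<le> drp E \<gamma>" if "e \<in> E" "e \<le> \<gamma>" for e E \<gamma>
    unfolding drp_def by (rule LeastI2[of _ \<gamma>]) (use that in auto)
  have drp_mono: "drp E \<gamma> \<le> drp E' \<gamma>" if "E \<subseteq> E'" for E E' \<gamma>
    unfolding drp_def[of E] by (rule Least_le) (use that drp_ge in blast)
  have drp_in: "drp E \<gamma> \<in> E" if E: "closed_unbounded s E" "bt \<in> E" and "\<gamma> < s" for E \<gamma>
  proof (rule ccontr)
    assume n: "drp E \<gamma> \<notin> E"
    have "lim_pt E (drp E \<gamma>)"
      unfolding lim_pt_def
    proof (intro conjI allI impI)
      show "\<exists>y. y < drp E \<gamma>" using n E(2) bt by (metis le_less)
      fix y assume "y < drp E \<gamma>"
      then have "\<not> (\<forall>e\<in>E. e \<le> \<gamma> \<longrightarrow> e \<le> y)" unfolding drp_def using not_less_Least by blast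
      then obtain e where e: "e \<in> E" "e \<le> \<gamma>" "y < e" by force
      then show "\<exists>z\<in>E. y < z \<and> z < drp E \<gamma>" using drp_ge[OF e(1,2)] n by (metis le_less)
    qed
    moreover have "drp E \<gamma> < s" using drp_le[of E \<gamma>] \<open>\<gamma> < s\<close> by simp
    ultimately show False using n E(1) unfolding closed_unbounded_def by blast
  qed
  \<comment> \<open>The value \<open>bt\<close> is discarded because it belongs to the clubs below
    by decree and need not lie in the club \<open>Dd E\<close> that defeats the guess.\<close>
  define CC where "CC E \<alpha> = drp E ` c \<alpha> - {bt}" for E \<alpha>
  have "\<forall>E. \<exists>D. closed_unbounded s D \<and> (\<forall>\<alpha><s. CC E \<alpha> \<subseteq> D \<longrightarrow> |CC E \<alpha>| \<le>o |{..<k}| )"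
    using contr by blast
  then obtain Dd where Dd: "\<And>E. closed_unbounded s (Dd E)"
      "\<And>E \<alpha>. \<alpha> < s \<Longrightarrow> CC E \<alpha> \<subseteq> Dd E \<Longrightarrow> |CC E \<alpha>| \<le>o |{..<k}|"
    by metis
  \<comment> \<open>A decreasing sequence of clubs: each one refines every earlier
    \<open>E j\<close> together with the club witnessing that the ladders glued to
    \<open>E j\<close> fail.\<close>
  have "\<exists>E :: 'o \<Rightarrow> 'o set. \<forall>i. E i = {x. x < s \<and> (\<forall>j\<in>{..<i}. x \<in> E j \<inter> insert bt (Dd (E j)))}"
    by (rule wellorder_recursion, intro Collect_cong conj_cong refl ball_cong) auto
  then obtain E :: "'o \<Rightarrow> 'o set"
    where E: "\<And>i. E i = {x. x < s \<and> (\<forall>j\<in>{..<i}. x \<in> E j \<inter> insert bt (Dd (E j)))}" by blast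
  have s_i: "cof_above s {..<i}" if "i \<le> p" for i
    by (rule cof_above_mono[OF s]) (use that in \<open>intro card_of_mono1, auto\<close>)
  have E_club: "closed_unbounded s (E i) \<and> bt \<in> E i" if "i \<le> p" for i
    using that
  proof (induction i rule: less_induct)
    case (less i)
    have "closed_unbounded s (E j \<inter> insert bt (Dd (E j)))" if "j \<in> {..<i}" for j
    proof -
      have "closed_unbounded s (E j)" using less that by auto
      then show ?thesis
        by (rule closed_unbounded_Int[OF s_nat _ closed_unbounded_insert_least[OF Dd(1) bt bt_s]])
    qed
    then have "closed_unbounded s (E i)"
      using closed_unbounded_Inter[OF s_nat s_i[OF less.prems], of "\<lambda>j. E j \<inter> insert bt (Dd (E j))"]
      by (subst E) blast
    moreover have "bt \<in> E i" by (subst E) (use less bt_s in auto)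
    ultimately show ?case ..
  qed
  have E_anti: "E j \<subseteq> E i" if "i < j" for i j using E[of j] that by auto
  define Ei where "Ei = E p"
  have "\<not> |Ei| \<le>o |{..<q}|"
  proof
    assume "|Ei| \<le>o |{..<q}|"
    then obtain b where "b < s" "\<forall>x\<in>Ei. x < b"
      using cof_aboveD[OF s_q, of Ei] E_club[of p] unfolding Ei_def closed_unbounded_def by blast
    then show False using E_club[of p] unfolding Ei_def closed_unbounded_def by fastforce
  qed
  then have "|{..<q}| \<le>o |Ei|"
    by (meson card_of_Well_order not_ordLeq_iff_ordLess ordLess_imp_ordLeq)
  then obtain X where X: "X \<subseteq> Ei" "|{..<q}| =o |X|"
    using internalize_card_of_ordLeq2[of "{..<q}" Ei] by blast
  have Xq: "|X| \<le>o |{..<q}|" using X(2) ordIso_iff_ordLeq by blast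
  have X_k: "\<not> |X| \<le>o |{..<k}|" using X(2) q ordIso_ordLeq_trans by blast
  have X_s: "X \<subseteq> {..<s}" using X(1) E_club[of p] unfolding Ei_def closed_unbounded_def by blast
  obtain b where b: "b < s" "\<forall>x\<in>X. x < b" using cof_aboveD[OF s_q X_s Xq] by blast
  have "X \<inter> {..<b} = X" using b by auto
  then have b': "\<not> |X \<inter> {..<b}| \<le>o |{..<k}|" using X_k by simp
  \<comment> \<open>Minimality makes every cofinal subset of \<open>\<alpha>\<close> larger than
    \<open>|{..<k}|\<close>, while the trace of \<open>X\<close> is cofinal of size at most
    \<open>|{..<q}|\<close>. So \<open>c \<alpha>\<close> is a true ladder, and any set cofinal in
    \<open>\<alpha>\<close> is too big for the failure in \<open>Dd\<close>.\<close>
  define \<alpha> where "\<alpha> = (LEAST a. \<not> |X \<inter> {..<a}| \<le>o |{..<k}| )"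
  have \<alpha>: "\<not> |X \<inter> {..<\<alpha>}| \<le>o |{..<k}|" unfolding \<alpha>_def by (rule LeastI) (fact b')
  have "\<alpha> \<le> b" unfolding \<alpha>_def by (rule Least_le) (fact b')
  then have \<alpha>_s: "\<alpha> < s" using b by simp
  have \<alpha>_min: "|X \<inter> {..<y}| \<le>o |{..<k}|" if "y < \<alpha>" for y
    using that not_less_Least unfolding \<alpha>_def by blast
  have \<alpha>_min': "|insert y (X \<inter> {..<y})| \<le>o |{..<k}|" if "y < \<alpha>" for y
    using card_of_insert_ordLeq[OF inf \<alpha>_min[OF that]] .
  have X_unb: "\<exists>z\<in>X. y < z \<and> z < \<alpha>" if "y < \<alpha>" for y
  proof (rule ccontr)
    assume "\<not> ?thesis"
    then have "X \<inter> {..<\<alpha>} \<subseteq> insert y (X \<inter> {..<y})" by force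
    then show False using \<alpha>_min'[OF that] \<alpha> card_of_subset_ordLeq by blast
  qed
  have small: "\<not> |Y| \<le>o |{..<k}|" if Y: "Y \<subseteq> {..<\<alpha>}" "\<And>x. x < \<alpha> \<Longrightarrow> \<exists>y\<in>Y. x \<le> y" for Y
  proof
    assume "|Y| \<le>o |{..<k}|"
    then have "|\<Union>y\<in>Y. insert y (X \<inter> {..<y})| \<le>o |{..<k}|"
      by (rule card_of_UNION_ordLeq_infinite[OF inf]) (use Y \<alpha>_min' in blast)
    moreover have "X \<inter> {..<\<alpha>} \<subseteq> (\<Union>y\<in>Y. insert y (X \<inter> {..<y}))" using Y(2) by fastforce
    ultimately show False using \<alpha> card_of_subset_ordLeq by blast
  qed
  have "X \<inter> {..<\<alpha>} \<subseteq> {..<\<alpha>} \<and> |X \<inter> {..<\<alpha>}| \<le>o |{..<q}| \<and> (\<forall>x<\<alpha>. \<exists>y\<in>X \<inter> {..<\<alpha>}. x \<le> y)"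
  proof (intro conjI allI impI)
    show "|X \<inter> {..<\<alpha>}| \<le>o |{..<q}|"
      by (rule card_of_subset_ordLeq[OF _ Xq]) simp
  qed (use X_unb in \<open>auto intro: less_imp_le\<close>)
  then have c\<alpha>: "c \<alpha> \<subseteq> {..<\<alpha>} \<and> |c \<alpha>| \<le>o |{..<q}| \<and> (\<forall>x<\<alpha>. \<exists>y\<in>c \<alpha>. x \<le> y)"
    unfolding c_def by (rule someI)
  \<comment> \<open>As the clubs shrink, \<open>drp (E j) \<gamma>\<close> can only go down, so it
    is constant from the stage where it attains its minimum.\<close>
  have "\<exists>i<p. \<forall>j. i \<le> j \<and> j < p \<longrightarrow> drp (E j) \<gamma> = drp (E i) \<gamma>" for \<gamma>
  proof -
    define m where "m = (LEAST m. \<exists>i<p. m = drp (E i) \<gamma>)"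
    have "\<exists>m. \<exists>i<p. m = drp (E i) \<gamma>" using cof_above_nonempty[OF p] by blast
    then have "\<exists>i<p. m = drp (E i) \<gamma>" unfolding m_def by (rule LeastI_ex)
    then obtain i where i: "i < p" "m = drp (E i) \<gamma>" by blast
    have "drp (E j) \<gamma> = drp (E i) \<gamma>" if "i \<le> j" "j < p" for j
    proof (rule antisym)
      show "drp (E j) \<gamma> \<le> drp (E i) \<gamma>" using E_anti[of i j] that drp_mono by (cases "i = j") auto
      show "drp (E i) \<gamma> \<le> drp (E j) \<gamma>"
        unfolding i(2)[symmetric] m_def by (rule Least_le) (use that in blast)
    qed
    then show ?thesis using i(1) by blast
  qed
  then obtain ig where ig: "\<And>\<gamma>. ig \<gamma> < p" "\<And>\<gamma> j. ig \<gamma> \<le> j \<Longrightarrow> j < p \<Longrightarrow> drp (E j) \<gamma> = drp (E (ig \<gamma>)) \<gamma>"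
    by metis
  obtain i where i: "i < p" "\<And>\<gamma>. \<gamma> \<in> c \<alpha> \<Longrightarrow> ig \<gamma> < i"
    using cof_above_image[OF p, of "c \<alpha>" ig] c\<alpha> ig(1) by blast
  obtain j where j: "j < p" "i < j" using cof_above_two[OF p_nat i(1) i(1)] by blast
  \<comment> \<open>All rungs have settled by stage \<open>i\<close>, so their values can be
    computed from a later club \<open>E j\<close>, which lies inside \<open>Dd (E i)\<close> apart
    from \<open>bt\<close>.\<close>
  have "CC (E i) \<alpha> \<subseteq> Dd (E i)"
  proof
    fix x assume "x \<in> CC (E i) \<alpha>"
    then obtain \<gamma> where \<gamma>: "\<gamma> \<in> c \<alpha>" "x = drp (E i) \<gamma>" "x \<noteq> bt" unfolding CC_def by blast
    have "\<gamma> < s" using \<gamma>(1) c\<alpha> \<alpha>_s by (meson lessThan_iff less_trans subsetD)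
    have "ig \<gamma> < i" using i(2)[OF \<gamma>(1)] .
    then have "x = drp (E j) \<gamma>" using ig(2)[of \<gamma> i] ig(2)[of \<gamma> j] i j \<gamma>(2) by auto
    then have "x \<in> E j" using drp_in E_club[of j] j \<open>\<gamma> < s\<close> by auto
    then show "x \<in> Dd (E i)" using E[of j] j \<gamma>(3) by auto
  qed
  then have "|CC (E i) \<alpha>| \<le>o |{..<k}|" using Dd(2)[OF \<alpha>_s] by blast
  moreover have "\<not> |CC (E i) \<alpha>| \<le>o |{..<k}|"
  proof (rule small)
    show "CC (E i) \<alpha> \<subseteq> {..<\<alpha>}" using c\<alpha> drp_le unfolding CC_def by (auto intro: le_less_trans)
    fix x assume "x < \<alpha>"
    then obtain e where e: "e \<in> X" "x < e" "e < \<alpha>" using X_unb by blast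
    obtain \<gamma> where \<gamma>: "\<gamma> \<in> c \<alpha>" "e \<le> \<gamma>" using c\<alpha> e by blast
    have "e \<in> E i" using e(1) X(1) E_anti[OF i(1)] unfolding Ei_def by blast
    then have "e \<le> drp (E i) \<gamma>" using drp_ge \<gamma> by blast
    then have "x < drp (E i) \<gamma>" using e(2) by (rule less_le_trans[rotated])
    moreover from this have "drp (E i) \<gamma> \<noteq> bt" using bt[of x] by auto
    ultimately have "drp (E i) \<gamma> \<in> CC (E i) \<alpha>" "x \<le> drp (E i) \<gamma>"
      using \<gamma>(1) unfolding CC_def by auto
    then show "\<exists>y\<in>CC (E i) \<alpha>. x \<le> y" by blast
  qed
  ultimately show False by blast
qed

section \<open>Exact upper bounds and scales\<close>

definition proj :: "'o::wellorder set \<Rightarrow> 'o \<Rightarrow> 'o" where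
  "proj S x = (LEAST y. y \<in> S \<and> x \<le> y)"

lemma proj:
  assumes "\<exists>y\<in>S. x \<le> y"
  shows "proj S x \<in> S" "x \<le> proj S x"
proof -
  have "proj S x \<in> S \<and> x \<le> proj S x"
    unfolding proj_def by (rule LeastI_ex) (use assms in blast)
  then show "proj S x \<in> S" "x \<le> proj S x" by auto
qed

lemma proj_le: "y \<in> S \<Longrightarrow> x \<le> y \<Longrightarrow> proj S x \<le> y"
  unfolding proj_def by (rule Least_le) simp

lemma proj_mono: "x \<le> x' \<Longrightarrow> \<exists>y\<in>S. x' \<le> y \<Longrightarrow> proj S x \<le> proj S x'"
  using proj[of S x'] by (intro proj_le) auto

lemma increasing_mono:
  fixes f :: "'o::wellorder \<Rightarrow> 'a \<Rightarrow> 'o"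
  assumes "\<And>x y. x < y \<Longrightarrow> y < T \<Longrightarrow> \<forall>\<^sub>F a in Fi. f x a < f y a" "x \<le> y" "y < T"
  shows "\<forall>\<^sub>F a in Fi. f x a \<le> f y a"
proof (cases "x = y")
  case False
  then have "\<forall>\<^sub>F a in Fi. f x a < f y a" using assms by simp
  then show ?thesis by (rule eventually_mono) simp
qed simp

text \<open>
  If every projection failed to bound the sequence, one could build \<open>xi\<close> of length \<open>s\<close> such that each
  step jumps over the projection of an earlier function, and whose values at a guessed set of indices
  increase strictly at a common \<open>a\<close>. This produces too many elements of \<open>S a\<close>.
\<close>

theorem bounding_projection:
  fixes Fi :: "'a filter" and f :: "'o::wellorder \<Rightarrow> 'a \<Rightarrow> 'o" and A :: "'a set"
    and T s p q k :: 'o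
  assumes inc: "\<And>x y. x < y \<Longrightarrow> y < T \<Longrightarrow> \<forall>\<^sub>F a in Fi. f x a < f y a"
    and A: "\<forall>\<^sub>F a in Fi. a \<in> A" "|A| \<le>o |{..<k}|"
    and inf: "infinite {..<k}" and q: "\<not> |{..<q}| \<le>o |{..<k}|"
    and p: "cof_above p {..<q}" and s: "cof_above s {..<p}" and T: "cof_above T {..<s}"
    and s_nat: "cof_above s (UNIV :: nat set)"
    and cont: "\<And>d. d < T \<Longrightarrow> \<exists>y. y < d \<Longrightarrow> \<forall>y<d. \<exists>z<d. y < z \<Longrightarrow>
      \<exists>E. closed_unbounded d E \<and> (\<forall>\<^sub>F a in Fi. \<forall>x\<in>E. f x a \<le> f d a)"
    and S: "\<And>a. |S a| \<le>o |{..<k}|"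
    and cov: "\<And>x. x < T \<Longrightarrow> \<forall>\<^sub>F a in Fi. \<exists>y\<in>S a. f x a \<le> y"
  shows "\<exists>x<T. \<forall>y<T. \<forall>\<^sub>F a in Fi. f y a \<le> proj (S a) (f x a)"
proof (rule ccontr)
  assume contr: "\<not> ?thesis"
  \<comment> \<open>The index \<open>psi x\<close> names a function that exceeds the projection of
    \<open>f x\<close> on a set of coordinates not negligible for \<open>Fi\<close>.\<close>
  then have "\<exists>y. x < T \<longrightarrow> y < T \<and> \<not> (\<forall>\<^sub>F a in Fi. f y a \<le> proj (S a) (f x a))" for x by blast
  then obtain psi where psi: "\<And>x. x < T \<Longrightarrow> psi x < T"
      "\<And>x. x < T \<Longrightarrow> \<not> (\<forall>\<^sub>F a in Fi. f (psi x) a \<le> proj (S a) (f x a))"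
    by metis
  have psi_gt: "x < psi x" if x: "x < T" for x
  proof (rule ccontr)
    assume "\<not> x < psi x"
    then have "\<forall>\<^sub>F a in Fi. f (psi x) a \<le> f x a" using increasing_mono[where f = f and Fi = Fi, OF inc] x by simp
    then have "\<forall>\<^sub>F a in Fi. f (psi x) a \<le> proj (S a) (f x a)"
      using cov[OF x] by eventually_elim (auto intro: order_trans proj)
    then show False using psi(2)[OF x] by blast
  qed
  obtain C :: "'o \<Rightarrow> 'o set"
    where C: "\<And>D. closed_unbounded s D \<Longrightarrow> \<exists>\<alpha><s. C \<alpha> \<subseteq> D \<and> \<not> |C \<alpha>| \<le>o |{..<k}|"
    using club_guessing[OF inf q p s] by blast
  define bt :: 'o where "bt = (LEAST x. True)"
  have "bt \<le> x" for x unfolding bt_def by (rule Least_le) simp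
  then have bt_T: "bt < T" using cof_above_nonempty[OF T] le_less_trans by blast
  \<comment> \<open>An index whose function bounds all of \<open>Y\<close> on one set of the filter,
    uniformly in \<open>Y\<close>. If there is none the implication is vacuous and
    \<open>dom Y\<close> is the least ordinal, so \<open>dom\<close> is total with values below
    \<open>T\<close>.\<close>
  define dom where "dom Y = (LEAST e. (\<exists>e<T. \<forall>\<^sub>F a in Fi. \<forall>x\<in>Y. f x a \<le> f e a) \<longrightarrow>
    e < T \<and> (\<forall>\<^sub>F a in Fi. \<forall>x\<in>Y. f x a \<le> f e a))" for Y
  have dom: "dom Y < T \<and> (\<forall>\<^sub>F a in Fi. \<forall>x\<in>Y. f x a \<le> f (dom Y) a)"
    if "\<exists>e<T. \<forall>\<^sub>F a in Fi. \<forall>x\<in>Y. f x a \<le> f e a" for Y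
    using LeastI_ex[of "\<lambda>e. (\<exists>e<T. \<forall>\<^sub>F a in Fi. \<forall>x\<in>Y. f x a \<le> f e a) \<longrightarrow>
      e < T \<and> (\<forall>\<^sub>F a in Fi. \<forall>x\<in>Y. f x a \<le> f e a)"] that
    unfolding dom_def by blast
  have dom_T: "dom Y < T" for Y
  proof (cases "\<exists>e<T. \<forall>\<^sub>F a in Fi. \<forall>x\<in>Y. f x a \<le> f e a")
    case False
    then have "dom Y \<le> bt" unfolding dom_def by (intro Least_le) blast
    then show ?thesis using bt_T by simp
  qed (use dom in blast)
  \<comment> \<open>Which ladder will guess correctly is not known in advance, so step
    \<open>j\<close> passes the dominators of the initial segments of all \<open>s\<close> many
    ladders.\<close>
  define yy where "yy xi j = (LEAST y. xi j \<le> y \<and> (\<forall>\<alpha><s. dom (xi ` (C \<alpha> \<inter> {..j})) \<le> y))"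
    for xi :: "'o \<Rightarrow> 'o" and j
  \<comment> \<open>Taking suprema at every stage makes \<open>xi\<close> continuous; this is what
    pulls a club of \<open>d\<close> back to a club of \<open>s\<close>.\<close>
  have "\<exists>xi. \<forall>i. xi i = (LEAST x. \<forall>j<i. psi (yy xi j) \<le> x)"
  proof (rule wellorder_recursion)
    fix xi xi' :: "'o \<Rightarrow> 'o" and i
    assume eq: "\<And>z. z < i \<Longrightarrow> xi z = xi' z"
    have "yy xi j = yy xi' j" if "j < i" for j
    proof -
      have "xi ` (C \<alpha> \<inter> {..j}) = xi' ` (C \<alpha> \<inter> {..j})" for \<alpha>
        by (rule image_cong) (use eq that in auto)
      then show ?thesis unfolding yy_def eq[OF that] by simp
    qed
    then show "(LEAST x. \<forall>j<i. psi (yy xi j) \<le> x) = (LEAST x. \<forall>j<i. psi (yy xi' j) \<le> x)"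
      by (metis (no_types, lifting))
  qed
  then obtain xi where xi: "\<And>i. xi i = (LEAST x. \<forall>j<i. psi (yy xi j) \<le> x)" by blast
  define y where "y j = yy xi j" for j
  define N where "N j = psi (y j)" for j
  have xi_le: "xi i \<le> x" if "\<And>j. j < i \<Longrightarrow> N j \<le> x" for i x
  proof -
    have "\<forall>j<i. psi (yy xi j) \<le> x" using that by (simp add: N_def y_def)
    then have "(LEAST x. \<forall>j<i. psi (yy xi j) \<le> x) \<le> x"
      by (rule Least_le[of "\<lambda>x. \<forall>j<i. psi (yy xi j) \<le> x"])
    then show ?thesis unfolding xi[of i, symmetric] .
  qed
  have T_max: "\<exists>b<T. \<forall>j<s. g j \<le> b" if "\<And>j. j < s \<Longrightarrow> g j < T" for g
    using cof_above_image[OF T ordLeq_refl[OF card_of_Card_order], of g] that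
    by (meson lessThan_iff less_imp_le)
  have y: "xi j \<le> y j" "\<And>\<alpha>. \<alpha> < s \<Longrightarrow> dom (xi ` (C \<alpha> \<inter> {..j})) \<le> y j" "y j < T"
    if xij: "xi j < T" for j
  proof -
    obtain b where b: "b < T" "\<forall>\<alpha><s. dom (xi ` (C \<alpha> \<inter> {..j})) \<le> b" using T_max[of "\<lambda>\<alpha>. dom (xi ` (C \<alpha> \<inter> {..j}))"] dom_T by blast
    have m: "xi j \<le> max b (xi j) \<and> (\<forall>\<alpha><s. dom (xi ` (C \<alpha> \<inter> {..j})) \<le> max b (xi j))"
      using b by (auto simp: le_max_iff_disj)
    have "xi j \<le> y j \<and> (\<forall>\<alpha><s. dom (xi ` (C \<alpha> \<inter> {..j})) \<le> y j)"
      unfolding y_def yy_def by (rule LeastI) (rule m)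
    moreover have "y j \<le> max b (xi j)" unfolding y_def yy_def by (rule Least_le) (rule m)
    ultimately show "xi j \<le> y j" "\<And>\<alpha>. \<alpha> < s \<Longrightarrow> dom (xi ` (C \<alpha> \<inter> {..j})) \<le> y j" "y j < T"
      using le_less_trans[of "y j" "max b (xi j)" T] b(1) xij by auto
  qed
  have N_T: "N j < T" if "xi j < T" for j unfolding N_def using psi(1) y(3) that by blast
  have xi_N: "xi j < N j" if "xi j < T" for j
    unfolding N_def using psi_gt[OF y(3)[OF that]] y(1)[OF that] by simp
  have xi_T: "xi i < T" if "i < s" for i
    using that
  proof (induction i rule: less_induct)
    case (less i)
    have "N j < T" if "j < i" for j using N_T less that by (meson less_trans)
    moreover have "|{..<i}| \<le>o |{..<s}|" by (rule card_of_mono1) (use less in auto)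
    ultimately obtain b where "b < T" "\<forall>j\<in>{..<i}. N j < b"
      using cof_above_image[OF T, of "{..<i}" N] by auto
    then show ?case using xi_le[of i b] by (auto intro: le_less_trans less_imp_le)
  qed
  note y = y[OF xi_T] and N_T = N_T[OF xi_T] and xi_N = xi_N[OF xi_T]
  have N_xi: "N j \<le> xi i" if "j < i" "i < s" for i j
  proof -
    obtain b where b: "b < T" "\<forall>j<s. N j \<le> b" using T_max[of N] N_T by blast
    have "\<forall>j<i. psi (yy xi j) \<le> b" using b that by (auto simp: N_def y_def)
    then have "\<forall>j<i. psi (yy xi j) \<le> (LEAST x. \<forall>j<i. psi (yy xi j) \<le> x)"
      by (rule LeastI[of "\<lambda>x. \<forall>j<i. psi (yy xi j) \<le> x"])
    then have "\<forall>j<i. psi (yy xi j) \<le> xi i" unfolding xi[of i, symmetric] .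
    then show ?thesis using that by (simp add: N_def y_def)
  qed
  have xi_mono: "xi j < xi i" if "j < i" "i < s" for i j
    using xi_N[of j] N_xi[OF that] that by (meson less_le_trans less_trans)
  have xi_sup: "\<exists>j<i. u < N j" if "u < xi i" for u i
    using xi_le[of i u] that by (meson not_le)
  obtain b where b: "b < T" "\<forall>i\<in>{..<s}. xi i < b"
    using cof_above_image[OF T ordLeq_refl[OF card_of_Card_order], of xi] xi_T by blast
  define d where "d = (LEAST d. \<forall>i\<in>{..<s}. xi i < d)"
  have xi_d: "xi i < d" if "i < s" for i
    using LeastI[of "\<lambda>d. \<forall>i\<in>{..<s}. xi i < d" b] b(2) that unfolding d_def by blast
  have "d \<le> b" unfolding d_def by (rule Least_le) (rule b(2))
  then have d_T: "d < T" using b by simp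
  have d_xi: "\<exists>i<s. u \<le> xi i" if "u < d" for u
    using not_less_Least[of u "\<lambda>d. \<forall>i\<in>{..<s}. xi i < d"] that unfolding d_def by (auto simp: not_less)
  have d_xi': "\<exists>i<s. u < xi i \<and> j < i" if ud: "u < d" and js: "j < s" for u j
  proof -
    obtain i where i: "i < s" "u \<le> xi i" using d_xi ud by blast
    obtain i' where "i' < s" "i < i'" "j < i'" using cof_above_two[OF s_nat i(1) js] by blast
    then show ?thesis using i xi_mono[of i i'] by (meson le_less_trans)
  qed
  obtain bs where bs: "bs < s" using cof_above_nonempty[OF s] by blast
  have "\<exists>y. y < d" using xi_d[OF bs] by blast
  moreover have "\<forall>y<d. \<exists>z<d. y < z" using d_xi'[OF _ bs] xi_d by blast
  ultimately obtain E where E: "closed_unbounded d E" "\<forall>\<^sub>F a in Fi. \<forall>x\<in>E. f x a \<le> f d a"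
    using cont[OF d_T] by blast
  have E_lim: "xi i \<in> E" if "lim_pt E (xi i)" "i < s" for i
    using E(1) that xi_d unfolding closed_unbounded_def by blast
  \<comment> \<open>On \<open>E\<close> the functions are bounded by \<open>f d\<close> on a single
    set of coordinates. Hence, for a ladder inside \<open>D\<close>, every \<open>dom\<close> of an
    initial segment is a genuine dominator.\<close>
  define D where "D = {i. i < s \<and> xi i \<in> E}"
  have "closed_unbounded s D"
    unfolding closed_unbounded_def
  proof (intro conjI allI impI)
    show "D \<subseteq> {..<s}" unfolding D_def by auto
  next
    fix i0 assume i0: "i0 < s"
    define g where "g i = (LEAST i'. i < i' \<and> i' < s \<and> (\<exists>e\<in>E. xi i < e \<and> e < xi i'))" for i
    have g: "i < g i \<and> g i < s \<and> (\<exists>e\<in>E. xi i < e \<and> e < xi (g i))" if i: "i < s" for i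
      unfolding g_def
    proof (rule LeastI_ex)
      obtain e where e: "e \<in> E" "xi i < e" "e < d"
        using E(1) xi_d[OF i] unfolding closed_unbounded_def by blast
      then show "\<exists>i'. i < i' \<and> i' < s \<and> (\<exists>e\<in>E. xi i < e \<and> e < xi i')" using d_xi'[OF e(3) i] by blast
    qed
    have g_mono: "g i \<le> g k" if ik: "i \<le> k" "k < s" for i k
    proof -
      obtain e where e: "e \<in> E" "xi k < e" "e < xi (g k)" using g[OF ik(2)] by blast
      have "xi i \<le> xi k" using ik xi_mono by (cases "i = k") (auto intro: less_imp_le)
      then show ?thesis
        unfolding g_def[of i] using g[OF ik(2)] e ik by (intro Least_le) (meson le_less_trans)
    qed
    obtain c where c: "i0 < c" "c < s" "\<And>z. z < c \<Longrightarrow> g z < c"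
      using closure_point_above[of s g i0, OF s_nat _ _ g_mono i0] g by metis
    have "lim_pt E (xi c)"
      unfolding lim_pt_def
    proof (intro conjI allI impI)
      show "\<exists>y. y < xi c" using xi_mono c by blast
      fix u assume "u < xi c"
      then obtain j where j: "j < c" "u < N j" using xi_sup by blast
      have js: "j < s" using j c by simp
      have "N j \<le> xi (g j)" using N_xi g[OF js] by blast
      moreover obtain e where "e \<in> E" "xi (g j) < e" "e < xi (g (g j))" using g g[OF js] by blast
      moreover have "xi (g (g j)) < xi c" using xi_mono c j by blast
      ultimately show "\<exists>z\<in>E. u < z \<and> z < xi c" using j(2) by (meson less_le_trans less_trans)
    qed
    then show "\<exists>y\<in>D. i0 < y" using E_lim c unfolding D_def by blast
  next
    fix i assume i: "i < s" "lim_pt D i"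
    have "lim_pt E (xi i)"
      unfolding lim_pt_def
    proof (intro conjI allI impI)
      show "\<exists>y. y < xi i" using i xi_mono unfolding lim_pt_def by blast
      fix u assume "u < xi i"
      then obtain j where j: "j < i" "u < N j" using xi_sup by blast
      then obtain i' where i': "i' \<in> D" "j < i'" "i' < i" using i unfolding lim_pt_def by blast
      then have "i' < s" using i by simp
      then have "u < xi i'" using N_xi[OF i'(2)] j(2) by (meson less_le_trans)
      then show "\<exists>z\<in>E. u < z \<and> z < xi i" using i' xi_mono[OF i'(3) i(1)] unfolding D_def by blast
    qed
    then show "i \<in> D" using E_lim i unfolding D_def by blast
  qed
  then obtain \<alpha> where \<alpha>: "\<alpha> < s" "C \<alpha> \<subseteq> D" "\<not> |C \<alpha>| \<le>o |{..<k}|" using C by blast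
  have C_s: "j < s" "xi j \<in> E" if "j \<in> C \<alpha>" for j using \<alpha>(2) that unfolding D_def by auto
  \<comment> \<open>A possible last rung is removed, so that each remaining one has a next rung
    \<open>nj j\<close>.\<close>
  define C' where "C' = {j\<in>C \<alpha>. \<exists>j'\<in>C \<alpha>. j < j'}"
  have C'_k: "\<not> |C'| \<le>o |{..<k}|"
  proof
    assume le: "|C'| \<le>o |{..<k}|"
    show False
    proof (cases "C' = C \<alpha>")
      case True
      then show False using le \<alpha> by simp
    next
      case False
      then obtain m where "m \<in> C \<alpha>" "m \<notin> C'" unfolding C'_def by blast
      then have "C \<alpha> \<subseteq> insert m C'" unfolding C'_def using linorder_neqE by blast
      then show False using card_of_subset_ordLeq[OF _ card_of_insert_ordLeq[OF inf le]] \<alpha>(3) by blast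
    qed
  qed
  define nj where "nj j = (LEAST j'. j' \<in> C \<alpha> \<and> j < j')" for j
  have nj: "nj j \<in> C \<alpha> \<and> j < nj j" if "j \<in> C'" for j
    unfolding nj_def by (rule LeastI_ex) (use that in \<open>auto simp: C'_def\<close>)
  have nj_le: "nj j \<le> j'" if "j' \<in> C \<alpha>" "j < j'" for j j'
    unfolding nj_def by (rule Least_le) (use that in auto)
  define good where "good j a \<longleftrightarrow> a \<in> A \<and> (\<forall>j'\<in>C \<alpha>. j' \<le> j \<longrightarrow> f (xi j') a \<le> f (y j) a) \<and>
    f (N j) a \<le> f (xi (nj j)) a \<and> (\<exists>z\<in>S a. f (y j) a \<le> z)" for j a
  have good: "\<forall>\<^sub>F a in Fi. good j a" if j: "j \<in> C'" for j
  proof -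
    have js: "j < s" using j C_s unfolding C'_def by blast
    let ?Y = "xi ` (C \<alpha> \<inter> {..j})"
    have "?Y \<subseteq> E" using C_s by auto
    then have "\<exists>e<T. \<forall>\<^sub>F a in Fi. \<forall>x\<in>?Y. f x a \<le> f e a"
      using d_T eventually_mono[OF E(2), of "\<lambda>a. \<forall>x\<in>?Y. f x a \<le> f d a"] by blast
    then have "\<forall>\<^sub>F a in Fi. \<forall>x\<in>?Y. f x a \<le> f (dom ?Y) a" using dom by blast
    moreover have "\<forall>\<^sub>F a in Fi. f (dom ?Y) a \<le> f (y j) a"
      using increasing_mono[OF inc y(2)[OF js \<alpha>(1)] y(3)[OF js]] .
    moreover have "\<forall>\<^sub>F a in Fi. f (N j) a \<le> f (xi (nj j)) a"
      by (rule increasing_mono[OF inc N_xi xi_T]) (use nj[OF j] C_s in auto)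
    ultimately show ?thesis
      using A(1) cov[OF y(3)[OF js]] unfolding good_def
      by eventually_elim (auto intro: order_trans)
  qed
  \<comment> \<open>The jump over the projection happens frequently and \<open>good j\<close>
    eventually, so some coordinate has both.\<close>
  have "\<exists>a. j \<in> C' \<longrightarrow> good j a \<and> proj (S a) (f (y j) a) < f (N j) a" for j
  proof (rule ccontr)
    assume neg: "\<not> ?thesis"
    then have j: "j \<in> C'" by blast
    have "\<forall>\<^sub>F a in Fi. f (psi (y j)) a \<le> proj (S a) (f (y j) a)"
      using good[OF j]
    proof eventually_elim
      case (elim a)
      then show ?case using neg j unfolding N_def by (meson not_less)
    qed
    moreover have "y j < T" using y(3) j C_s unfolding C'_def by blast
    ultimately show False using psi(2) by blast
  qed
  then obtain aj where aj: "\<And>j. j \<in> C' \<Longrightarrow> good j (aj j) \<and> proj (S (aj j)) (f (y j) (aj j)) < f (N j) (aj j)"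
    by metis
  \<comment> \<open>For rungs assigned the same coordinate, the projection at one rung lies strictly
    below the value at the next, hence below the projection at any later rung. The rungs therefore
    inject into \<open>S a\<close>.\<close>
  have fiber: "|{j\<in>C'. aj j = a}| \<le>o |{..<k}|" for a
  proof -
    define h where "h j = proj (S a) (f (y j) a)" for j
    have h_less: "h j1 < h j2" if j: "j1 \<in> C'" "j2 \<in> C'" "aj j1 = a" "aj j2 = a" "j1 < j2" for j1 j2
    proof -
      have g: "good j1 a" "good j2 a" "h j1 < f (N j1) a" using aj[OF j(1)] aj[OF j(2)] j unfolding h_def by auto
      have "f (N j1) a \<le> f (xi (nj j1)) a" using g unfolding good_def by blast
      also have "nj j1 \<in> C \<alpha>" "nj j1 \<le> j2" using nj[OF j(1)] nj_le[OF _ j(5)] j(2) unfolding C'_def by auto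
      then have "f (xi (nj j1)) a \<le> f (y j2) a" using g(2) unfolding good_def by blast
      also have "\<dots> \<le> h j2" unfolding h_def by (rule proj(2)) (use g(2) good_def in blast)
      finally show ?thesis using g(3) by simp
    qed
    have "inj_on h {j\<in>C'. aj j = a}"
    proof (rule inj_onI)
      fix j1 j2 assume j: "j1 \<in> {j\<in>C'. aj j = a}" "j2 \<in> {j\<in>C'. aj j = a}" "h j1 = h j2"
      then show "j1 = j2" using h_less[of j1 j2] h_less[of j2 j1] by (cases j1 j2 rule: linorder_cases) auto
    qed
    moreover have "h ` {j\<in>C'. aj j = a} \<subseteq> S a"
    proof
      fix z assume "z \<in> h ` {j\<in>C'. aj j = a}"
      then obtain j where j: "j \<in> C'" "aj j = a" "z = h j" by blast
      then have "good j a" using aj by blast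
      then show "z \<in> S a" unfolding j(3) h_def good_def by (intro proj(1)) blast
    qed
    ultimately have "|{j\<in>C'. aj j = a}| \<le>o |S a|" using card_of_ordLeq by blast
    then show ?thesis by (rule ordLeq_transitive[OF _ S])
  qed
  have "|\<Union>a\<in>A. {j\<in>C'. aj j = a}| \<le>o |{..<k}|"
    by (rule card_of_UNION_ordLeq_infinite[OF inf A(2)]) (use fiber in blast)
  moreover have "C' \<subseteq> (\<Union>a\<in>A. {j\<in>C'. aj j = a})" using aj unfolding good_def by blast
  ultimately show False using C'_k card_of_subset_ordLeq by blast
qed

text \<open>
  Starting from \<open>{h0}\<close>, keep adding to the sets \<open>S i a\<close> a function witnessing that the current
  projection is not exact. The projections of a single late \<open>f X\<close> decrease with \<open>i\<close>, so they become
  constant before step \<open>q\<close>.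
\<close>

theorem exact_upper_bound:
  fixes Fi :: "'a filter" and f :: "'o::wellorder \<Rightarrow> 'a \<Rightarrow> 'o" and A :: "'a set"
    and T q k :: 'o
  assumes inc: "\<And>x y. x < y \<Longrightarrow> y < T \<Longrightarrow> \<forall>\<^sub>F a in Fi. f x a < f y a"
    and A: "\<forall>\<^sub>F a in Fi. a \<in> A" "|A| \<le>o |{..<k}|"
    and inf: "infinite {..<k}" and q: "\<And>y. y < q \<Longrightarrow> |{..<y}| \<le>o |{..<k}|" "cof_above q {..<k}"
    and T: "cof_above T {..<q}"
    and h0: "\<And>x. x < T \<Longrightarrow> \<forall>\<^sub>F a in Fi. f x a \<le> h0 a"
    and BP: "\<And>S. (\<And>a. |S a| \<le>o |{..<k}| ) \<Longrightarrow> (\<And>x. x < T \<Longrightarrow> \<forall>\<^sub>F a in Fi. \<exists>y\<in>S a. f x a \<le> y) \<Longrightarrow>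
      \<exists>x<T. \<forall>y<T. \<forall>\<^sub>F a in Fi. f y a \<le> proj (S a) (f x a)"
  shows "\<exists>H. (\<forall>\<^sub>F a in Fi. H a \<le> h0 a) \<and> (\<forall>x<T. \<forall>\<^sub>F a in Fi. f x a \<le> H a) \<and>
    (\<forall>g. (\<forall>\<^sub>F a in Fi. g a < H a) \<longrightarrow> (\<exists>x<T. \<forall>\<^sub>F a in Fi. g a < f x a))"
proof (rule ccontr)
  assume contr: "\<not> ?thesis"
  define ok where "ok S \<longleftrightarrow> (\<forall>a. |S a| \<le>o |{..<k}| \<and> h0 a \<in> S a)" for S
  have cov: "\<forall>\<^sub>F a in Fi. \<exists>y\<in>S a. f x a \<le> y" if "ok S" "x < T" for S x
    using h0[OF that(2)] by eventually_elim (use that(1) ok_def in blast)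
  have "\<exists>x. ok S \<longrightarrow> x < T \<and> (\<forall>y<T. \<forall>\<^sub>F a in Fi. f y a \<le> proj (S a) (f x a))" for S
    using BP[of S] cov[of S] unfolding ok_def by blast
  then obtain xS where xS: "\<And>S. ok S \<Longrightarrow> xS S < T"
      "\<And>S y. ok S \<Longrightarrow> y < T \<Longrightarrow> \<forall>\<^sub>F a in Fi. f y a \<le> proj (S a) (f (xS S) a)"
    by metis
  \<comment> \<open>The projection of \<open>f (xS S)\<close> is an upper bound below
    \<open>h0\<close>, so it fails to be exact; \<open>g S\<close> witnesses the failure.\<close>
  have "\<exists>g. ok S \<longrightarrow> (\<forall>\<^sub>F a in Fi. g a < proj (S a) (f (xS S) a)) \<and> (\<forall>x<T. \<not> (\<forall>\<^sub>F a in Fi. g a < f x a))" for S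
  proof (cases "ok S")
    case True
    have "\<forall>\<^sub>F a in Fi. proj (S a) (f (xS S) a) \<le> h0 a"
      using h0[OF xS(1)[OF True]] by eventually_elim (use True in \<open>auto simp: ok_def intro: proj_le\<close>)
    then show ?thesis
      using spec[OF contr[unfolded not_ex], of "\<lambda>a. proj (S a) (f (xS S) a)"] xS(2)[OF True] by blast
  qed simp
  then obtain g where g: "\<And>S. ok S \<Longrightarrow> \<forall>\<^sub>F a in Fi. g S a < proj (S a) (f (xS S) a)"
      "\<And>S x. ok S \<Longrightarrow> x < T \<Longrightarrow> \<not> (\<forall>\<^sub>F a in Fi. g S a < f x a)"
    by metis
  have "\<exists>S. \<forall>i::'o. S i = (\<lambda>a. insert (h0 a) ((\<lambda>j. g (S j) a) ` {..<i}))"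
  proof (rule wellorder_recursion)
    fix S S' :: "'o \<Rightarrow> 'a \<Rightarrow> 'o set" and i
    assume "\<And>z. z < i \<Longrightarrow> S z = S' z"
    then have "(\<lambda>j. g (S j) a) ` {..<i} = (\<lambda>j. g (S' j) a) ` {..<i}" for a
      by (intro image_cong) auto
    then show "(\<lambda>a. insert (h0 a) ((\<lambda>j. g (S j) a) ` {..<i})) = (\<lambda>a. insert (h0 a) ((\<lambda>j. g (S' j) a) ` {..<i}))"
      by simp
  qed
  then obtain S :: "'o \<Rightarrow> 'a \<Rightarrow> 'o set"
    where S: "\<And>i. S i = (\<lambda>a. insert (h0 a) ((\<lambda>j. g (S j) a) ` {..<i}))" by blast
  have S_h0: "h0 a \<in> S i a" for i a by (subst S) simp
  have S_g: "g (S i) a \<in> S j a" if "i < j" for i j a using S[of j] that by auto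
  have S_mono: "S i a \<subseteq> S j a" if "i \<le> j" for i j a
    using S[of i] S[of j] that by (auto intro: less_le_trans)
  have ok: "ok (S i)" if "i < q" for i
    unfolding ok_def
  proof (intro allI conjI)
    fix a
    have "|(\<lambda>j. g (S j) a) ` {..<i}| \<le>o |{..<k}|"
      by (rule ordLeq_transitive[OF card_of_image q(1)[OF that]])
    then show "|S i a| \<le>o |{..<k}|" by (subst S) (rule card_of_insert_ordLeq[OF inf])
  qed (rule S_h0)
  \<comment> \<open>There are only \<open>|{..<q}|\<close> stages, so one index \<open>X\<close>
    lies above all indices \<open>xS (S i)\<close>.\<close>
  obtain X where X: "X < T" "\<And>i. i < q \<Longrightarrow> xS (S i) < X"
    using cof_above_image[OF T ordLeq_refl[OF card_of_Card_order], of "\<lambda>i. xS (S i)"] xS(1)[OF ok]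
    by auto
  define p where "p i a = proj (S i a) (f X a)" for i a
  have p_anti: "p j a \<le> p i a" if "i \<le> j" "f X a \<le> h0 a" for i j a
    unfolding p_def by (rule proj_le) (use S_mono[OF that(1)] proj[of "S i a" "f X a"] S_h0 that(2) in blast)+
  have "\<exists>i<q. \<forall>j. i \<le> j \<and> j < q \<and> f X a \<le> h0 a \<longrightarrow> p j a = p i a" for a
  proof -
    define mi where "mi = (LEAST v. \<exists>i<q. v = p i a)"
    have "\<exists>v. \<exists>i<q. v = p i a" using cof_above_nonempty[OF q(2)] by blast
    then have "\<exists>i<q. mi = p i a" unfolding mi_def by (rule LeastI_ex)
    then obtain i where i: "i < q" "mi = p i a" by blast
    have "p j a = p i a" if "i \<le> j" "j < q" "f X a \<le> h0 a" for j
    proof (rule antisym)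
      show "p j a \<le> p i a" by (rule p_anti) fact+
      show "p i a \<le> p j a" unfolding i(2)[symmetric] mi_def by (rule Least_le) (use that in blast)
    qed
    then show ?thesis using i(1) by blast
  qed
  then obtain ia where ia: "\<And>a. ia a < q" "\<And>a j. ia a \<le> j \<Longrightarrow> j < q \<Longrightarrow> f X a \<le> h0 a \<Longrightarrow> p j a = p (ia a) a"
    by metis
  obtain i where i: "i < q" "\<And>a. a \<in> A \<Longrightarrow> ia a < i"
    using cof_above_image[OF q(2) A(2), of ia] ia(1) by blast
  have "|{i}| \<le>o |{..<k}|" by (rule card_of_singl_ordLeq) (use inf in auto)
  then obtain j where j: "j < q" "i < j" using cof_aboveD[OF q(2), of "{i}"] i by auto
  have "\<forall>\<^sub>F a in Fi. f (xS (S i)) a \<le> f X a"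
    by (rule increasing_mono[where f = f and Fi = Fi, OF inc]) (use X i in \<open>auto intro: less_imp_le\<close>)
  with g(1)[OF ok[OF i(1)]] h0[OF X(1)] A(1)
  have "\<forall>\<^sub>F a in Fi. g (S i) a < f X a"
  proof eventually_elim
    case (elim a)
    have "proj (S i a) (f (xS (S i)) a) \<le> p i a"
      unfolding p_def by (rule proj_mono) (use elim S_h0 in blast)+
    also have "p i a = p j a" using ia(2)[of a i] ia(2)[of a j] i(2)[of a] i(1) j elim by auto
    finally have "g (S i) a < p j a" using elim by (auto intro: less_le_trans)
    \<comment> \<open>The witness of stage \<open>i\<close> belongs to \<open>S j a\<close>. Were it
      at least \<open>f X a\<close>, the projection at stage \<open>j\<close> would be no larger
      than it, but that projection still has the value from stage \<open>i\<close>, which is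
      strictly larger.\<close>
    then show ?case unfolding p_def using proj_le[OF S_g[OF j(2)], of "f X a" a] by (meson not_le)
  qed
  then show False using g(2)[OF ok[OF i(1)] X(1)] by blast
qed

text \<open>Enumerate \<open>d\<close> by \<open>L\<close> and cut the enumeration at the elements
  of \<open>Z\<close>. If the cofinality of \<open>d\<close> exceeded every \<open>|{..<z}|\<close>,
  each piece would be bounded, and the bounds would have a common bound \<open>c < d\<close>; but
  \<open>c\<close> itself lies in some piece.\<close>

lemma small_cofinal:
  fixes d L :: "'o::wellorder"
  assumes d: "|{..<d}| \<le>o |{..<L}|" and Z: "\<And>x. x < L \<Longrightarrow> \<exists>z\<in>Z. x < z"
    and cof: "cof_above d Z"
  shows "\<exists>z\<in>Z. \<not> cof_above d {..<z}"
proof (rule ccontr)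
  assume contr: "\<not> ?thesis"
  obtain e where e: "inj_on e {..<d}" "e ` {..<d} \<subseteq> {..<L}" using d card_of_ordLeq by metis
  have "\<exists>b<d. \<forall>x<d. e x < z \<longrightarrow> x < b" if "z \<in> Z" for z
  proof -
    have "|{x. x < d \<and> e x < z}| \<le>o |{..<z}|"
      by (rule card_of_ordLeqI[of e]) (use e(1) in \<open>auto simp: inj_on_def\<close>)
    then show ?thesis using cof_aboveD[of d "{..<z}" "{x. x < d \<and> e x < z}"] contr that by auto
  qed
  then obtain b where b: "\<And>z. z \<in> Z \<Longrightarrow> b z < d" "\<And>z x. z \<in> Z \<Longrightarrow> x < d \<Longrightarrow> e x < z \<Longrightarrow> x < b z"
    by metis
  obtain c where c: "c < d" "\<And>z. z \<in> Z \<Longrightarrow> b z < c"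
    using cof_above_image[OF cof ordLeq_refl[OF card_of_Card_order], of b] b(1) by blast
  obtain z where "z \<in> Z" "e c < z" using Z[of "e c"] e(2) c(1) by auto
  then show False using b(2)[of z c] c by (meson less_asym)
qed

text \<open>Between two limit points of \<open>Y\<close> lies an element of \<open>Y\<close>, so
  sending a limit point to the least element of \<open>Y\<close> not below it is injective.\<close>

lemma card_lim_pts:
  fixes d :: "'o::wellorder"
  assumes Y: "\<And>b. b < d \<Longrightarrow> \<exists>y\<in>Y. b \<le> y"
  shows "|{x. x < d \<and> lim_pt Y x}| \<le>o |Y|"
proof -
  define P where "P = {x. x < d \<and> lim_pt Y x}"
  define h where "h x = (LEAST y. y \<in> Y \<and> x \<le> y)" for x
  have h: "h x \<in> Y \<and> x \<le> h x" if "x < d" for x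
    unfolding h_def by (rule LeastI_ex) (use Y[OF that] in blast)
  have h_less: "h x < h x'" if x: "x < x'" "x' \<in> P" for x x'
  proof -
    obtain y where y: "y \<in> Y" "x < y" "y < x'" using x unfolding P_def lim_pt_def by blast
    then have "h x \<le> y" unfolding h_def by (intro Least_le) simp
    then show ?thesis using y h[of x'] x unfolding P_def by (auto intro: less_le_trans le_less_trans)
  qed
  have "|P| \<le>o |Y|"
  proof (rule card_of_ordLeqI[of h])
    show "inj_on h P"
    proof (rule inj_onI)
      fix x y assume "x \<in> P" "y \<in> P" "h x = h y"
      then show "x = y" using h_less[of x y] h_less[of y x] by (cases x y rule: linorder_cases) auto
    qed
  qed (use h P_def in auto)
  then show ?thesis unfolding P_def .
qed

lemma closed_unbounded_closure:
  fixes d :: "'o::wellorder"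
  assumes inf: "infinite K" and Y: "Y \<subseteq> {..<d}" "|Y| \<le>o |K|" "\<And>b. b < d \<Longrightarrow> \<exists>y\<in>Y. b \<le> y"
    and lim: "\<And>x. x < d \<Longrightarrow> \<exists>y<d. x < y"
  shows "\<exists>E. closed_unbounded d E \<and> |E| \<le>o |K|"
proof -
  define P where "P = {x. x < d \<and> lim_pt Y x}"
  have "|P| \<le>o |Y|" unfolding P_def by (rule card_lim_pts[OF Y(3)])
  then have "|P| \<le>o |K|" by (rule ordLeq_transitive[OF _ Y(2)])
  then have "|Y \<union> P| \<le>o |K|"
    by (rule card_of_union_ordLeq[OF inf Y(2)])
  moreover have "closed_unbounded d (Y \<union> P)"
    unfolding closed_unbounded_def
  proof (intro conjI allI impI)
    show "Y \<union> P \<subseteq> {..<d}" using Y(1) P_def by auto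
  next
    fix x assume "x < d"
    then obtain x' where "x' < d" "x < x'" using lim by blast
    then show "\<exists>y\<in>Y \<union> P. x < y" using Y(3)[of x'] by (meson UnI1 less_le_trans)
  next
    fix x assume x: "x < d" "lim_pt (Y \<union> P) x"
    have "lim_pt Y x"
      unfolding lim_pt_def
    proof (intro conjI allI impI)
      show "\<exists>y. y < x" using x(2) unfolding lim_pt_def by blast
      fix u assume "u < x"
      then obtain z where z: "z \<in> Y \<union> P" "u < z" "z < x" using x(2) unfolding lim_pt_def by blast
      show "\<exists>z\<in>Y. u < z \<and> z < x"
      proof (cases "z \<in> Y")
        case False
        then have "lim_pt Y z" using z unfolding P_def by blast
        then obtain w where "w \<in> Y" "u < w" "w < z" using z(2) unfolding lim_pt_def by blast
        then show ?thesis using z(3) by (meson less_trans)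
      qed (use z in blast)
    qed
    then show "x \<in> Y \<union> P" using x unfolding P_def by blast
  qed
  ultimately show ?thesis by blast
qed

section \<open>Scales modulo bounded sets\<close>

definition tails :: "'o::wellorder \<Rightarrow> 'o set \<Rightarrow> 'o filter" where
  "tails L A = (INF b\<in>{..<L}. principal {a\<in>A. b < a})"

lemma eventually_tails:
  assumes "\<exists>b. b < L"
  shows "(\<forall>\<^sub>F a in tails L A. P a) \<longleftrightarrow> (\<exists>b<L. \<forall>a\<in>A. b < a \<longrightarrow> P a)"
proof -
  have "(\<forall>\<^sub>F a in tails L A. P a) \<longleftrightarrow> (\<exists>b\<in>{..<L}. eventually P (principal {a\<in>A. b < a}))"
    unfolding tails_def
  proof (rule eventually_INF_base)
    fix a b assume "a \<in> {..<L}" "b \<in> {..<L}"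
    then show "\<exists>x\<in>{..<L}. principal {a\<in>A. x < a} \<le> inf (principal {c\<in>A. a < c}) (principal {a\<in>A. b < a})"
      by (intro bexI[of _ "max a b"]) auto
  qed (use assms in auto)
  then show ?thesis by (auto simp: eventually_principal)
qed

text \<open>At coordinate \<open>a\<close> only \<open>|{..<a}|\<close> earlier functions can be
  dominated below the regular \<open>next_card a\<close>, so each stage distributes its predecessors
  over the coordinates. Continuity at limit stages permits \<open>bounding_projection\<close>, which
  gives the exact upper bound and then, applied to cofinal subsets of the \<open>H a\<close>, the
  growth of the cofinalities.\<close>

theorem scale_exists:
  fixes L m :: "'o::wellorder" and A :: "'o set"
  assumes inf: "infinite {..<m}" and mL: "m < L"
    and A: "A \<subseteq> {..<L}" "\<And>a. a \<in> A \<Longrightarrow> m \<le> a" "|A| \<le>o |{..<m}|" "\<And>x. x < L \<Longrightarrow> \<exists>a\<in>A. x < a"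
    and lim: "\<And>x. x < L \<Longrightarrow> \<exists>y<L. \<not> |{..<y}| \<le>o |{..<x}|"
    and LT: "\<not> |{..<next_card L}| \<le>o |{..<L}|"
  shows "\<exists>f H. (\<forall>x<next_card L. \<forall>\<^sub>F a in tails L A. f x a < H a) \<and>
    (\<forall>\<^sub>F a in tails L A. H a \<le> next_card a) \<and>
    (\<forall>g. (\<forall>\<^sub>F a in tails L A. g a < H a) \<longrightarrow> (\<exists>x<next_card L. \<forall>\<^sub>F a in tails L A. g a < f x a)) \<and>
    (\<forall>z<L. \<forall>\<^sub>F a in tails L A. cof_above (H a) {..<z})"
proof -
  define T where "T = next_card L"
  define Fi where "Fi = tails L A"
  have ev: "(\<forall>\<^sub>F a in Fi. P a) \<longleftrightarrow> (\<exists>b<L. \<forall>a\<in>A. b < a \<longrightarrow> P a)" for P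
    unfolding Fi_def by (rule eventually_tails) (use mL in blast)
  have ev_A: "\<forall>\<^sub>F a in Fi. a \<in> A" unfolding ev using mL by blast
  have below: "|{..<x}| \<le>o |{..<y}|" if "x \<le> y" for x y :: 'o
    by (rule card_of_mono1) (use that in auto)
  have inf': "infinite {..<x}" if "m \<le> x" for x :: 'o
    using infinite_super[of "{..<m}" "{..<x}"] that inf by auto
  have nc: "\<not> |{..<next_card x}| \<le>o |{..<x}|" "next_card x < L" "x < next_card x" if xL: "x < L" for x
  proof -
    obtain y where y: "y < L" "\<not> |{..<y}| \<le>o |{..<x}|" using lim xL by blast
    show *: "\<not> |{..<next_card x}| \<le>o |{..<x}|" by (rule next_card_not_le(1)) (rule y(2))
    show "next_card x < L" using next_card_not_le(2)[OF y(2)] y(1) by simp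
    show "x < next_card x" using * below[of "next_card x" x] by (meson not_le)
  qed
  have cof_nc: "cof_above (next_card x) {..<x}" if "m \<le> x" "x < L" for x
    by (rule cof_above_next_card[OF nc(1) inf']) (use that in auto)
  have T: "cof_above T {..<L}" unfolding T_def
    by (rule cof_above_next_card[OF LT inf']) (use mL in simp)
  have cof_le: "cof_above x {..<y}" if "cof_above x {..<z}" "y \<le> z" for x y z :: 'o
    by (rule cof_above_mono[OF that(1) below[OF that(2)]])
  have nat_m: "|UNIV :: nat set| \<le>o |{..<m}|" by (rule infinite_nat_ordLeq[OF inf])
  have cof_nat: "cof_above x (UNIV :: nat set)" if "cof_above x {..<z}" "m \<le> z" for x z :: 'o
    by (rule cof_above_mono[OF cof_le[OF that] nat_m])
  have T_nat: "cof_above T (UNIV :: nat set)" by (rule cof_nat[OF T]) (use mL in simp)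
  have T_below: "|{..<d}| \<le>o |{..<L}|" if "d < T" for d using below_next_card that unfolding T_def .
  \<comment> \<open>A limit \<open>d\<close> below \<open>\<lambda>\<^sup>+\<close> has cofinality
    below \<lambda>, hence a club of size below \<lambda>; all large coordinates can absorb it at
    once.\<close>
  have "\<exists>E. d < T \<and> (\<exists>y. y < d) \<and> (\<forall>y<d. \<exists>z<d. y < z) \<longrightarrow>
      closed_unbounded d E \<and> (\<exists>z<L. |E| \<le>o |{..<z}| )" for d
  proof (cases "d < T \<and> (\<exists>y. y < d) \<and> (\<forall>y<d. \<exists>z<d. y < z)")
    case True
    have "\<exists>z<L. m \<le> z \<and> \<not> cof_above d {..<z}"
    proof (cases "cof_above d A")
      case True': True
      then obtain z where z: "z \<in> A" "\<not> cof_above d {..<z}"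
        using small_cofinal[OF T_below A(4) True'] True by blast
      then show ?thesis using A(1,2) by blast
    next
      case False
      then show ?thesis using mL cof_above_mono[OF _ A(3)] by blast
    qed
    then obtain z where z: "z < L" "m \<le> z" "\<not> cof_above d {..<z}" by blast
    obtain Y where Y: "Y \<subseteq> {..<d}" "|Y| \<le>o |{..<z}|" "\<And>b. b < d \<Longrightarrow> \<exists>y\<in>Y. b \<le> y"
      using not_cof_aboveD[OF z(3)] by blast
    then show ?thesis using closed_unbounded_closure[OF inf'[OF z(2)] Y] True z(1) by blast
  qed blast
  then obtain E where E: "\<And>d. d < T \<Longrightarrow> \<exists>y. y < d \<Longrightarrow> \<forall>y<d. \<exists>z<d. y < z \<Longrightarrow>
      closed_unbounded d (E d) \<and> (\<exists>z<L. |E d| \<le>o |{..<z}| )"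
    by metis
  have "\<exists>e. d < T \<longrightarrow> inj_on e {..<d} \<and> e ` {..<d} \<subseteq> {..<L}" for d
    using T_below[of d] card_of_ordLeq by metis
  then obtain e where e: "\<And>d. d < T \<Longrightarrow> inj_on (e d) {..<d}" "\<And>d. d < T \<Longrightarrow> e d ` {..<d} \<subseteq> {..<L}"
    by metis
  \<comment> \<open>The first part eventually contains every given \<open>x < d\<close>, which makes
    the sequence increasing. The second takes in the whole club \<open>E d\<close> as soon as it
    fits, which makes the sequence continuous.\<close>
  define B where "B d a = {x. x < d \<and> e d x < a} \<union> (if |E d| \<le>o |{..<a}| then E d \<inter> {..<d} else {})" for d a
  have B_d: "x < d" if "x \<in> B d a" for x d a using that unfolding B_def by (auto split: if_splits)
  have B_card: "|B d a| \<le>o |{..<a}|" if d: "d < T" and a: "a \<in> A" for d a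
  proof -
    have "|{x. x < d \<and> e d x < a}| \<le>o |{..<a}|"
      by (rule card_of_ordLeqI[of "e d"]) (use e(1)[OF d] in \<open>auto simp: inj_on_def\<close>)
    moreover have "|if |E d| \<le>o |{..<a}| then E d \<inter> {..<d} else {}| \<le>o |{..<a}|"
      using card_of_subset_ordLeq[of "E d \<inter> {..<d}" "E d"] by (auto simp: card_of_empty)
    ultimately show ?thesis
      unfolding B_def by (rule card_of_union_ordLeq[OF inf'[OF A(2)[OF a]]])
  qed
  have "\<exists>f :: 'o \<Rightarrow> 'o \<Rightarrow> 'o. \<forall>d. f d = (\<lambda>a. LEAST y. \<forall>x\<in>B d a. f x a < y)"
  proof (rule wellorder_recursion)
    fix f g :: "'o \<Rightarrow> 'o \<Rightarrow> 'o" and d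
    assume eq: "\<And>z. z < d \<Longrightarrow> f z = g z"
    have "(\<forall>x\<in>B d a. f x a < y) \<longleftrightarrow> (\<forall>x\<in>B d a. g x a < y)" for a y
      by (rule ball_cong[OF refl]) (simp add: eq[OF B_d])
    then show "(\<lambda>a. LEAST y. \<forall>x\<in>B d a. f x a < y) = (\<lambda>a. LEAST y. \<forall>x\<in>B d a. g x a < y)" by simp
  qed
  then obtain f :: "'o \<Rightarrow> 'o \<Rightarrow> 'o"
    where f': "\<forall>d. f d = (\<lambda>a. LEAST y. \<forall>x\<in>B d a. f x a < y)" by (rule exE)
  have f: "f d a = (LEAST y. \<forall>x\<in>B d a. f x a < y)" for d a
    by (rule fun_cong[OF spec[OF f']])
  have f_bound: "\<exists>b<next_card a. \<forall>x\<in>B d a. f x a < b"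
    if d: "d < T" and a: "a \<in> A" and IH: "\<And>x. x < d \<Longrightarrow> f x a < next_card a" for d a
  proof (rule cof_above_image[OF cof_nc B_card[OF d a]])
    show "m \<le> a" "a < L" using A a by auto
    fix x assume "x \<in> B d a"
    then show "f x a < next_card a" by (rule IH[OF B_d])
  qed
  have f_nc: "f d a < next_card a" if d: "d < T" and a: "a \<in> A" for d a
    using d
  proof (induction d rule: less_induct)
    case (less d)
    then obtain b where b: "b < next_card a" "\<forall>x\<in>B d a. f x a < b"
      using f_bound[OF less.prems a] by (meson less_trans)
    have "(LEAST y. \<forall>x\<in>B d a. f x a < y) \<le> b" by (rule Least_le) (rule b(2))
    then show ?case using b(1) unfolding f[of d a, symmetric] by simp
  qed
  have f_B: "f x a < f d a" if d: "d < T" and a: "a \<in> A" and x: "x \<in> B d a" for x d a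
  proof -
    obtain b where b: "\<forall>x\<in>B d a. f x a < b" using f_bound[OF d a] f_nc d a by (meson less_trans)
    have "\<forall>x\<in>B d a. f x a < (LEAST y. \<forall>x\<in>B d a. f x a < y)" by (rule LeastI) (rule b)
    then show ?thesis using x unfolding f[of d a, symmetric] by blast
  qed
  have inc: "\<forall>\<^sub>F a in Fi. f x a < f y a" if "x < y" "y < T" for x y
  proof -
    have "e y x < L" using e(2)[OF that(2)] that(1) by auto
    moreover have "f x a < f y a" if "a \<in> A" "e y x < a" for a
      using f_B[of y a x] that \<open>x < y\<close> \<open>y < T\<close> unfolding B_def by simp
    ultimately show ?thesis unfolding ev by blast
  qed
  have cont: "\<exists>E. closed_unbounded d E \<and> (\<forall>\<^sub>F a in Fi. \<forall>x\<in>E. f x a \<le> f d a)"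
    if d: "d < T" "\<exists>y. y < d" "\<forall>y<d. \<exists>z<d. y < z" for d
  proof -
    obtain z where z: "closed_unbounded d (E d)" "z < L" "|E d| \<le>o |{..<z}|" using E[OF d] by blast
    have "f x a \<le> f d a" if "a \<in> A" "z < a" "x \<in> E d" for a x
    proof -
      have "|E d| \<le>o |{..<a}|" by (rule ordLeq_transitive[OF z(3) below]) (use that in simp)
      moreover have "x < d" using that(3) z(1) unfolding closed_unbounded_def by auto
      ultimately have "x \<in> B d a" using that(3) unfolding B_def by simp
      then show ?thesis using f_B[OF d(1) that(1)] by (simp add: less_imp_le)
    qed
    then show ?thesis using z(1,2) unfolding ev by blast
  qed
  \<comment> \<open>The cardinals \<open>q\<close>, \<open>p\<close>, \<open>s\<close> are the first
    three successors of \<open>k\<close>, all below the limit cardinal \<open>L\<close>.\<close>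
  have BP: "\<exists>x<T. \<forall>y<T. \<forall>\<^sub>F a in Fi. f y a \<le> proj (S a) (f x a)"
    if k: "m \<le> k" "k < L" and S: "\<And>a. |S a| \<le>o |{..<k}|"
      "\<And>x. x < T \<Longrightarrow> \<forall>\<^sub>F a in Fi. \<exists>y\<in>S a. f x a \<le> y" for k S
  proof -
    have q: "m \<le> next_card k" "next_card k < L" using nc[OF k(2)] k by auto
    have p: "m \<le> next_card (next_card k)" "next_card (next_card k) < L" using nc[OF q(2)] q by auto
    have s: "m \<le> next_card (next_card (next_card k))" "next_card (next_card (next_card k)) < L"
      using nc[OF p(2)] p by auto
    have Ak: "|A| \<le>o |{..<k}|" by (rule ordLeq_transitive[OF A(3) below[OF k(1)]])
    show ?thesis
      by (rule bounding_projection[OF inc ev_A Ak inf'[OF k(1)] nc(1)[OF k(2)] cof_nc[OF q]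
            cof_nc[OF p] cof_le[OF T] cof_nat[OF cof_nc[OF p] p(1)] cont S])
        (use s in auto)
  qed
  have qm: "next_card m < L" using nc[OF mL] by simp
  have "\<exists>H. (\<forall>\<^sub>F a in Fi. H a \<le> next_card a) \<and> (\<forall>x<T. \<forall>\<^sub>F a in Fi. f x a \<le> H a) \<and>
    (\<forall>g. (\<forall>\<^sub>F a in Fi. g a < H a) \<longrightarrow> (\<exists>x<T. \<forall>\<^sub>F a in Fi. g a < f x a))"
  proof (rule exact_upper_bound[OF inc ev_A A(3) inf below_next_card cof_nc[OF order_refl mL] cof_le[OF T] _ BP[OF order_refl mL]])
    show "next_card m \<le> L" using qm by simp
    fix x assume "x < T"
    then show "\<forall>\<^sub>F a in Fi. f x a \<le> next_card a"
      using ev_A by (elim eventually_mono) (auto intro: less_imp_le f_nc)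
  qed auto
  then obtain H where H: "\<forall>\<^sub>F a in Fi. H a \<le> next_card a" "\<And>x. x < T \<Longrightarrow> \<forall>\<^sub>F a in Fi. f x a \<le> H a"
    "\<And>g. \<forall>\<^sub>F a in Fi. g a < H a \<Longrightarrow> \<exists>x<T. \<forall>\<^sub>F a in Fi. g a < f x a" by blast
  have f_H: "\<forall>\<^sub>F a in Fi. f x a < H a" if x: "x < T" for x
  proof -
    obtain y where "y < T" "x < y" using cof_above_two[OF T_nat x x] by blast
    then show ?thesis using H(2)[of y] inc[of x y] by (auto elim: eventually_elim2 intro: less_le_trans)
  qed
  have "\<forall>\<^sub>F a in Fi. cof_above (H a) {..<z}" if z: "z < L" for z
  proof -
    define k where "k = max z m"
    have k: "m \<le> k" "k < L" "z \<le> k" using z mL unfolding k_def by auto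
    define P where "P a \<longleftrightarrow> cof_above (H a) {..<z}" for a
    have "\<exists>Y. \<not> P a \<longrightarrow> Y \<subseteq> {..<H a} \<and> |Y| \<le>o |{..<z}| \<and> (\<forall>b<H a. \<exists>y\<in>Y. b \<le> y)" for a
      unfolding P_def using not_cof_aboveD[of "H a"] by blast
    then obtain Y where Y: "\<And>a. \<not> P a \<Longrightarrow> Y a \<subseteq> {..<H a}" "\<And>a. \<not> P a \<Longrightarrow> |Y a| \<le>o |{..<z}|"
      "\<And>a b. \<not> P a \<Longrightarrow> b < H a \<Longrightarrow> \<exists>y\<in>Y a. b \<le> y" by metis
    \<comment> \<open>At a coordinate where \<open>H a\<close> has small cofinality,
      \<open>S a\<close> is cofinal in \<open>H a\<close>, so projections stay below
      \<open>H a\<close>. If such coordinates were unbounded, a function below \<open>H\<close>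
      would bound the whole sequence there, against exactness.\<close>
    define S where "S a = (if P a then {H a} else Y a)" for a
    have "|S a| \<le>o |{..<k}|" for a
    proof (cases "P a")
      case True
      have "|{H a}| \<le>o |{..<k}|" by (rule card_of_singl_ordLeq) (use inf'[OF k(1)] in auto)
      then show ?thesis using True by (simp add: S_def)
    next
      case False
      then show ?thesis using ordLeq_transitive[OF Y(2) below[OF k(3)]] by (simp add: S_def)
    qed
    moreover have "\<forall>\<^sub>F a in Fi. \<exists>y\<in>S a. f x a \<le> y" if x: "x < T" for x
      using f_H[OF x] by eventually_elim (use Y(3) in \<open>auto simp: S_def intro: less_imp_le\<close>)
    ultimately obtain x where x: "x < T" "\<And>y. y < T \<Longrightarrow> \<forall>\<^sub>F a in Fi. f y a \<le> proj (S a) (f x a)"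
      using BP[OF k(1,2), of S] by blast
    obtain bt where bt: "\<And>x :: 'o. bt \<le> x" using Least_le[of "\<lambda>x. True"] by blast
    define g where "g a = (if P a then bt else proj (Y a) (f x a))" for a
    have "\<forall>\<^sub>F a in Fi. g a < H a"
      using f_H[OF x(1)]
    proof eventually_elim
      case (elim a)
      show ?case
      proof (cases "P a")
        case True
        then show ?thesis using elim bt[of "f x a"] unfolding g_def by (auto intro: le_less_trans)
      next
        case False
        then show ?thesis using proj(1)[OF Y(3)[OF False elim]] Y(1)[OF False] unfolding g_def by auto
      qed
    qed
    then obtain y where y: "y < T" "\<forall>\<^sub>F a in Fi. g a < f y a" using H(3) by blast
    show ?thesis
      using x(2)[OF y(1)] y(2)
    proof eventually_elim
      case (elim a)
      then show ?case unfolding g_def S_def P_def[symmetric] by (auto split: if_splits)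
    qed
  qed
  then show ?thesis using f_H H(1,3) unfolding T_def Fi_def by blast
qed

section \<open>Decomposability\<close>

lemma wellorder_UNIV:
  "Well_order {(x :: 'o::wellorder, y). x \<le> y}" "Field {(x :: 'o::wellorder, y). x \<le> y} = UNIV"
proof -
  have F: "Field {(x :: 'o, y). x \<le> y} = UNIV" by (auto simp: Field_def)
  have "{(x :: 'o, y). x \<le> y} - Id = {(x, y). x < y}" by (auto simp: less_le)
  then have "wf ({(x :: 'o, y). x \<le> y} - Id)" using wf by metis
  moreover have "Linear_order {(x :: 'o, y). x \<le> y}"
    unfolding linear_order_on_def partial_order_on_def preorder_on_def F
    by (auto simp: refl_on_def trans_def antisym_def total_on_def)
  ultimately show "Well_order {(x :: 'o, y). x \<le> y}" unfolding well_order_on_def F by blast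
  show "Field {(x :: 'o, y). x \<le> y} = UNIV" by (rule F)
qed

lemma order_type:
  fixes r :: "'b rel"
  assumes "Well_order r" "r <o {(x :: 'o::wellorder, y). x \<le> y}"
  obtains z :: "'o::wellorder" and g where "bij_betw g (Field r) {..<z}"
    "\<And>x y. x \<in> Field r \<Longrightarrow> y \<in> Field r \<Longrightarrow> (x, y) \<in> r \<longleftrightarrow> g x \<le> g y"
proof -
  let ?R = "{(x :: 'o, y). x \<le> y}"
  obtain z where "r =o Restr ?R (underS ?R z)"
    using assms(2) ordLess_iff_ordIso_Restr[OF wellorder_UNIV(1) assms(1)] by blast
  moreover have "underS ?R z = {..<z}" unfolding underS_def by auto
  ultimately have "r =o Restr ?R {..<z}" by simp
  then obtain g where g: "iso r (Restr ?R {..<z}) g" unfolding ordIso_def by blast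
  have F: "Field (Restr ?R {..<z}) = {..<z}" unfolding Field_def by auto
  have gg: "bij_betw g (Field r) {..<z}" using g unfolding iso_iff2 F by blast
  moreover have "(x, y) \<in> r \<longleftrightarrow> g x \<le> g y" if "x \<in> Field r" "y \<in> Field r" for x y
    using g gg that unfolding iso_iff2 bij_betw_def by auto
  ultimately show ?thesis using that by blast
qed

text \<open>The comparison with \<open>{..<L}\<close> guarantees that the order type of
  \<open>|X|\<close> occurs in the type, so cardinals below \<open>L\<close> can be handled as
  ordinals.\<close>

lemma card_ordinal:
  fixes X :: "'b set" and L :: "'o::wellorder"
  assumes X: "|X| <o |{..<L}|"
  shows "\<exists>z<L. |X| =o |{..<z}|"
proof -
  have "|UNIV :: 'o set| \<le>o {(x :: 'o, y). x \<le> y}"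
    using card_of_least[of UNIV "{(x :: 'o, y). x \<le> y}"] wellorder_UNIV by metis
  then have "|{..<L}| \<le>o {(x :: 'o, y). x \<le> y}"
    by (rule ordLeq_transitive[OF card_of_mono1, rotated]) simp
  then have "|X| <o {(x :: 'o, y). x \<le> y}" using X ordLess_ordLeq_trans by blast
  then obtain z :: 'o and g where "bij_betw g (Field |X| ) {..<z}"
    using order_type[OF card_of_Well_order] by metis
  then have z: "|X| =o |{..<z}|" using card_of_ordIso by (metis Field_card_of)
  have "z < L"
  proof (rule ccontr)
    assume "\<not> z < L"
    then have "|{..<L}| \<le>o |{..<z}|" by (intro card_of_mono1) auto
    then have "|{..<L}| \<le>o |X|" using z ordLeq_ordIso_trans ordIso_symmetric by blast
    then show False using X not_ordLess_ordLeq by blast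
  qed
  then show ?thesis using z by blast
qed

lemma card_less_next_card:
  fixes x :: "'o::wellorder"
  assumes X: "|X| <o |{..<next_card x}|"
  shows "|X| \<le>o |{..<x}|"
proof -
  obtain z where "z < next_card x" "|X| =o |{..<z}|" using card_ordinal[OF X] by blast
  then show ?thesis using below_next_card ordIso_ordLeq_trans by blast
qed

text \<open>Decomposability depends only on the cardinality of the range; a set in place of a
  cardinal order lets the values be ordinals of any type.\<close>

definition set_decomposable :: "'k set \<Rightarrow> 'i set \<Rightarrow> 'i set set \<Rightarrow> bool" where
  "set_decomposable K I F \<longleftrightarrow>
     (\<exists>f. f ` I \<subseteq> K \<and> (\<forall>X \<subseteq> K. |X| <o |K| \<longrightarrow> {i \<in> I. f i \<in> X} \<notin> F))"

lemma not_set_decomposableD: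
  assumes "\<not> set_decomposable K I F" "f ` I \<subseteq> K"
  shows "\<exists>X\<subseteq>K. |X| <o |K| \<and> {i\<in>I. f i \<in> X} \<in> F"
  using spec[OF assms(1)[unfolded set_decomposable_def not_ex], of f] assms(2) by blast

lemma decomposable_iff:
  assumes "Card_order r"
  shows "decomposable r I F \<longleftrightarrow> set_decomposable (Field r) I F"
proof -
  have r: "|Field r| =o r" by (rule card_of_Field_ordIso[OF assms])
  have "|X| <o r \<longleftrightarrow> |X| <o |Field r|" for X :: "'a set"
    using r ordLess_ordIso_trans ordIso_symmetric by blast
  then show ?thesis unfolding decomposable_def decomposition_def set_decomposable_def by simp
qed

lemma set_decomposable_cong:
  assumes "|K| =o |K'|" and dec: "set_decomposable K I F"
  shows "set_decomposable K' I F"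
proof -
  obtain g where g: "bij_betw g K K'" using assms(1) card_of_ordIso by blast
  obtain f where f: "f ` I \<subseteq> K" "\<And>X. X \<subseteq> K \<Longrightarrow> |X| <o |K| \<Longrightarrow> {i \<in> I. f i \<in> X} \<notin> F"
    using dec unfolding set_decomposable_def by blast
  have "{i \<in> I. g (f i) \<in> X} \<notin> F" if X: "X \<subseteq> K'" "|X| <o |K'|" for X
  proof -
    let ?Y = "{k\<in>K. g k \<in> X}"
    have "|?Y| \<le>o |X|"
      by (rule card_of_ordLeqI[of g]) (use g in \<open>auto simp: bij_betw_def inj_on_def\<close>)
    then have "|?Y| <o |K|"
      using X(2) assms(1) ordLeq_ordLess_trans ordLess_ordIso_trans ordIso_symmetric by blast
    then have "{i \<in> I. f i \<in> ?Y} \<notin> F" by (intro f(2)) auto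
    moreover have "{i \<in> I. f i \<in> ?Y} = {i \<in> I. g (f i) \<in> X}" using f(1) by auto
    ultimately show ?thesis by simp
  qed
  moreover have "(g \<circ> f) ` I \<subseteq> K'" using f(1) g unfolding bij_betw_def by auto
  ultimately show ?thesis unfolding set_decomposable_def by (intro exI[of _ "g \<circ> f"]) simp
qed

lemma filter_on_mono: "filter_on I F \<Longrightarrow> A \<in> F \<Longrightarrow> A \<subseteq> B \<Longrightarrow> B \<subseteq> I \<Longrightarrow> B \<in> F"
  unfolding filter_on_def by blast

lemma filter_on_Int: "filter_on I F \<Longrightarrow> A \<in> F \<Longrightarrow> B \<in> F \<Longrightarrow> A \<inter> B \<in> F"
  unfolding filter_on_def by blast

lemma filter_on_empty: "filter_on I F \<Longrightarrow> {} \<notin> F"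
  unfolding filter_on_def by blast

lemma filter_on_subset: "filter_on I F \<Longrightarrow> A \<in> F \<Longrightarrow> A \<subseteq> I"
  unfolding filter_on_def by blast

text \<open>Inject \<open>X\<close> into \<open>L\<close> and apply indecomposability to the
  composite. Indices with \<open>d i\<close> outside \<open>X\<close> get a default value, harmless
  because the others form a set in \<open>F\<close>.\<close>

lemma small_support:
  fixes L :: "'o::wellorder"
  assumes F: "filter_on I F" and nd: "\<not> set_decomposable {..<L} I F" and L: "\<exists>b. b < L"
    and X: "|X| \<le>o |{..<L}|" "{i\<in>I. d i \<in> X} \<in> F"
  shows "\<exists>X'\<subseteq>X. |X'| <o |{..<L}| \<and> {i\<in>I. d i \<in> X'} \<in> F"
proof -
  obtain v where v: "inj_on v X" "v ` X \<subseteq> {..<L}" using X(1) card_of_ordLeq by metis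
  obtain b where b: "b < L" using L by blast
  define f where "f i = (if d i \<in> X then v (d i) else b)" for i
  have "f ` I \<subseteq> {..<L}" using v(2) b unfolding f_def by auto
  then obtain Y where Y: "|Y| <o |{..<L}|" "{i\<in>I. f i \<in> Y} \<in> F"
    using not_set_decomposableD[OF nd, of f] by blast
  let ?X = "{x\<in>X. v x \<in> Y}"
  have "|?X| \<le>o |Y|" by (rule card_of_ordLeqI[of v]) (use v in \<open>auto simp: inj_on_def\<close>)
  then have "|?X| <o |{..<L}|" using Y(1) ordLeq_ordLess_trans by blast
  moreover have "{i\<in>I. d i \<in> ?X} \<in> F"
    by (rule filter_on_mono[OF F filter_on_Int[OF F X(2) Y(2)]]) (auto simp: f_def split: if_splits)
  ultimately show ?thesis by (intro exI[of _ ?X]) simp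
qed

text \<open>
  Domination modulo bounded sets improves to domination everywhere beyond a fixed \<open>k\<close> (\<open>uniform\<close>
  below): otherwise the supremum of one counterexample for each \<open>k \<in> A\<close> would not be dominated. Hence
  a small set of indices \<open>x\<close> bounds the values of a single decomposition.
\<close>

theorem decomposable_dichotomy:
  fixes L m :: "'o::wellorder" and f :: "'o \<Rightarrow> 'o \<Rightarrow> 'o" and H :: "'o \<Rightarrow> 'o"
  assumes F: "filter_on I F" and inf: "infinite {..<m}" and mL: "m < L"
    and A: "|A| \<le>o |{..<m}|" "A \<subseteq> {..<L}" "\<And>b. b < L \<Longrightarrow> \<exists>a\<in>A. b < a"
    and f: "\<And>x. x < next_card L \<Longrightarrow> \<forall>\<^sub>F a in tails L A. f x a < H a"
    and exact: "\<And>g. \<forall>\<^sub>F a in tails L A. g a < H a \<Longrightarrow>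
      \<exists>x<next_card L. \<forall>\<^sub>F a in tails L A. g a < f x a"
    and cof: "\<And>z. z < L \<Longrightarrow> \<forall>\<^sub>F a in tails L A. cof_above (H a) {..<z}"
    and E: "E \<subseteq> A" "\<And>b. b < L \<Longrightarrow> \<exists>a\<in>E. b < a"
    and u: "\<And>a. a \<in> E \<Longrightarrow> \<exists>u. (\<forall>i\<in>I. u i < H a) \<and> (\<forall>d<H a. {i\<in>I. u i < d} \<notin> F)"
  shows "set_decomposable {..<L} I F \<or> set_decomposable {..<next_card L} I F"
proof (rule ccontr)
  assume contr: "\<not> ?thesis"
  define T where "T = next_card L"
  have ev: "(\<forall>\<^sub>F a in tails L A. P a) \<longleftrightarrow> (\<exists>b<L. \<forall>a\<in>A. b < a \<longrightarrow> P a)" for P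
    by (rule eventually_tails) (use mL in blast)
  define bt :: 'o where "bt = (LEAST x. True)"
  have bt: "bt \<le> x" for x unfolding bt_def by (rule Least_le) simp
  \<comment> \<open>The bound below which \<open>f x a < H a\<close> may fail depends on
    \<open>x\<close>. Resetting the offending values puts all \<open>f' x a\<close> below
    \<open>H a\<close> simultaneously, wherever \<open>H a\<close> is nonzero.\<close>
  define f' where "f' x a = (if f x a < H a then f x a else bt)" for x a
  have uniform: "\<exists>k<L. \<forall>p. (\<forall>a\<in>E. p a < H a) \<longrightarrow> (\<exists>x<T. \<forall>a\<in>E. k < a \<longrightarrow> p a < f' x a)"
  proof (rule ccontr)
    assume "\<not> ?thesis"
    then have "\<exists>p. k < L \<longrightarrow> (\<forall>a\<in>E. p a < H a) \<and> \<not> (\<exists>x<T. \<forall>a\<in>E. k < a \<longrightarrow> p a < f' x a)" for k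
      by blast
    then obtain p where p: "\<And>k a. k < L \<Longrightarrow> a \<in> E \<Longrightarrow> p k a < H a"
      "\<And>k. k < L \<Longrightarrow> \<not> (\<exists>x<T. \<forall>a\<in>E. k < a \<longrightarrow> p k a < f' x a)" by metis
    \<comment> \<open>The supremum of the \<open>|A|\<close> many counterexamples stays below
      \<open>H a\<close> because \<open>H a\<close> eventually has cofinality above
      \<open>|{..<m}|\<close>. Outside \<open>E\<close> the counterexamples are not controlled,
      hence the guard.\<close>
    define e where "e a = (LEAST b. \<forall>k\<in>A. a \<in> E \<longrightarrow> p k a < b)" for a
    have e: "(\<forall>k\<in>A. a \<in> E \<longrightarrow> p k a < e a) \<and> e a < H a" if ca: "cof_above (H a) {..<m}" for a
    proof -
      have "\<exists>b<H a. \<forall>k\<in>A. a \<in> E \<longrightarrow> p k a < b"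
      proof (cases "a \<in> E")
        case True
        then show ?thesis
          using cof_above_image[OF ca A(1), of "\<lambda>k. p k a"] p(1)[OF _ True] A(2) by auto
      qed (use cof_above_nonempty[OF ca] in blast)
      then obtain b where b: "b < H a" "\<forall>k\<in>A. a \<in> E \<longrightarrow> p k a < b" by blast
      have "\<forall>k\<in>A. a \<in> E \<longrightarrow> p k a < e a" unfolding e_def by (rule LeastI) (rule b(2))
      moreover have "e a \<le> b" unfolding e_def by (rule Least_le) (rule b(2))
      ultimately show ?thesis using b(1) by auto
    qed
    have "\<forall>\<^sub>F a in tails L A. e a < H a" using cof[OF mL] by eventually_elim (use e in blast)
    then obtain x where x: "x < T" "\<forall>\<^sub>F a in tails L A. e a < f x a" using exact[of e] unfolding T_def by blast
    have "\<forall>\<^sub>F a in tails L A. a \<in> E \<longrightarrow> (\<forall>k\<in>A. p k a < f' x a)"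
      using x(2) f[OF x(1)[unfolded T_def]] cof[OF mL]
    proof eventually_elim
      case (elim a)
      then show ?case using e[of a] unfolding f'_def by (auto intro: less_trans)
    qed
    then obtain b where b: "b < L" "\<And>a k. a \<in> E \<Longrightarrow> b < a \<Longrightarrow> k \<in> A \<Longrightarrow> p k a < f' x a"
      unfolding ev using E(1) by blast
    obtain k where "k \<in> A" "b < k" using A(3)[OF b(1)] by blast
    then show False using p(2)[of k] b(2) x(1) A(2) by (meson lessThan_iff less_trans subsetD)
  qed
  then obtain k where k: "k < L"
    "\<And>p. (\<And>a. a \<in> E \<Longrightarrow> p a < H a) \<Longrightarrow> \<exists>x<T. \<forall>a\<in>E. k < a \<longrightarrow> p a < f' x a" by blast
  obtain u' where u': "\<And>a i. a \<in> E \<Longrightarrow> i \<in> I \<Longrightarrow> u' a i < H a"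
    "\<And>a d. a \<in> E \<Longrightarrow> d < H a \<Longrightarrow> {i\<in>I. u' a i < d} \<notin> F" using u by metis
  have "\<exists>x. i \<in> I \<longrightarrow> x < T \<and> (\<forall>a\<in>E. k < a \<longrightarrow> u' a i < f' x a)" for i
    using k(2)[of "\<lambda>a. u' a i"] u'(1) by blast
  then obtain d where d: "\<And>i. i \<in> I \<Longrightarrow> d i < T"
    "\<And>i a. i \<in> I \<Longrightarrow> a \<in> E \<Longrightarrow> k < a \<Longrightarrow> u' a i < f' (d i) a" by metis
  obtain X where X: "X \<subseteq> {..<T}" "|X| <o |{..<T}|" "{i\<in>I. d i \<in> X} \<in> F"
    using not_set_decomposableD[of "{..<T}" I F d] contr d(1) unfolding T_def by blast
  have "|X| \<le>o |{..<L}|" using card_less_next_card X(2) unfolding T_def by blast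
  then obtain X' where X': "|X'| <o |{..<L}|" "{i\<in>I. d i \<in> X'} \<in> F"
    using small_support[OF F _ _ _ X(3), of L] contr mL by blast
  obtain z where z: "z < L" "|X'| =o |{..<z}|" using card_ordinal[OF X'(1)] by blast
  have "\<forall>\<^sub>F a in tails L A. cof_above (H a) {..<z}" by (rule cof[OF z(1)])
  then obtain b where b: "b < L" "\<And>a. a \<in> A \<Longrightarrow> b < a \<Longrightarrow> cof_above (H a) {..<z}" unfolding ev by blast
  \<comment> \<open>Beyond \<open>k\<close> domination is uniform in the index, so one coordinate
    serves all of \<open>X'\<close>; beyond \<open>b\<close> the cofinality of \<open>H a\<close>
    exceeds \<open>|X'|\<close>.\<close>
  obtain a where a: "a \<in> E" "max b k < a" using E(2)[of "max b k"] b(1) k(1) by auto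
  have ca: "cof_above (H a) X'"
    using cof_above_mono[OF b(2)] z(2) ordIso_iff_ordLeq a E(1) by (metis max_less_iff_conj subsetD)
  have "f' x a < H a" for x
    using cof_above_nonempty[OF ca] bt unfolding f'_def by (auto intro: le_less_trans)
  then obtain c where c: "c < H a" "\<And>x. x \<in> X' \<Longrightarrow> f' x a < c"
    using cof_above_image[OF ca ordLeq_refl[OF card_of_Card_order], of "\<lambda>x. f' x a"] by blast
  have "{i\<in>I. d i \<in> X'} \<subseteq> {i\<in>I. u' a i < c}"
    using d(2)[OF _ a(1)] a(2) c(2) by (auto intro: less_trans)
  then have "{i\<in>I. u' a i < c} \<in> F" by (rule filter_on_mono[OF F X'(2)]) auto
  then show False using u'(2)[OF a(1) c(1)] by blast
qed

section \<open>Clubs of closure points and of limit points\<close>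

lemma closed_unbounded_closure_points:
  fixes g :: "'o::wellorder \<Rightarrow> 'o"
  assumes nat: "cof_above s (UNIV :: nat set)" and g: "\<And>z. z < s \<Longrightarrow> g z < s"
    and mono: "\<And>z z'. z \<le> z' \<Longrightarrow> z' < s \<Longrightarrow> g z \<le> g z'"
  shows "closed_unbounded s {x. x < s \<and> (\<exists>y. y < x) \<and> (\<forall>z<x. g z < x)}"
  unfolding closed_unbounded_def
proof (intro conjI allI impI)
  fix x assume x: "x < s"
  define g' where "g' z = (LEAST y. g z < y \<and> z < y)" for z
  have ex: "\<exists>y<s. g z < y \<and> z < y" if "z < s" for z
    using cof_above_two[OF nat g[OF that] that] .
  have g': "g z < g' z \<and> z < g' z" if z: "z < s" for z
    unfolding g'_def by (rule LeastI_ex) (use ex[OF z] in blast)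
  have g'_le: "g' z \<le> y" if "g z < y" "z < y" for z y
    unfolding g'_def by (rule Least_le) (use that in blast)
  have g'_s: "g' z < s" if z: "z < s" for z
    using ex[OF z] g'_le by (meson le_less_trans)
  have g'_mono: "g' z \<le> g' z'" if "z \<le> z'" "z' < s" for z z'
    by (rule g'_le) (use g'[OF that(2)] mono[OF that] that(1) in \<open>auto intro: le_less_trans\<close>)
  obtain y where "x < y" "y < s" "\<And>z. z < y \<Longrightarrow> g' z < y"
    using closure_point_above[of s g' x, OF nat g'_s _ g'_mono x] g' by blast
  then show "\<exists>y\<in>{x. x < s \<and> (\<exists>y. y < x) \<and> (\<forall>z<x. g z < x)}. x < y"
    using g' by (intro bexI[of _ y]) (auto, meson less_trans)
next
  fix x assume x: "x < s" "lim_pt {x. x < s \<and> (\<exists>y. y < x) \<and> (\<forall>z<x. g z < x)} x"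
  then have "g z < x" if "z < x" for z
    using that unfolding lim_pt_def by (blast intro: less_trans)
  then show "x \<in> {x. x < s \<and> (\<exists>y. y < x) \<and> (\<forall>z<x. g z < x)}" using x unfolding lim_pt_def by blast
qed auto

lemma closed_unbounded_lim_pts:
  fixes s :: "'o::wellorder"
  assumes nat: "cof_above s (UNIV :: nat set)" and Z: "Z \<subseteq> {..<s}" "\<And>x. x < s \<Longrightarrow> \<exists>z\<in>Z. x < z"
  shows "closed_unbounded s {x. x < s \<and> lim_pt Z x}"
proof -
  define g where "g x = (LEAST z. z \<in> Z \<and> x < z)" for x
  have g: "g x \<in> Z \<and> x < g x" if x: "x < s" for x
    unfolding g_def by (rule LeastI_ex) (use Z(2)[OF x] in blast)
  have g_s: "g x < s" if "x < s" for x using g[OF that] Z(1) by auto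
  have g_mono: "g x \<le> g y" if "x \<le> y" "y < s" for x y
    unfolding g_def[of x] by (rule Least_le) (use g[OF that(2)] that(1) in auto)
  have sub: "{x. x < s \<and> (\<exists>y. y < x) \<and> (\<forall>z<x. g z < x)} \<subseteq> {x. x < s \<and> lim_pt Z x}"
    unfolding lim_pt_def using g by (blast intro: less_trans)
  show ?thesis
    unfolding closed_unbounded_def
  proof (intro conjI allI impI)
    fix x assume "x < s"
    then show "\<exists>y\<in>{x. x < s \<and> lim_pt Z x}. x < y"
      using closed_unbounded_closure_points[of s g, OF nat g_s g_mono] sub
      unfolding closed_unbounded_def by blast
  next
    fix x assume x: "x < s" "lim_pt {x. x < s \<and> lim_pt Z x} x"
    have "lim_pt Z x"
      unfolding lim_pt_def
    proof (intro conjI allI impI)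
      show "\<exists>y. y < x" using x(2) unfolding lim_pt_def by blast
      fix u assume "u < x"
      then obtain z where "u < z" "z < x" "lim_pt Z z" using x(2) unfolding lim_pt_def by blast
      then show "\<exists>z\<in>Z. u < z \<and> z < x" unfolding lim_pt_def by (meson less_trans)
    qed
    then show "x \<in> {x. x < s \<and> lim_pt Z x}" using x by blast
  qed auto
qed

lemma closed_unbounded_above:
  assumes "cof_above s (UNIV :: nat set)" "closed_unbounded s D" "b < s"
  shows "closed_unbounded s (D \<inter> {b<..})"
  unfolding closed_unbounded_def
proof (intro conjI allI impI)
  fix x assume "x < s"
  then obtain c where "c < s" "x < c" "b < c" using cof_above_two[OF assms(1) _ assms(3)] by blast
  then show "\<exists>y\<in>D \<inter> {b<..}. x < y"
    using assms(2) unfolding closed_unbounded_def by (meson IntI greaterThan_iff less_trans)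
next
  fix x assume x: "x < s" "lim_pt (D \<inter> {b<..}) x"
  then have "lim_pt D x" by (auto elim: lim_pt_mono)
  moreover have "b < x" using x(2) unfolding lim_pt_def by (auto intro: less_trans)
  ultimately show "x \<in> D \<inter> {b<..}" using assms(2) x(1) unfolding closed_unbounded_def by blast
qed (use assms(2) in \<open>auto simp: closed_unbounded_def\<close>)

section \<open>Cofinalities as regular initial ordinals\<close>

definition regular_ordinal :: "'o::wellorder \<Rightarrow> bool" where
  "regular_ordinal z \<longleftrightarrow> infinite {..<z} \<and> (\<forall>y<z. |{..<y}| <o |{..<z}| ) \<and>
     (\<forall>X\<subseteq>{..<z}. |X| <o |{..<z}| \<longrightarrow> (\<exists>b<z. \<forall>x\<in>X. x < b))"

lemma card_initial_segment:
  fixes x z :: "'o::wellorder"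
  assumes "infinite {..<z}" "\<And>y. y < z \<Longrightarrow> |{..<y}| <o |{..<z}|" "x < z"
  shows "|{..x}| <o |{..<z}|"
proof (cases "finite {..<x}")
  case True
  have "{..x} = insert x {..<x}" by auto
  then have "finite {..x}" using True by simp
  then show ?thesis
    using finite_ordLess_infinite[OF card_of_Well_order card_of_Well_order, of "{..x}" "{..<z}"] assms(1)
    by (simp add: Field_card_of)
next
  case False
  have "{..x} = insert x {..<x}" by auto
  then have "|{..x}| \<le>o |{..<x}|"
    using card_of_insert_ordLeq[OF False ordLeq_refl[OF card_of_Card_order], of x] by simp
  then show ?thesis using assms(2)[OF assms(3)] ordLeq_ordLess_trans by blast
qed

text \<open>Take \<open>z\<close> to be the least length of a cofinal map into \<open>h\<close>.
  Minimality rules out a shorter reindexing, which gives both that \<open>z\<close> is an initial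
  ordinal and that it is regular.\<close>

lemma cofinality_ordinal:
  fixes h :: "'o::wellorder"
  assumes nat: "cof_above h (UNIV :: nat set)"
  obtains z v where "z \<le> h" "regular_ordinal z" "\<And>x. x < z \<Longrightarrow> v x < h"
    "\<And>b. b < h \<Longrightarrow> \<exists>x<z. b \<le> v x" "\<And>x y. x \<le> y \<Longrightarrow> y < z \<Longrightarrow> v x \<le> v y"
proof -
  define cofin where "cofin z e \<longleftrightarrow> (\<forall>x<z. e x < h) \<and> (\<forall>b<h. \<exists>x<z. b \<le> e x)" for z :: 'o and e
  define z where "z = (LEAST z. \<exists>e. cofin z e)"
  have h: "\<exists>e. cofin h e" by (rule exI[of _ "\<lambda>x. x"]) (auto simp: cofin_def)
  have "\<exists>e. cofin z e" unfolding z_def by (rule LeastI) (rule h)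
  then obtain e where e: "cofin z e" by blast
  have z_h: "z \<le> h" unfolding z_def by (rule Least_le) (rule h)
  have z_min: "\<not> cofin y w" if "y < z" for y w using that not_less_Least unfolding z_def by blast
  have inf: "infinite {..<z}"
  proof
    assume "finite {..<z}"
    then have "finite (e ` {..<z})" by simp
    then obtain b where "b < h" "\<forall>y\<in>e ` {..<z}. y < b"
      using cof_aboveD[OF cof_above_finite[OF nat], of "e ` {..<z}" "e ` {..<z}"] e
        ordLeq_refl[OF card_of_Card_order] unfolding cofin_def by blast
    moreover obtain x where "x < z" "b \<le> e x" using e calculation(1) unfolding cofin_def by blast
    ultimately show False by (meson imageI leD lessThan_iff)
  qed
  have nb: "\<exists>b<h. \<forall>x\<in>X. w x < b" if X: "|X| <o |{..<z}|" "\<And>x. x \<in> X \<Longrightarrow> w x < h" for X :: "'o set" and w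
  proof -
    obtain y where y: "y < z" "|X| =o |{..<y}|" using card_ordinal[OF X(1)] by blast
    then obtain g where g: "bij_betw g {..<y} X" using card_of_ordIso ordIso_symmetric by blast
    have "\<not> cofin y (w \<circ> g)" by (rule z_min[OF y(1)])
    then obtain b where b: "b < h" "\<And>x. x < y \<Longrightarrow> w (g x) < b"
      using X(2) g unfolding cofin_def bij_betw_def by (auto simp: not_le)
    have "\<forall>x\<in>X. w x < b" using b(2) g unfolding bij_betw_def by auto
    then show ?thesis using b(1) by blast
  qed
  have init: "|{..<y}| <o |{..<z}|" if "y < z" for y
  proof (rule ccontr)
    assume "\<not> |{..<y}| <o |{..<z}|"
    then have "|{..<z}| \<le>o |{..<y}|" by (meson card_of_Well_order not_ordLess_iff_ordLeq)
    moreover have "{..<z} \<noteq> {}" using that by auto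
    ultimately obtain g where g: "g ` {..<y} = {..<z}"
      using card_of_ordLeq2[of "{..<z}" "{..<y}"] by blast
    have "cofin y (e \<circ> g)"
      unfolding cofin_def
    proof (intro conjI allI impI)
      fix x assume "x < y"
      then show "(e \<circ> g) x < h" using g e unfolding cofin_def by auto
    next
      fix b assume "b < h"
      then obtain x where "x < z" "b \<le> e x" using e unfolding cofin_def by blast
      moreover then obtain x' where "x' < y" "x = g x'" using g by (metis imageE lessThan_iff)
      ultimately show "\<exists>x<y. b \<le> (e \<circ> g) x" by auto
    qed
    then show False using z_min[OF that] by blast
  qed
  \<comment> \<open>The running strict supremum of \<open>e\<close> is monotone; by the minimality
    of \<open>z\<close> it stays below \<open>h\<close>.\<close>
  define v where "v x = (LEAST b. \<forall>x'\<le>x. e x' < b)" for x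
  have v: "(\<forall>x'\<le>x. e x' < v x) \<and> v x < h" if xz: "x < z" for x
  proof -
    obtain b where b: "b < h" "\<forall>x'\<in>{..x}. e x' < b"
      using nb[OF card_initial_segment[OF inf init xz], of e] e xz unfolding cofin_def
      by (meson atMost_iff le_less_trans)
    have b': "\<forall>x'\<le>x. e x' < b" using b by simp
    have "\<forall>x'\<le>x. e x' < v x" unfolding v_def by (rule LeastI) (rule b')
    moreover have "v x \<le> b" unfolding v_def by (rule Least_le) (rule b')
    ultimately show ?thesis using b(1) by auto
  qed
  have v_mono: "v x \<le> v y" if "x \<le> y" "y < z" for x y
    unfolding v_def[of x] by (rule Least_le) (use v[OF that(2)] that(1) in auto)
  have v_cof: "\<exists>x<z. b \<le> v x" if b: "b < h" for b
  proof -
    obtain x where "x < z" "b \<le> e x" using e b unfolding cofin_def by blast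
    then show ?thesis using v[of x] by (meson le_less_trans less_imp_le order_refl)
  qed
  have "\<exists>b<z. \<forall>x\<in>X. x < b" if X: "X \<subseteq> {..<z}" "|X| <o |{..<z}|" for X
  proof (rule ccontr)
    assume contr: "\<not> ?thesis"
    obtain b where b: "b < h" "\<forall>x\<in>X. v x < b" using nb[OF X(2), of v] v X(1) by blast
    obtain x where x: "x < z" "b \<le> v x" using v_cof[OF b(1)] by blast
    obtain y where "y \<in> X" "x \<le> y" using contr x(1) by (meson not_le)
    then show False using v_mono[of x y] X(1) b(2) x(2) by (meson leD le_less_trans lessThan_iff subsetD order_trans)
  qed
  then have "regular_ordinal z" unfolding regular_ordinal_def using inf init by blast
  then show ?thesis using that[OF z_h] v v_cof v_mono by blast
qed

text \<open>Compose a decomposition over the cofinality of \<open>h\<close> with a monotone cofinal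
  map: boundedness of the composite on a set in \<open>F\<close> would confine the decomposition to
  a proper initial segment.\<close>

lemma unbounded_of_regular:
  fixes h l :: "'o::wellorder"
  assumes nat: "cof_above h (UNIV :: nat set)" and l: "cof_above h {..<l}" and F: "filter_on I F"
    and dec: "\<And>z. z \<le> h \<Longrightarrow> regular_ordinal z \<Longrightarrow> \<not> |{..<z}| \<le>o |{..<l}| \<Longrightarrow> set_decomposable {..<z} I F"
  shows "\<exists>u. (\<forall>i\<in>I. u i < h) \<and> (\<forall>d<h. {i\<in>I. u i < d} \<notin> F)"
proof -
  obtain z v where z: "z \<le> h" "regular_ordinal z" and v: "\<And>x. x < z \<Longrightarrow> v x < h"
    "\<And>b. b < h \<Longrightarrow> \<exists>x<z. b \<le> v x" "\<And>x y. x \<le> y \<Longrightarrow> y < z \<Longrightarrow> v x \<le> v y"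
    using cofinality_ordinal[OF nat] by blast
  have "\<not> |{..<z}| \<le>o |{..<l}|"
  proof
    assume "|{..<z}| \<le>o |{..<l}|"
    then obtain b where "b < h" "\<forall>x\<in>{..<z}. v x < b" using cof_above_image[OF l, of "{..<z}" v] v(1) by blast
    moreover obtain x where "x < z" "b \<le> v x" using v(2)[OF calculation(1)] by blast
    ultimately show False by (meson leD lessThan_iff)
  qed
  then obtain f where f: "f ` I \<subseteq> {..<z}" "\<And>X. X \<subseteq> {..<z} \<Longrightarrow> |X| <o |{..<z}| \<Longrightarrow> {i \<in> I. f i \<in> X} \<notin> F"
    using dec[OF z] unfolding set_decomposable_def by blast
  have "{i\<in>I. v (f i) < d} \<notin> F" if dh: "d < h" for d
  proof
    assume in_F: "{i\<in>I. v (f i) < d} \<in> F"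
    obtain x where x: "x < z" "d \<le> v x" using v(2)[OF dh] by blast
    have "{i\<in>I. v (f i) < d} \<subseteq> {i\<in>I. f i \<in> {..<x}}"
    proof (clarsimp)
      fix i assume i: "i \<in> I" "v (f i) < d"
      show "f i < x"
      proof (rule ccontr)
        assume "\<not> f i < x"
        then have "v x \<le> v (f i)" using v(3)[of x "f i"] f(1) i(1) by auto
        then show False using i(2) x(2) by auto
      qed
    qed
    then have "{i\<in>I. f i \<in> {..<x}} \<in> F" by (rule filter_on_mono[OF F in_F]) auto
    moreover have "{..<x} \<subseteq> {..<z}" using x(1) by auto
    moreover have "|{..<x}| <o |{..<z}|" using x(1) z(2) unfolding regular_ordinal_def by blast
    ultimately show False using f(2) by blast
  qed
  moreover have "\<forall>i\<in>I. v (f i) < h" using f(1) v(1) by auto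
  ultimately show ?thesis by (intro exI[of _ "\<lambda>i. v (f i)"]) blast
qed

text \<open>\<open>L\<close> is a singular cardinal with cofinal subset \<open>Z\<close>, and \<open>m\<close> bounds its cofinality.\<close>

locale singular_ordinal =
  fixes L m :: "'o::wellorder" and Z :: "'o set"
  assumes init: "x < L \<Longrightarrow> |{..<x}| <o |{..<L}|"
    and inf: "infinite {..<m}" and mL: "m < L"
    and Z: "Z \<subseteq> {..<L}" "|Z| \<le>o |{..<m}|" "x < L \<Longrightarrow> \<exists>z\<in>Z. x < z"
    and next_L: "\<not> |{..<next_card L}| \<le>o |{..<L}|"
begin

lemma inf_L: "infinite {..<L}"
  using infinite_super[of "{..<m}" "{..<L}"] inf mL by auto

text \<open>If cardinalities below \<open>L\<close> were capped by that of \<open>x\<close>, then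
  \<open>L\<close> would be a union of at most \<open>|{..<m}|\<close> sets of size at most
  \<open>|{..<k}|\<close>, where \<open>k\<close> is the larger of \<open>x\<close> and
  \<open>m\<close>.\<close>

lemma limit_cardinal:
  assumes x: "x < L"
  shows "\<exists>y<L. \<not> |{..<y}| \<le>o |{..<x}|"
proof (rule ccontr)
  assume contr: "\<not> ?thesis"
  define k where "k = max x m"
  have k: "k < L" "x \<le> k" "m \<le> k" using x mL unfolding k_def by auto
  have infk: "infinite {..<k}" using infinite_super[of "{..<m}" "{..<k}"] inf k by auto
  have xk: "|{..<x}| \<le>o |{..<k}|" and mk: "|{..<m}| \<le>o |{..<k}|" by (rule card_of_mono1; use k in auto)+
  have "|\<Union>z\<in>Z. {..<z}| \<le>o |{..<k}|"
  proof (rule card_of_UNION_ordLeq_infinite[OF infk], rule ordLeq_transitive[OF Z(2) mk], rule ballI)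
    fix z assume "z \<in> Z"
    then have "|{..<z}| \<le>o |{..<x}|" using contr Z(1) by auto
    then show "|{..<z}| \<le>o |{..<k}|" by (rule ordLeq_transitive[OF _ xk])
  qed
  moreover have "{..<L} \<subseteq> (\<Union>z\<in>Z. {..<z})" using Z(3) by auto
  ultimately have "|{..<L}| \<le>o |{..<k}|" using card_of_subset_ordLeq by blast
  then show False using init[OF k(1)] not_ordLess_ordLeq by blast
qed

text \<open>For large \<open>a\<close> the ordinal \<open>H a\<close> lies below \<open>L\<close>
  and has cofinality above \<open>|{..<l}|\<close>, so its cofinality is one of the regular
  cardinals of the hypothesis.\<close>

theorem dichotomy_regular:
  assumes F: "filter_on I F" and l: "l < L"
    and dec: "\<And>z. z < L \<Longrightarrow> regular_ordinal z \<Longrightarrow> \<not> |{..<z}| \<le>o |{..<l}| \<Longrightarrow> set_decomposable {..<z} I F"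
  shows "set_decomposable {..<L} I F \<or> set_decomposable {..<next_card L} I F"
proof -
  define A where "A = {z\<in>Z. m \<le> z}"
  have A: "A \<subseteq> {..<L}" "\<And>a. a \<in> A \<Longrightarrow> m \<le> a" "|A| \<le>o |{..<m}|"
    using Z(1) card_of_subset_ordLeq[OF _ Z(2), of A] unfolding A_def by auto
  have A_unb: "\<exists>a\<in>A. x < a" if "x < L" for x
    using Z(3)[of "max x m"] that mL unfolding A_def by auto
  have ev: "(\<forall>\<^sub>F a in tails L A. P a) \<longleftrightarrow> (\<exists>b<L. \<forall>a\<in>A. b < a \<longrightarrow> P a)" for P
    by (rule eventually_tails) (use mL in blast)
  obtain f H where f: "\<forall>x<next_card L. \<forall>\<^sub>F a in tails L A. f x a < H a"
    and H: "\<forall>\<^sub>F a in tails L A. H a \<le> next_card a"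
    and ex: "\<forall>g. (\<forall>\<^sub>F a in tails L A. g a < H a) \<longrightarrow> (\<exists>x<next_card L. \<forall>\<^sub>F a in tails L A. g a < f x a)"
    and cof: "\<forall>z<L. \<forall>\<^sub>F a in tails L A. cof_above (H a) {..<z}"
    using scale_exists[OF inf mL A A_unb limit_cardinal next_L] by blast
  define k where "k = max l m"
  have k: "k < L" "l \<le> k" "m \<le> k" using l mL unfolding k_def by auto
  have "\<forall>\<^sub>F a in tails L A. cof_above (H a) {..<k} \<and> H a \<le> next_card a"
    using cof k(1) H by (auto intro: eventually_conj)
  then obtain b where b: "b < L" "\<And>a. a \<in> A \<Longrightarrow> b < a \<Longrightarrow> cof_above (H a) {..<k} \<and> H a \<le> next_card a"
    unfolding ev by blast
  define E where "E = {a\<in>A. b < a}"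
  show ?thesis
  proof (rule decomposable_dichotomy[OF F inf mL A(3) A(1) A_unb])
    show "E \<subseteq> A" unfolding E_def by blast
    show "\<exists>a\<in>E. c < a" if "c < L" for c using A_unb[of "max b c"] that b(1) unfolding E_def by auto
    fix a assume "a \<in> E"
    then have a: "cof_above (H a) {..<k}" "H a \<le> next_card a" "a < L" using b(2) A(1) unfolding E_def by auto
    have "H a < L" using limit_cardinal[OF a(3)] next_card_not_le(2) a(2) by (meson le_less_trans)
    have ml: "|{..<l}| \<le>o |{..<k}|" and mm: "|{..<m}| \<le>o |{..<k}|" by (rule card_of_mono1; use k in auto)+
    show "\<exists>u. (\<forall>i\<in>I. u i < H a) \<and> (\<forall>d<H a. {i\<in>I. u i < d} \<notin> F)"
    proof (rule unbounded_of_regular[OF _ cof_above_mono[OF a(1) ml] F])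
      show "cof_above (H a) (UNIV :: nat set)"
        by (rule cof_above_mono[OF cof_above_mono[OF a(1) mm] infinite_nat_ordLeq[OF inf]])
      show "set_decomposable {..<z} I F" if "z \<le> H a" "regular_ordinal z" "\<not> |{..<z}| \<le>o |{..<l}|" for z
        by (rule dec) (use that \<open>H a < L\<close> in auto)
    qed
  qed (use f ex cof in auto)
qed

text \<open>For a club of \<open>a\<close> the cofinality of \<open>H a\<close> exceeds
  \<open>|{..<z}|\<close> for every \<open>z < a\<close>. An \<open>H a\<close> below the successor
  of \<open>a\<close> would have size at most \<open>|{..<a}|\<close>, and
  \<open>small_cofinal\<close> would give it cofinality at most \<open>|{..<z}|\<close> for some
  \<open>z\<close> in \<open>Z\<close> below \<open>a\<close>. So \<open>H a\<close> is the
  successor there.\<close>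

theorem dichotomy_stationary:
  assumes F: "filter_on I F" and nat: "cof_above L (UNIV :: nat set)"
    and S: "\<And>C. closed_unbounded L C \<Longrightarrow> S \<inter> C \<noteq> {}"
    and dec: "\<And>a. a \<in> S \<Longrightarrow> set_decomposable {..<next_card a} I F"
  shows "set_decomposable {..<L} I F \<or> set_decomposable {..<next_card L} I F"
proof -
  define Z' where "Z' = {x. x < L \<and> lim_pt Z x}"
  have Z': "closed_unbounded L Z'" unfolding Z'_def by (rule closed_unbounded_lim_pts[OF nat Z(1,3)])
  \<comment> \<open>Limit points of \<open>Z\<close> above \<open>m\<close> are those
    \<open>a\<close> in which a set of size at most \<open>|{..<m}|\<close>, with
    \<open>m < a\<close>, is cofinal, as \<open>small_cofinal\<close> requires.\<close>
  define A where "A = Z' \<inter> {m<..}"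
  have A_club: "closed_unbounded L A" unfolding A_def by (rule closed_unbounded_above[OF nat Z' mL])
  have A: "A \<subseteq> {..<L}" "\<And>a. a \<in> A \<Longrightarrow> m \<le> a" "\<And>x. x < L \<Longrightarrow> \<exists>a\<in>A. x < a"
    using A_club unfolding A_def closed_unbounded_def by auto
  have "|{x. x < L \<and> lim_pt Z x}| \<le>o |Z|"
    by (rule card_lim_pts) (use Z(3) in \<open>auto intro: less_imp_le\<close>)
  then have Am: "|A| \<le>o |{..<m}|"
    using card_of_subset_ordLeq[of A Z'] ordLeq_transitive[OF _ Z(2)] unfolding A_def Z'_def by blast
  have ev: "(\<forall>\<^sub>F a in tails L A. P a) \<longleftrightarrow> (\<exists>b<L. \<forall>a\<in>A. b < a \<longrightarrow> P a)" for P
    by (rule eventually_tails) (use mL in blast)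
  obtain f H where f: "\<forall>x<next_card L. \<forall>\<^sub>F a in tails L A. f x a < H a"
    and H: "\<forall>\<^sub>F a in tails L A. H a \<le> next_card a"
    and ex: "\<forall>g. (\<forall>\<^sub>F a in tails L A. g a < H a) \<longrightarrow> (\<exists>x<next_card L. \<forall>\<^sub>F a in tails L A. g a < f x a)"
    and cof: "\<forall>z<L. \<forall>\<^sub>F a in tails L A. cof_above (H a) {..<z}"
    using scale_exists[OF inf mL A(1,2) Am A(3) limit_cardinal next_L] by blast
  \<comment> \<open>The threshold beyond which cofinalities exceed \<open>|{..<K}|\<close>; at
    closure points of \<open>b\<close> all \<open>K < a\<close> are covered together.\<close>
  define b where "b K = (LEAST b. \<forall>a\<in>A. b < a \<longrightarrow> cof_above (H a) {..<K})" for K :: 'o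
  have b: "(\<forall>a\<in>A. b K < a \<longrightarrow> cof_above (H a) {..<K}) \<and> b K < L" if K: "K < L" for K
  proof -
    obtain c where c: "c < L" "\<forall>a\<in>A. c < a \<longrightarrow> cof_above (H a) {..<K}" using cof K unfolding ev by blast
    have "\<forall>a\<in>A. b K < a \<longrightarrow> cof_above (H a) {..<K}" unfolding b_def by (rule LeastI) (rule c(2))
    moreover have "b K \<le> c" unfolding b_def by (rule Least_le) (rule c(2))
    ultimately show ?thesis using c(1) by auto
  qed
  have b_mono: "b K \<le> b K'" if K: "K \<le> K'" "K' < L" for K K'
  proof -
    have "\<forall>a\<in>A. b K' < a \<longrightarrow> cof_above (H a) {..<K}"
    proof (intro ballI impI)
      fix a assume "a \<in> A" "b K' < a"
      then have "cof_above (H a) {..<K'}" using b[OF K(2)] by blast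
      moreover have "|{..<K}| \<le>o |{..<K'}|" by (rule card_of_mono1) (use K in auto)
      ultimately show "cof_above (H a) {..<K}" by (rule cof_above_mono)
    qed
    then show ?thesis unfolding b_def[of K] by (rule Least_le)
  qed
  obtain c where c: "c < L" "\<And>a. a \<in> A \<Longrightarrow> c < a \<Longrightarrow> H a \<le> next_card a" using H unfolding ev by blast
  define C where "C = A \<inter> {x. x < L \<and> (\<exists>y. y < x) \<and> (\<forall>z<x. b z < x)}"
  have C: "closed_unbounded L C" unfolding C_def
    by (rule closed_unbounded_Int[OF nat A_club closed_unbounded_closure_points[OF nat _ b_mono]])
      (use b in auto)
  define E where "E = S \<inter> C \<inter> {c<..}"
  show ?thesis
  proof (rule decomposable_dichotomy[OF F inf mL Am A(1,3)])
    show "E \<subseteq> A" unfolding E_def C_def by blast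
    show "\<exists>a\<in>E. x < a" if x: "x < L" for x
    proof -
      have "max c x < L" using c(1) x by simp
      then show ?thesis
        using S[OF closed_unbounded_above[OF nat C, of "max c x"]] unfolding E_def by auto
    qed
    fix a assume "a \<in> E"
    then have a: "a \<in> S" "a \<in> A" "a < L" "c < a" "\<And>z. z < a \<Longrightarrow> b z < a" "m < a" "lim_pt Z a"
      unfolding E_def C_def A_def Z'_def by auto
    have cof_a: "cof_above (H a) {..<z}" if "z < a" for z using b[of z] a that by (meson less_trans)
    have "H a = next_card a"
    proof (rule ccontr)
      assume "H a \<noteq> next_card a"
      then have "H a < next_card a" using c(2)[OF a(2,4)] by simp
      then have Ha: "|{..<H a}| \<le>o |{..<a}|" by (rule below_next_card)
      have "\<exists>z\<in>Z \<inter> {..<a}. \<not> cof_above (H a) {..<z}"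
      proof (rule small_cofinal[OF Ha])
        show "\<exists>z\<in>Z \<inter> {..<a}. x < z" if "x < a" for x using a(7) that unfolding lim_pt_def by blast
        show "cof_above (H a) (Z \<inter> {..<a})"
          by (rule cof_above_mono[OF cof_a[OF a(6)] card_of_subset_ordLeq[OF _ Z(2)]]) blast
      qed
      then show False using cof_a by blast
    qed
    obtain w where w: "w ` I \<subseteq> {..<next_card a}"
      "\<And>X. X \<subseteq> {..<next_card a} \<Longrightarrow> |X| <o |{..<next_card a}| \<Longrightarrow> {i \<in> I. w i \<in> X} \<notin> F"
      using dec[OF a(1)] unfolding set_decomposable_def by blast
    have "{i\<in>I. w i < d} \<notin> F" if d: "d < next_card a" for d
    proof -
      obtain y where "y < L" "\<not> |{..<y}| \<le>o |{..<a}|" using limit_cardinal[OF a(3)] by blast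
      then have "|{..<a}| <o |{..<next_card a}|"
        using next_card_not_le(1) by (meson card_of_Well_order not_ordLeq_iff_ordLess)
      then have "|{..<d}| <o |{..<next_card a}|" using below_next_card[OF d] ordLeq_ordLess_trans by blast
      then have "{i \<in> I. w i \<in> {..<d}} \<notin> F" by (intro w(2)) (use d in auto)
      then show ?thesis by simp
    qed
    then show "\<exists>u. (\<forall>i\<in>I. u i < H a) \<and> (\<forall>d<H a. {i\<in>I. u i < d} \<notin> F)"
      using w(1) unfolding \<open>H a = next_card a\<close> by (intro exI[of _ w]) auto
  qed (use f ex cof in auto)
qed

end

section \<open>Regularity of ultrafilters\<close>

lemma ultrafilter_compl: "ultrafilter_on I D \<Longrightarrow> A \<subseteq> I \<Longrightarrow> A \<notin> D \<Longrightarrow> I - A \<in> D"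
  unfolding ultrafilter_on_def by blast

lemma ultrafilter_Un:
  assumes D: "ultrafilter_on I D" and A: "A \<subseteq> I" "A \<notin> D" and B: "B \<subseteq> I" "B \<notin> D"
  shows "A \<union> B \<notin> D"
proof
  assume "A \<union> B \<in> D"
  have F: "filter_on I D" using D unfolding ultrafilter_on_def by blast
  have "(A \<union> B) \<inter> ((I - A) \<inter> (I - B)) \<in> D"
    using filter_on_Int[OF F \<open>A \<union> B \<in> D\<close> filter_on_Int[OF F ultrafilter_compl[OF D A] ultrafilter_compl[OF D B]]] .
  moreover have "(A \<union> B) \<inter> ((I - A) \<inter> (I - B)) = {}" by blast
  ultimately show False using filter_on_empty[OF F] by simp
qed

text \<open>Among the elements with infinitely many above them, take one with \<open>v\<close>
  minimal. Its successor in \<open>Z\<close> again has infinitely many above it, with a smaller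
  value of \<open>v\<close>.\<close>

lemma finite_strictly_decreasing:
  fixes Z :: "'o::wellorder set" and v :: "'o \<Rightarrow> 'p::wellorder"
  assumes dec: "\<And>x y. x \<in> Z \<Longrightarrow> y \<in> Z \<Longrightarrow> x < y \<Longrightarrow> v y < v x"
  shows "finite Z"
proof (rule ccontr)
  assume inf: "infinite Z"
  define W where "W = {x\<in>Z. infinite {y\<in>Z. x \<le> y}}"
  obtain b where b: "b \<in> Z" "\<And>y. y \<in> Z \<Longrightarrow> b \<le> y"
  proof -
    have "Z \<noteq> {}" using inf by auto
    then have "\<exists>b. b \<in> Z" by blast
    then have "(LEAST b. b \<in> Z) \<in> Z" by (rule LeastI_ex)
    then show ?thesis by (rule that) (rule Least_le)
  qed
  have "{y\<in>Z. b \<le> y} = Z" using b by auto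
  then have "b \<in> W" using inf b unfolding W_def by simp
  then have "\<exists>m. \<exists>x\<in>W. m = v x" by blast
  then have "\<exists>x\<in>W. (LEAST m. \<exists>x\<in>W. m = v x) = v x" by (rule LeastI_ex)
  then obtain x where x: "x \<in> W" "(LEAST m. \<exists>x\<in>W. m = v x) = v x" by blast
  define y where "y = (LEAST y. y \<in> Z \<and> x < y)"
  have eq: "{y\<in>Z. x \<le> y} = insert x {y\<in>Z. x < y}" using x(1) unfolding W_def by auto
  then have inf': "infinite {y\<in>Z. x < y}" using x(1) unfolding W_def by simp
  then have "{y\<in>Z. x < y} \<noteq> {}" by (intro notI) simp
  then obtain y' where "y' \<in> Z \<and> x < y'" by blast
  then have y: "y \<in> Z \<and> x < y" unfolding y_def by (rule LeastI)
  have "{y'\<in>Z. x < y'} = {y'\<in>Z. y \<le> y'}"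
    using y unfolding y_def by (auto intro: Least_le less_le_trans)
  then have "y \<in> W" using inf' y unfolding W_def by simp
  then have "v x \<le> v y" unfolding x(2)[symmetric] by (intro Least_le) blast
  then show False using dec[of x y] x(1) y unfolding W_def by auto
qed

lemma card_of_finite_subsets:
  assumes inf: "infinite A"
  shows "|{S. S \<subseteq> A \<and> finite S}| \<le>o |A|"
proof -
  have n: "|{S. S \<subseteq> A \<and> finite S \<and> card S = n}| \<le>o |A|" for n
  proof (induction n)
    case 0
    have "{S. S \<subseteq> A \<and> finite S \<and> card S = 0} = {{}}" by auto
    moreover have "|{{} :: 'a set}| \<le>o |A|" by (rule card_of_singl_ordLeq) (use inf in auto)
    ultimately show ?case by simp
  next
    case (Suc n)
    let ?S = "{S. S \<subseteq> A \<and> finite S \<and> card S = n}"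
    have "|A \<times> ?S| \<le>o |A|"
      using card_of_Times_ordLeq_infinite_Field[of "|A|" A ?S] inf Suc
        ordLeq_refl[OF card_of_Card_order, of A]
      by (simp add: Field_card_of card_of_card_order_on)
    then have "|(\<lambda>(x, S). insert x S) ` (A \<times> ?S)| \<le>o |A|"
      by (rule ordLeq_transitive[OF card_of_image])
    moreover have "{S. S \<subseteq> A \<and> finite S \<and> card S = Suc n} \<subseteq> (\<lambda>(x, S). insert x S) ` (A \<times> ?S)"
    proof
      fix S assume "S \<in> {S. S \<subseteq> A \<and> finite S \<and> card S = Suc n}"
      then have S: "S \<subseteq> A" "finite S" "card S = Suc n" by auto
      then have "S \<noteq> {}" by auto
      then obtain x where x: "x \<in> S" by blast
      show "S \<in> (\<lambda>(x, S). insert x S) ` (A \<times> ?S)"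
        by (rule image_eqI[of _ _ "(x, S - {x})"]) (use S x in auto)
    qed
    ultimately show ?case using card_of_subset_ordLeq by blast
  qed
  have "|\<Union>n\<in>(UNIV :: nat set). {S. S \<subseteq> A \<and> finite S \<and> card S = n}| \<le>o |A|"
    by (rule card_of_UNION_ordLeq_infinite[OF inf infinite_nat_ordLeq[OF inf]]) (use n in blast)
  moreover have "{S. S \<subseteq> A \<and> finite S} \<subseteq> (\<Union>n\<in>(UNIV :: nat set). {S. S \<subseteq> A \<and> finite S \<and> card S = n})"
    by blast
  ultimately show ?thesis using card_of_subset_ordLeq by blast
qed

text \<open>Regularity read pointwise: each point lies in few sets. Indexing allows repeated sets,
  which are dealt with in \<open>regular_uf_of_family\<close>.\<close>

definition regular_family :: "'j set \<Rightarrow> 'k set \<Rightarrow> 'i set \<Rightarrow> 'i set set \<Rightarrow> bool" where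
  "regular_family J K I D \<longleftrightarrow> (\<exists>B. (\<forall>j\<in>J. B j \<in> D) \<and> (\<forall>i\<in>I. |{j\<in>J. i \<in> B j}| <o |K| ))"

lemma regular_family_subset:
  assumes "regular_family J K I D" "|J'| \<le>o |J|"
  shows "regular_family J' K I D"
proof -
  obtain B where B: "\<And>j. j \<in> J \<Longrightarrow> B j \<in> D" "\<And>i. i \<in> I \<Longrightarrow> |{j\<in>J. i \<in> B j}| <o |K|"
    using assms(1) unfolding regular_family_def by blast
  obtain h where h: "inj_on h J'" "h ` J' \<subseteq> J" using assms(2) card_of_ordLeq by metis
  have "|{j\<in>J'. i \<in> B (h j)}| <o |K|" if "i \<in> I" for i
  proof (rule ordLeq_ordLess_trans[OF _ B(2)[OF that]])
    show "|{j\<in>J'. i \<in> B (h j)}| \<le>o |{j\<in>J. i \<in> B j}|"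
      by (rule card_of_ordLeqI[of h]) (use h in \<open>auto simp: inj_on_def\<close>)
  qed
  then show ?thesis unfolding regular_family_def using B(1) h(2) by (intro exI[of _ "\<lambda>j. B (h j)"]) auto
qed

section \<open>Regular families indexed by the successor of a singular cardinal\<close>

context singular_ordinal
begin

definition T :: 'o where "T = next_card L"

lemma cof_T: "cof_above T {..<L}"
  unfolding T_def by (rule cof_above_next_card[OF next_L inf_L])

lemma cof_T_le: "\<tau> \<le> L \<Longrightarrow> cof_above T {..<\<tau>}"
  by (rule cof_above_mono[OF cof_T card_of_mono1]) auto

lemma nat_T: "cof_above T (UNIV :: nat set)"
  by (rule cof_above_mono[OF cof_T infinite_nat_ordLeq[OF inf_L]])

lemma below_T: "d < T \<Longrightarrow> |{..<d}| \<le>o |{..<L}|"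
  unfolding T_def by (rule below_next_card)

lemma T_le_card: "\<not> |J| \<le>o |{..<L}| \<Longrightarrow> |{..<T}| \<le>o |J|"
  using card_less_next_card[of J L] unfolding T_def
  by (meson card_of_Well_order not_ordLeq_iff_ordLess)

lemma below_L: "x < L \<Longrightarrow> next_card x < L" "x < L \<Longrightarrow> |{..<x}| <o |{..<next_card x}|"
proof -
  assume "x < L"
  then obtain y where y: "y < L" "\<not> |{..<y}| \<le>o |{..<x}|" using limit_cardinal by blast
  show "next_card x < L" using next_card_not_le(2)[OF y(2)] y(1) by simp
  show "|{..<x}| <o |{..<next_card x}|"
    using next_card_not_le(1)[OF y(2)] by (meson card_of_Well_order not_ordLeq_iff_ordLess)
qed

lemma small_cofinal_subset:
  assumes d: "d < T"
  shows "\<exists>Y\<subseteq>{..<d}. |Y| <o |{..<L}| \<and> (\<forall>b<d. \<exists>y\<in>Y. b \<le> y)"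
proof -
  have "\<exists>z<L. \<not> cof_above d {..<z}"
  proof (cases "cof_above d Z")
    case True
    then show ?thesis using small_cofinal[OF below_T[OF d] Z(3) True] Z(1) by blast
  next
    case False
    then show ?thesis using mL cof_above_mono[OF _ Z(2)] by blast
  qed
  then obtain z where z: "z < L" "\<not> cof_above d {..<z}" by blast
  obtain Y where Y: "Y \<subseteq> {..<d}" "|Y| \<le>o |{..<z}|" "\<forall>b<d. \<exists>y\<in>Y. b \<le> y"
    using not_cof_aboveD[OF z(2)] by blast
  have "|Y| <o |{..<L}|" by (rule ordLeq_ordLess_trans[OF Y(2) init[OF z(1)]])
  then show ?thesis using Y(1,3) by blast
qed

text \<open>On the club of closure points of \<open>g\<close> the intervals from \<open>x\<close> to
  \<open>g x\<close> are disjoint. A point lying in many of the sets picks different elements of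
  \<open>c i\<close> from them, so it lies in at most \<open>|c i|\<close> many.\<close>

lemma regular_family_intervals:
  assumes F: "filter_on I D" and c: "\<And>i. i \<in> I \<Longrightarrow> |c i| <o |K|"
    and int: "\<And>\<alpha>. \<alpha> < T \<Longrightarrow> \<exists>\<beta><T. {i\<in>I. \<exists>y\<in>c i. \<alpha> \<le> y \<and> y < \<beta>} \<in> D"
  shows "regular_family {..<T} K I D"
proof -
  define g where "g \<alpha> = (LEAST \<beta>. {i\<in>I. \<exists>y\<in>c i. \<alpha> \<le> y \<and> y < \<beta>} \<in> D)" for \<alpha>
  have g: "{i\<in>I. \<exists>y\<in>c i. \<alpha> \<le> y \<and> y < g \<alpha>} \<in> D \<and> g \<alpha> < T" if \<alpha>: "\<alpha> < T" for \<alpha>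
  proof -
    obtain \<beta> where \<beta>: "\<beta> < T" "{i\<in>I. \<exists>y\<in>c i. \<alpha> \<le> y \<and> y < \<beta>} \<in> D" using int[OF \<alpha>] by blast
    have "{i\<in>I. \<exists>y\<in>c i. \<alpha> \<le> y \<and> y < g \<alpha>} \<in> D" unfolding g_def by (rule LeastI) (rule \<beta>(2))
    moreover have "g \<alpha> \<le> \<beta>" unfolding g_def by (rule Least_le) (rule \<beta>(2))
    ultimately show ?thesis using \<beta>(1) by auto
  qed
  have g_mono: "g \<alpha> \<le> g \<beta>" if "\<alpha> \<le> \<beta>" "\<beta> < T" for \<alpha> \<beta>
    unfolding g_def[of \<alpha>]
  proof (rule Least_le, rule filter_on_mono[OF F conjunct1[OF g[OF that(2)]]])
    show "{i\<in>I. \<exists>y\<in>c i. \<beta> \<le> y \<and> y < g \<beta>} \<subseteq> {i\<in>I. \<exists>y\<in>c i. \<alpha> \<le> y \<and> y < g \<beta>}"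
      using that(1) by (auto intro: order_trans)
  qed auto
  define C where "C = {x. x < T \<and> (\<exists>y. y < x) \<and> (\<forall>z<x. g z < x)}"
  have C: "closed_unbounded T C" unfolding C_def
    by (rule closed_unbounded_closure_points[OF nat_T _ g_mono]) (use g in blast)
  have "\<not> |C| \<le>o |{..<L}|"
  proof
    assume "|C| \<le>o |{..<L}|"
    then obtain b where b: "b < T" "\<forall>x\<in>C. x < b"
      using cof_aboveD[OF cof_T, of C] C unfolding closed_unbounded_def by blast
    then obtain x where "x \<in> C" "b < x" using C unfolding closed_unbounded_def by blast
    then show False using b(2) by (meson less_asym)
  qed
  then have TC: "|{..<T}| \<le>o |C|" by (rule T_le_card)
  define B where "B x = {i\<in>I. \<exists>y\<in>c i. x \<le> y \<and> y < g x}" for x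
  have "|{x\<in>C. i \<in> B x}| <o |K|" if i: "i \<in> I" for i
  proof (rule ordLeq_ordLess_trans[OF _ c[OF i]])
    define h where "h x = (LEAST y. y \<in> c i \<and> x \<le> y \<and> y < g x)" for x
    have h: "h x \<in> c i \<and> x \<le> h x \<and> h x < g x" if "i \<in> B x" for x
      unfolding h_def by (rule LeastI_ex) (use that in \<open>auto simp: B_def\<close>)
    have less: "h x < h y" if "x < y" "y \<in> C" "i \<in> B x" "i \<in> B y" for x y
    proof -
      have "h x < g x" using h[OF that(3)] by blast
      also have "g x < y" using that(1,2) unfolding C_def by blast
      also have "y \<le> h y" using h[OF that(4)] by blast
      finally show ?thesis .
    qed
    show "|{x\<in>C. i \<in> B x}| \<le>o |c i|"
    proof (rule card_of_ordLeqI[of h])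
      show "inj_on h {x\<in>C. i \<in> B x}"
      proof (rule inj_onI)
        fix x y assume "x \<in> {x\<in>C. i \<in> B x}" "y \<in> {x\<in>C. i \<in> B x}" "h x = h y"
        then show "x = y" using less[of x y] less[of y x] by (cases x y rule: linorder_cases) auto
      qed
    qed (use h in auto)
  qed
  moreover have "\<forall>x\<in>C. B x \<in> D" using g unfolding B_def C_def by blast
  ultimately have "regular_family C K I D" unfolding regular_family_def by (intro exI[of _ B]) simp
  then show ?thesis by (rule regular_family_subset[OF _ TC])
qed

text \<open>For an ultrafilter, \<open>h\<close> represents an element of the ultrapower of
  \<open>T\<close> lying above all constants.\<close>

definition unb :: "'i set \<Rightarrow> 'i set set \<Rightarrow> ('i \<Rightarrow> 'o) \<Rightarrow> bool" where
  "unb I D h \<longleftrightarrow> (\<forall>i\<in>I. h i < T) \<and> (\<forall>\<alpha><T. {i\<in>I. h i < \<alpha>} \<notin> D)"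

lemma unb_ge:
  assumes "ultrafilter_on I D" "unb I D h" "\<alpha> < T"
  shows "{i\<in>I. \<alpha> \<le> h i} \<in> D"
proof -
  have "I - {i\<in>I. h i < \<alpha>} \<in> D"
    by (rule ultrafilter_compl[OF assms(1)]) (use assms(2,3) in \<open>auto simp: unb_def\<close>)
  moreover have "I - {i\<in>I. h i < \<alpha>} = {i\<in>I. \<alpha> \<le> h i}" by auto
  ultimately show ?thesis by simp
qed

lemma unb_gt:
  assumes "ultrafilter_on I D" "unb I D h" "\<alpha> < T"
  shows "{i\<in>I. \<alpha> < h i} \<in> D"
proof -
  have F: "filter_on I D" using assms(1) unfolding ultrafilter_on_def by blast
  obtain \<beta> where "\<beta> < T" "\<alpha> < \<beta>" using cof_above_two[OF nat_T assms(3,3)] by blast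
  then show ?thesis by (intro filter_on_mono[OF F unb_ge[OF assms(1,2)]]) auto
qed

text \<open>Moving \<open>h i\<close> down to the least element not below \<open>\<alpha>\<close> of
  a small cofinal subset of \<open>h i\<close> gives a smaller function, bounded by minimality of
  \<open>h\<close>. Hence some interval above \<open>\<alpha>\<close> meets these cofinal subsets on
  a set in \<open>D\<close>.\<close>

lemma regular_family_least:
  assumes D: "ultrafilter_on I D" and h: "unb I D h"
    and least: "\<And>h'. unb I D h' \<Longrightarrow> {i\<in>I. h' i < h i} \<notin> D"
  shows "regular_family {..<T} {..<L} I D"
proof -
  have F: "filter_on I D" using D unfolding ultrafilter_on_def by blast
  have "\<exists>Y. d < T \<longrightarrow> Y \<subseteq> {..<d} \<and> |Y| <o |{..<L}| \<and> (\<forall>b<d. \<exists>y\<in>Y. b \<le> y)" for d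
    using small_cofinal_subset[of d] by blast
  then obtain Y where Y: "\<And>d. d < T \<Longrightarrow> Y d \<subseteq> {..<d}" "\<And>d. d < T \<Longrightarrow> |Y d| <o |{..<L}|"
    "\<And>d b. d < T \<Longrightarrow> b < d \<Longrightarrow> \<exists>y\<in>Y d. b \<le> y" by metis
  have hT: "h i < T" if "i \<in> I" for i using h that unfolding unb_def by blast
  show ?thesis
  proof (rule regular_family_intervals[OF F, of "\<lambda>i. Y (h i)"])
    show "|Y (h i)| <o |{..<L}|" if "i \<in> I" for i by (rule Y(2)[OF hT[OF that]])
    fix \<alpha> assume \<alpha>: "\<alpha> < T"
    define h' where "h' i = (if \<alpha> < h i then LEAST y. y \<in> Y (h i) \<and> \<alpha> \<le> y else \<alpha>)" for i
    have h': "h' i \<in> Y (h i) \<and> \<alpha> \<le> h' i \<and> h' i < h i" if i: "i \<in> I" "\<alpha> < h i" for i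
    proof -
      have "\<exists>y. y \<in> Y (h i) \<and> \<alpha> \<le> y" using Y(3)[OF hT[OF i(1)] i(2)] by blast
      then have "(LEAST y. y \<in> Y (h i) \<and> \<alpha> \<le> y) \<in> Y (h i) \<and> \<alpha> \<le> (LEAST y. y \<in> Y (h i) \<and> \<alpha> \<le> y)"
        by (rule LeastI_ex)
      then have "h' i \<in> Y (h i) \<and> \<alpha> \<le> h' i" unfolding h'_def using i(2) by simp
      then show ?thesis using Y(1)[OF hT[OF i(1)]] by auto
    qed
    have up: "{i\<in>I. \<alpha> < h i} \<in> D" by (rule unb_gt[OF D h \<alpha>])
    have "{i\<in>I. h' i < h i} \<in> D" by (rule filter_on_mono[OF F up]) (use h' in auto)
    then have "\<not> unb I D h'" using least by blast
    moreover have "\<forall>i\<in>I. h' i < T"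
    proof
      fix i assume i: "i \<in> I"
      show "h' i < T"
      proof (cases "\<alpha> < h i")
        case True
        then show ?thesis using h'[OF i] hT[OF i] by (meson less_trans)
      qed (simp add: h'_def \<alpha>)
    qed
    ultimately obtain \<beta> where \<beta>: "\<beta> < T" "{i\<in>I. h' i < \<beta>} \<in> D" unfolding unb_def by blast
    have "{i\<in>I. \<exists>y\<in>Y (h i). \<alpha> \<le> y \<and> y < \<beta>} \<in> D"
      by (rule filter_on_mono[OF F filter_on_Int[OF F up \<beta>(2)]]) (use h' in blast)+
    then show "\<exists>\<beta><T. {i\<in>I. \<exists>y\<in>Y (h i). \<alpha> \<le> y \<and> y < \<beta>} \<in> D" using \<beta>(1) by blast
  qed
qed

text \<open>
  If every unbounded function has a smaller one modulo \<open>D\<close>, one can go down \<open>\<tau>\<close> times, each time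
  below all but boundedly many of the previous values; the resulting sets are point-finite because a
  decreasing sequence of ordinals is finite.
\<close>

lemma point_finite_family:
  assumes D: "ultrafilter_on I D" and f: "unb I D f"
    and noleast: "\<And>h. unb I D h \<Longrightarrow> \<exists>h'. unb I D h' \<and> {i\<in>I. h' i < h i} \<in> D"
    and \<tau>: "\<tau> < L" and nreg: "\<not> regular_family {..<T} {..<next_card \<tau>} I D"
  shows "\<exists>B. (\<forall>x<\<tau>. B x \<in> D) \<and> (\<forall>i\<in>I. finite {x. x < \<tau> \<and> i \<in> B x})"
proof -
  have F: "filter_on I D" using D unfolding ultrafilter_on_def by blast
  \<comment> \<open>A stage carries a function and a threshold; the function must lie below all
    earlier ones whose values reach the threshold. The guard \<open>\<zeta> < \<tau>\<close> makes
    the recursion total.\<close>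
  define ok where "ok S \<zeta> r \<longleftrightarrow> (\<zeta> < \<tau> \<longrightarrow> snd r < T \<and> unb I D (fst r) \<and>
    {i\<in>I. \<forall>\<eta><\<zeta>. snd r \<le> fst (S \<eta>) i \<longrightarrow> fst r i < fst (S \<eta>) i} \<in> D)"
    for S :: "'o \<Rightarrow> ('a \<Rightarrow> 'o) \<times> 'o" and \<zeta> r
  have "\<exists>S. \<forall>\<zeta>. ok S \<zeta> (S \<zeta>)"
  proof (rule dependent_wellorder_choice[of ok])
    fix r :: "('a \<Rightarrow> 'o) \<times> 'o" and S S' :: "'o \<Rightarrow> ('a \<Rightarrow> 'o) \<times> 'o" and \<zeta> :: 'o
    assume eq: "\<And>y. y < \<zeta> \<Longrightarrow> S y = S' y"
    have "{i\<in>I. \<forall>\<eta><\<zeta>. snd r \<le> fst (S \<eta>) i \<longrightarrow> fst r i < fst (S \<eta>) i} =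
      {i\<in>I. \<forall>\<eta><\<zeta>. snd r \<le> fst (S' \<eta>) i \<longrightarrow> fst r i < fst (S' \<eta>) i}"
      by (rule Collect_cong) (use eq in auto)
    then show "ok S \<zeta> r = ok S' \<zeta> r" unfolding ok_def by (simp only:)
  next
    fix S :: "'o \<Rightarrow> ('a \<Rightarrow> 'o) \<times> 'o" and \<zeta> :: 'o
    assume IH: "\<And>y. y < \<zeta> \<Longrightarrow> ok S y (S y)"
    show "\<exists>r. ok S \<zeta> r"
    proof (cases "\<zeta> < \<tau>")
      case True
      define c where "c i = (\<lambda>\<eta>. fst (S \<eta>) i) ` {..<\<zeta>}" for i
      have "|c i| <o |{..<next_card \<tau>}|" for i
      proof -
        have "|c i| \<le>o |{..<\<zeta>}|" unfolding c_def by (rule card_of_image)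
        moreover have "|{..<\<zeta>}| \<le>o |{..<\<tau>}|" by (rule card_of_mono1) (use True in auto)
        ultimately have "|c i| \<le>o |{..<\<tau>}|" by (rule ordLeq_transitive)
        then show ?thesis by (rule ordLeq_ordLess_trans[OF _ below_L(2)[OF \<tau>]])
      qed
      \<comment> \<open>The earlier functions give fewer than \<open>next_card \<tau>\<close> values
        at each point, so the lack of regularity supplies an \<open>\<alpha>\<close> above which no
        bounded interval catches them on a set in \<open>D\<close>.\<close>
      then obtain \<alpha> where \<alpha>: "\<alpha> < T" "\<And>\<beta>. \<beta> < T \<Longrightarrow> {i\<in>I. \<exists>y\<in>c i. \<alpha> \<le> y \<and> y < \<beta>} \<notin> D"
        using regular_family_intervals[OF F, of c "{..<next_card \<tau>}"] nreg by blast
      \<comment> \<open>The pointwise minimum of \<open>f\<close> and of the earlier values from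
        \<open>\<alpha>\<close> on. It remains unbounded: below \<open>\<beta>\<close> it is either
        \<open>f\<close> or a caught value, and neither happens on a set in
        \<open>D\<close>.\<close>
      define g where "g i = (LEAST y. y = f i \<or> y \<in> c i \<and> \<alpha> \<le> y)" for i
      have g: "g i = f i \<or> g i \<in> c i \<and> \<alpha> \<le> g i" for i unfolding g_def by (rule LeastI[of _ "f i"]) simp
      have g_le: "g i \<le> y" if "y = f i \<or> y \<in> c i \<and> \<alpha> \<le> y" for i y
        unfolding g_def by (rule Least_le) (rule that)
      have g_unb: "unb I D g"
        unfolding unb_def
      proof (intro conjI ballI allI impI)
        fix i assume "i \<in> I"
        then show "g i < T" using g_le[of "f i" i] f unfolding unb_def by (auto intro: le_less_trans)
      next
        fix \<beta> assume \<beta>: "\<beta> < T"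
        let ?A = "{i\<in>I. f i < \<beta>}" and ?B = "{i\<in>I. \<exists>y\<in>c i. \<alpha> \<le> y \<and> y < \<beta>}"
        have A: "?A \<notin> D" using f \<beta> unfolding unb_def by blast
        have AB: "?A \<union> ?B \<notin> D" by (rule ultrafilter_Un[OF D _ A _ \<alpha>(2)[OF \<beta>]]) auto
        have sub: "{i\<in>I. g i < \<beta>} \<subseteq> ?A \<union> ?B"
        proof
          fix i assume "i \<in> {i\<in>I. g i < \<beta>}"
          then show "i \<in> ?A \<union> ?B" using g[of i] by auto
        qed
        show "{i\<in>I. g i < \<beta>} \<notin> D"
        proof
          assume "{i\<in>I. g i < \<beta>} \<in> D"
          then have "?A \<union> ?B \<in> D" by (rule filter_on_mono[OF F _ sub]) auto
          then show False using AB by blast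
        qed
      qed
      then obtain h where h: "unb I D h" "{i\<in>I. h i < g i} \<in> D" using noleast[OF g_unb] by blast
      have "{i\<in>I. \<forall>\<eta><\<zeta>. \<alpha> \<le> fst (S \<eta>) i \<longrightarrow> h i < fst (S \<eta>) i} \<in> D"
      proof (rule filter_on_mono[OF F h(2)], safe)
        fix i \<eta> assume i: "i \<in> I" "h i < g i" "\<eta> < \<zeta>" "\<alpha> \<le> fst (S \<eta>) i"
        then have "g i \<le> fst (S \<eta>) i" by (intro g_le) (auto simp: c_def)
        then show "h i < fst (S \<eta>) i" using i(2) by simp
      qed
      then have "ok S \<zeta> (h, \<alpha>)" unfolding ok_def using \<alpha>(1) h(1) by simp
      then show ?thesis by blast
    qed (simp add: ok_def)
  qed
  then obtain S where S': "\<forall>\<zeta>. ok S \<zeta> (S \<zeta>)" by (rule exE)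
  then have S: "ok S \<zeta> (S \<zeta>)" for \<zeta> by (rule spec)
  obtain \<alpha> where \<alpha>: "\<alpha> < T" "\<forall>\<zeta>\<in>{..<\<tau>}. snd (S \<zeta>) < \<alpha>"
    using cof_above_image[OF cof_T_le[OF less_imp_le[OF \<tau>]] ordLeq_refl[OF card_of_Card_order], of "\<lambda>\<zeta>. snd (S \<zeta>)"] S
    unfolding ok_def by auto
  \<comment> \<open>Restricting to values at least \<open>\<alpha>\<close>, which exceeds every
    threshold, makes all comparisons between stages strict.\<close>
  define B where "B \<zeta> = {i\<in>I. \<forall>\<eta><\<zeta>. snd (S \<zeta>) \<le> fst (S \<eta>) i \<longrightarrow> fst (S \<zeta>) i < fst (S \<eta>) i} \<inter>
    {i\<in>I. \<alpha> \<le> fst (S \<zeta>) i}" for \<zeta>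
  have "B \<zeta> \<in> D" if \<zeta>: "\<zeta> < \<tau>" for \<zeta>
    unfolding B_def
  proof (rule filter_on_Int[OF F _ unb_ge[OF D _ \<alpha>(1)]])
    show "{i\<in>I. \<forall>\<eta><\<zeta>. snd (S \<zeta>) \<le> fst (S \<eta>) i \<longrightarrow> fst (S \<zeta>) i < fst (S \<eta>) i} \<in> D"
      and "unb I D (fst (S \<zeta>))" using S[of \<zeta>] \<zeta> unfolding ok_def by auto
  qed
  moreover have "finite {x. x < \<tau> \<and> i \<in> B x}" for i
  proof (rule finite_strictly_decreasing[of _ "\<lambda>x. fst (S x) i"])
    fix x y assume xy: "x \<in> {x. x < \<tau> \<and> i \<in> B x}" "y \<in> {x. x < \<tau> \<and> i \<in> B x}" "x < y"
    then have "snd (S y) < \<alpha>" "\<alpha> \<le> fst (S x) i" using \<alpha>(2) unfolding B_def by auto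
    then have "snd (S y) \<le> fst (S x) i" by simp
    then show "fst (S y) i < fst (S x) i" using xy unfolding B_def by auto
  qed
  ultimately show ?thesis by (intro exI[of _ B]) simp
qed

text \<open>The families combine to finite sets \<open>K i\<close> such that each
  \<open>x < L\<close> is in \<open>K i\<close> for a set of \<open>i\<close> in \<open>D\<close>.
  If \<open>D\<close> were not decomposable over \<open>L\<close>, fewer than \<lambda> finite sets
  would occur on a set in \<open>D\<close>, and some \<open>x\<close> would lie in none of
  them.\<close>

lemma decomposable_of_point_finite:
  assumes F: "filter_on I D"
    and B: "\<And>\<tau>. \<tau> < L \<Longrightarrow> \<exists>B. (\<forall>x<\<tau>. B x \<in> D) \<and> (\<forall>i\<in>I. finite {x. x < \<tau> \<and> i \<in> B x})"
  shows "set_decomposable {..<L} I D"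
proof (rule ccontr)
  assume nd: "\<not> set_decomposable {..<L} I D"
  obtain B' where B': "\<And>\<tau> x. \<tau> < L \<Longrightarrow> x < \<tau> \<Longrightarrow> B' \<tau> x \<in> D"
    "\<And>\<tau> i. \<tau> < L \<Longrightarrow> i \<in> I \<Longrightarrow> finite {x. x < \<tau> \<and> i \<in> B' \<tau> x}"
    using B by metis
  obtain e where e: "inj_on e Z" "e ` Z \<subseteq> {..<m}" using Z(2) card_of_ordLeq by metis
  \<comment> \<open>The family of length \<open>m\<close>, transferred to \<open>Z\<close> by
    \<open>e\<close>, leaves only finitely many \<open>z\<close> active at each \<open>i\<close>;
    the family of length \<open>z\<close> leaves finitely many \<open>x\<close> for each of
    them.\<close>
  define K where "K i = (\<Union>z\<in>{z\<in>Z. i \<in> B' m (e z)}. {x. x < z \<and> i \<in> B' z x})" for i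
  have K_fin: "K i \<subseteq> {..<L} \<and> finite (K i)" if i: "i \<in> I" for i
  proof
    show "K i \<subseteq> {..<L}" using Z(1) unfolding K_def by (auto intro: less_trans)
    have "finite {z\<in>Z. i \<in> B' m (e z)}"
    proof (rule finite_imageD)
      show "finite (e ` {z\<in>Z. i \<in> B' m (e z)})"
        by (rule finite_subset[OF _ B'(2)[OF mL i]]) (use e(2) in auto)
      show "inj_on e {z\<in>Z. i \<in> B' m (e z)}" by (rule inj_on_subset[OF e(1)]) auto
    qed
    then show "finite (K i)" unfolding K_def by (rule finite_UN_I) (use B'(2) Z(1) i in auto)
  qed
  have K_D: "{i\<in>I. x \<in> K i} \<in> D" if x: "x < L" for x
  proof -
    obtain z where z: "z \<in> Z" "x < z" "z < L" using Z(3)[OF x] Z(1) by auto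
    have "B' m (e z) \<inter> B' z x \<in> D" by (rule filter_on_Int[OF F B'(1)[OF mL] B'(1)[OF z(3,2)]]) (use e(2) z in auto)
    then show ?thesis
    proof (rule filter_on_mono[OF F])
      show "B' m (e z) \<inter> B' z x \<subseteq> {i\<in>I. x \<in> K i}"
        using z filter_on_subset[OF F B'(1)[OF z(3,2)]] unfolding K_def by auto
    qed auto
  qed
  let ?X = "{S. S \<subseteq> {..<L} \<and> finite S}"
  have "{i\<in>I. K i \<in> ?X} = I" using K_fin by auto
  then have "{i\<in>I. K i \<in> ?X} \<in> D" using F unfolding filter_on_def by simp
  then obtain X' where X': "X' \<subseteq> ?X" "|X'| <o |{..<L}|" "{i\<in>I. K i \<in> X'} \<in> D"
    using small_support[OF F nd _ card_of_finite_subsets[OF inf_L]] mL by blast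
  obtain z where z: "z < L" "|X'| =o |{..<z}|" using card_ordinal[OF X'(2)] by blast
  define k where "k = max z m"
  have k: "k < L" "z \<le> k" "m \<le> k" using z mL unfolding k_def by auto
  have infk: "infinite {..<k}" using infinite_super[of "{..<m}" "{..<k}"] inf k by auto
  have "|{..<z}| \<le>o |{..<k}|" by (rule card_of_mono1) (use k in auto)
  then have "|X'| \<le>o |{..<k}|" using z(2) ordIso_ordLeq_trans by blast
  then have "|\<Union>S\<in>X'. S| \<le>o |{..<k}|"
  proof (rule card_of_UNION_ordLeq_infinite[OF infk], intro ballI)
    fix S assume "S \<in> X'"
    then have "finite S" using X'(1) by blast
    then show "|S| \<le>o |{..<k}|"
      using ordLess_imp_ordLeq[OF finite_ordLess_infinite[OF card_of_Well_order card_of_Well_order, of S "{..<k}"]] infk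
      by (simp add: Field_card_of)
  qed
  then have "|\<Union>S\<in>X'. S| <o |{..<L}|" using init[OF k(1)] ordLeq_ordLess_trans by blast
  then have "\<not> {..<L} \<subseteq> (\<Union>S\<in>X'. S)" using card_of_mono1 not_ordLess_ordLeq by blast
  then obtain x where x: "x < L" "x \<notin> (\<Union>S\<in>X'. S)" by blast
  have "{i\<in>I. x \<in> K i} \<inter> {i\<in>I. K i \<in> X'} \<in> D" by (rule filter_on_Int[OF F K_D[OF x(1)] X'(3)])
  moreover have "{i\<in>I. x \<in> K i} \<inter> {i\<in>I. K i \<in> X'} = {}" using x(2) by auto
  ultimately show False using filter_on_empty[OF F] by simp
qed

text \<open>The enumeration of \<open>f i\<close> places \<open>x\<close> in a block determined by
  \<open>Z\<close>. Indecomposability over \<open>Z\<close> bounds the block on a set in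
  \<open>D\<close>, and \<open>\<lambda>\<^sup>+\<close> many \<open>x\<close> share one bound
  \<open>b0\<close>. Injectivity of the enumeration allows a point at most \<open>|{..<b0}|\<close>
  of these \<open>x\<close>.\<close>

lemma regular_family_of_indecomposable:
  assumes D: "ultrafilter_on I D" and f: "unb I D f"
    and Zmin: "\<And>X. X \<subseteq> Z \<Longrightarrow> |X| <o |Z| \<Longrightarrow> \<exists>b<L. \<forall>x\<in>X. x \<le> b"
    and nd: "\<not> set_decomposable Z I D"
  shows "\<exists>z<L. regular_family {..<T} {..<z} I D"
proof -
  have F: "filter_on I D" using D unfolding ultrafilter_on_def by blast
  have "\<exists>e. d < T \<longrightarrow> inj_on e {..<d} \<and> e ` {..<d} \<subseteq> {..<L}" for d
    using below_T[of d] card_of_ordLeq by metis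
  then obtain e where e: "\<And>d. d < T \<Longrightarrow> inj_on (e d) {..<d}" "\<And>d. d < T \<Longrightarrow> e d ` {..<d} \<subseteq> {..<L}"
    by metis
  have fT: "f i < T" if "i \<in> I" for i using f that unfolding unb_def by blast
  obtain z0 where z0: "z0 \<in> Z" using Z(3)[OF mL] by blast
  have "\<exists>b<L. {i\<in>I. x < f i \<and> e (f i) x < b} \<in> D" if x: "x < T" for x
  proof -
    define zf where "zf i = (if x < f i \<and> i \<in> I then LEAST z. z \<in> Z \<and> e (f i) x < z else z0)" for i
    have zf: "zf i \<in> Z \<and> e (f i) x < zf i" if i: "i \<in> I" "x < f i" for i
    proof -
      have "e (f i) x < L" using e(2)[OF fT[OF i(1)]] i(2) by auto
      then have "\<exists>z. z \<in> Z \<and> e (f i) x < z" using Z(3) by blast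
      then have "(LEAST z. z \<in> Z \<and> e (f i) x < z) \<in> Z \<and> e (f i) x < (LEAST z. z \<in> Z \<and> e (f i) x < z)"
        by (rule LeastI_ex)
      then show ?thesis unfolding zf_def using i by simp
    qed
    have "zf ` I \<subseteq> Z" using zf z0 unfolding zf_def by auto
    then obtain X where X: "X \<subseteq> Z" "|X| <o |Z|" "{i\<in>I. zf i \<in> X} \<in> D"
      using not_set_decomposableD[OF nd, of zf] by blast
    obtain b where b: "b < L" "\<forall>x\<in>X. x \<le> b" using Zmin[OF X(1,2)] by blast
    have "{i\<in>I. x < f i \<and> e (f i) x < b} \<in> D"
      by (rule filter_on_mono[OF F filter_on_Int[OF F unb_gt[OF D f x] X(3)]])
        (use zf b(2) in \<open>auto intro: less_le_trans\<close>)
    then show ?thesis using b(1) by blast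
  qed
  then obtain b where b: "\<And>x. x < T \<Longrightarrow> b x < L"
    "\<And>x. x < T \<Longrightarrow> {i\<in>I. x < f i \<and> e (f i) x < b x} \<in> D" by metis
  have "\<exists>b0<L. \<not> |{x. x < T \<and> b x = b0}| \<le>o |{..<L}|"
  proof (rule ccontr)
    assume "\<not> ?thesis"
    then have "|\<Union>b0\<in>{..<L}. {x. x < T \<and> b x = b0}| \<le>o |{..<L}|"
      by (intro card_of_UNION_ordLeq_infinite[OF inf_L ordLeq_refl[OF card_of_Card_order]]) blast
    moreover have "{..<T} \<subseteq> (\<Union>b0\<in>{..<L}. {x. x < T \<and> b x = b0})" using b(1) by auto
    ultimately have "|{..<T}| \<le>o |{..<L}|" using card_of_subset_ordLeq by blast
    then show False using next_L unfolding T_def by blast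
  qed
  then obtain b0 where b0: "b0 < L" "\<not> |{x. x < T \<and> b x = b0}| \<le>o |{..<L}|" by blast
  define J where "J = {x. x < T \<and> b x = b0}"
  define B where "B x = {i\<in>I. x < f i \<and> e (f i) x < b0}" for x
  have "|{x\<in>J. i \<in> B x}| <o |{..<next_card b0}|" if i: "i \<in> I" for i
  proof (rule ordLeq_ordLess_trans[OF _ below_L(2)[OF b0(1)]])
    show "|{x\<in>J. i \<in> B x}| \<le>o |{..<b0}|"
      by (rule card_of_ordLeqI[of "e (f i)"])
        (use e(1)[OF fT[OF i]] in \<open>auto simp: inj_on_def B_def\<close>)
  qed
  moreover have "\<forall>x\<in>J. B x \<in> D" using b(2) unfolding J_def B_def by auto
  ultimately have "regular_family J {..<next_card b0} I D"
    unfolding regular_family_def by (intro exI[of _ B]) simp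
  then have "regular_family {..<T} {..<next_card b0} I D"
    by (rule regular_family_subset) (rule T_le_card[OF b0(2)[folded J_def]])
  then show ?thesis using below_L(1)[OF b0(1)] by blast
qed

theorem ultrafilter_trichotomy:
  assumes D: "ultrafilter_on I D" and dec: "set_decomposable {..<T} I D"
    and Zmin: "\<And>X. X \<subseteq> Z \<Longrightarrow> |X| <o |Z| \<Longrightarrow> \<exists>b<L. \<forall>x\<in>X. x \<le> b"
  shows "set_decomposable {..<L} I D \<or> (\<exists>z<L. regular_family {..<T} {..<z} I D) \<or>
    (set_decomposable Z I D \<and> regular_family {..<T} {..<L} I D)"
proof -
  have F: "filter_on I D" using D unfolding ultrafilter_on_def by blast
  obtain f where f: "f ` I \<subseteq> {..<T}" "\<And>X. X \<subseteq> {..<T} \<Longrightarrow> |X| <o |{..<T}| \<Longrightarrow> {i\<in>I. f i \<in> X} \<notin> D"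
    using dec unfolding set_decomposable_def by blast
  have LT: "|{..<L}| <o |{..<T}|"
    using next_L unfolding T_def by (meson card_of_Well_order not_ordLeq_iff_ordLess)
  have "{i\<in>I. f i < \<alpha>} \<notin> D" if \<alpha>: "\<alpha> < T" for \<alpha>
  proof -
    have "|{..<\<alpha>}| <o |{..<T}|" using below_T[OF \<alpha>] LT ordLeq_ordLess_trans by blast
    then have "{i\<in>I. f i \<in> {..<\<alpha>}} \<notin> D" by (intro f(2)) (use \<alpha> in auto)
    then show ?thesis by simp
  qed
  then have unb: "unb I D f" using f(1) unfolding unb_def by blast
  show ?thesis
  proof (cases "\<exists>z<L. regular_family {..<T} {..<z} I D")
    case nreg: False
    have decZ: "set_decomposable Z I D"
      using regular_family_of_indecomposable[OF D unb Zmin] nreg by blast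
    show ?thesis
    proof (cases "\<exists>h. unb I D h \<and> (\<forall>h'. unb I D h' \<longrightarrow> {i\<in>I. h' i < h i} \<notin> D)")
      case True
      then obtain h where h: "unb I D h" "\<And>h'. unb I D h' \<Longrightarrow> {i\<in>I. h' i < h i} \<notin> D" by blast
      then show ?thesis using regular_family_least[OF D h] decZ by blast
    next
      case False
      have nl: "\<exists>h'. unb I D h' \<and> {i\<in>I. h' i < h i} \<in> D" if "unb I D h" for h using False that by blast
      have "set_decomposable {..<L} I D"
      proof (rule decomposable_of_point_finite[OF F])
        fix \<tau> assume \<tau>: "\<tau> < L"
        have "\<not> regular_family {..<T} {..<next_card \<tau>} I D" using nreg below_L(1)[OF \<tau>] by blast
        show "\<exists>B. (\<forall>x<\<tau>. B x \<in> D) \<and> (\<forall>i\<in>I. finite {x. x < \<tau> \<and> i \<in> B x})"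
          by (rule point_finite_family[OF D unb _ \<tau> \<open>\<not> regular_family {..<T} {..<next_card \<tau>} I D\<close>]) (rule nl)
      qed
      then show ?thesis by blast
    qed
  qed blast
qed

end

section \<open>Passage to an arbitrary cardinal order\<close>

text \<open>An arbitrary well-order of \<open>'a\<close> is fixed; only its length matters.\<close>

datatype 'a ordinal = Ordinal (un_ordinal: 'a)

instantiation ordinal :: (type) wellorder
begin

definition less_eq_ordinal :: "'a ordinal \<Rightarrow> 'a ordinal \<Rightarrow> bool" where
  "x \<le> y \<longleftrightarrow> (un_ordinal x, un_ordinal y) \<in> (SOME r. well_order_on UNIV r)"

definition less_ordinal :: "'a ordinal \<Rightarrow> 'a ordinal \<Rightarrow> bool" where
  "x < y \<longleftrightarrow> x \<le> y \<and> \<not> y \<le> (x :: 'a ordinal)"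

instance
proof -
  define r :: "'a rel" where "r = (SOME r. well_order_on UNIV r)"
  have r: "well_order_on UNIV r" unfolding r_def by (rule someI_ex) (rule well_order_on)
  have le: "x \<le> y \<longleftrightarrow> (un_ordinal x, un_ordinal y) \<in> r" for x y :: "'a ordinal"
    unfolding less_eq_ordinal_def r_def ..
  have rel: "refl_on UNIV r" "trans r" "antisym r" "total_on UNIV r" and wf: "wf (r - Id)"
    using r unfolding order_on_defs by auto
  have refl: "(a, a) \<in> r" for a by (rule refl_onD[OF rel(1)]) simp
  have anti: "a = b" if "(a, b) \<in> r" "(b, a) \<in> r" for a b by (rule antisymD[OF rel(3) that])
  have total: "(a, b) \<in> r \<or> (b, a) \<in> r" for a b
    using rel(4) refl unfolding total_on_def by (cases "a = b") auto
  have less_r: "x < y \<longleftrightarrow> (un_ordinal x, un_ordinal y) \<in> r - Id" for x y :: "'a ordinal"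
    unfolding less_ordinal_def le using refl anti by (auto intro: ordinal.expand)
  show "OFCLASS('a ordinal, wellorder_class)"
  proof
    fix x y z :: "'a ordinal"
    show "x < y \<longleftrightarrow> x \<le> y \<and> \<not> y \<le> x" by (rule less_ordinal_def)
    show "x \<le> x" unfolding le by (rule refl)
    show "x \<le> y \<Longrightarrow> y \<le> z \<Longrightarrow> x \<le> z" unfolding le by (rule transD[OF rel(2)])
    show "x \<le> y \<Longrightarrow> y \<le> x \<Longrightarrow> x = y" unfolding le by (rule ordinal.expand, rule anti)
    show "x \<le> y \<or> y \<le> x" unfolding le by (rule total)
  next
    fix P :: "'a ordinal \<Rightarrow> bool" and a :: "'a ordinal"
    assume step: "\<And>x. (\<And>y. y < x \<Longrightarrow> P y) \<Longrightarrow> P x"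
    have "P (Ordinal b)" for b
      using wf
    proof (induction b rule: wf_induct_rule)
      case (less b)
      show ?case
      proof (rule step)
        fix y assume "y < Ordinal b"
        then have "P (Ordinal (un_ordinal y))" by (intro less.IH) (simp add: less_r)
        then show "P y" by simp
      qed
    qed
    from this[of "un_ordinal a"] show "P a" by simp
  qed
qed

end

lemma card_ordinal_UNIV: "|UNIV :: 'a set| \<le>o |UNIV :: 'a ordinal set|"
  by (rule card_of_ordLeqI[of Ordinal]) (auto simp: inj_on_def)

lemma card_next_card:
  fixes x y :: "'o::wellorder"
  assumes r: "Card_order r" and xr: "|{..<x}| =o r" and y: "\<not> |{..<y}| \<le>o |{..<x}|"
  shows "|{..<next_card x}| =o cardSuc r"
proof -
  have n: "|{..<x}| <o |{..<next_card x}|"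
    using next_card_not_le(1)[OF y] by (meson card_of_Well_order not_ordLeq_iff_ordLess)
  then have "r <o |{..<next_card x}|" by (rule ordIso_ordLess_trans[OF ordIso_symmetric[OF xr]])
  then have ge: "cardSuc r \<le>o |{..<next_card x}|" by (rule cardSuc_least[OF r card_of_Card_order])
  have F: "|Field (cardSuc r)| =o cardSuc r" by (rule card_of_Field_ordIso[OF cardSuc_Card_order[OF r]])
  have "\<not> cardSuc r <o |{..<next_card x}|"
  proof
    assume "cardSuc r <o |{..<next_card x}|"
    then have "|Field (cardSuc r)| <o |{..<next_card x}|" by (rule ordIso_ordLess_trans[OF F])
    then have "|Field (cardSuc r)| \<le>o |{..<x}|" by (rule card_less_next_card)
    then have "cardSuc r \<le>o |{..<x}|" by (rule ordIso_ordLeq_trans[OF ordIso_symmetric[OF F]])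
    then have "cardSuc r \<le>o r" by (rule ordLeq_ordIso_trans[OF _ xr])
    then show False using cardSuc_greater[OF r] not_ordLess_ordLeq by blast
  qed
  then have "cardSuc r =o |{..<next_card x}|" using iffD1[OF ordLeq_iff_ordLess_or_ordIso ge] by blast
  then show ?thesis by (rule ordIso_symmetric)
qed

section \<open>From indexed families to regular ultrafilters\<close>

lemma regular_ufI:
  assumes "E \<subseteq> D" "|E| =o n" "\<And>E'. E' \<subseteq> E \<Longrightarrow> |E'| =o m \<Longrightarrow> \<Inter>E' = {}"
  shows "regular_uf m n D"
  unfolding regular_uf_def using assms by (intro exI[of _ E] conjI allI impI)

lemma regular_uf_mono:
  assumes reg: "regular_uf m n D" and c: "Card_order m" "Card_order r" and le: "m \<le>o r" "r \<le>o n"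
  shows "regular_uf r r D"
proof -
  obtain E where E: "E \<subseteq> D" "|E| =o n" "\<And>E'. E' \<subseteq> E \<Longrightarrow> |E'| =o m \<Longrightarrow> \<Inter>E' = {}"
    using reg unfolding regular_uf_def by blast
  note Fr = card_of_Field_ordIso[OF c(2)] and Fm = card_of_Field_ordIso[OF c(1)]
  have "|Field r| \<le>o n" by (rule ordIso_ordLeq_trans[OF Fr le(2)])
  then have "|Field r| \<le>o |E|" by (rule ordLeq_ordIso_trans[OF _ ordIso_symmetric[OF E(2)]])
  then obtain E0 where E0: "E0 \<subseteq> E" "|Field r| =o |E0|"
    using internalize_card_of_ordLeq2[of "Field r" E] by blast
  have "|E0| =o r" by (rule ordIso_transitive[OF ordIso_symmetric[OF E0(2)] Fr])
  moreover have "\<Inter>E' = {}" if E': "E' \<subseteq> E0" "|E'| =o r" for E'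
  proof -
    have "|Field m| \<le>o r" by (rule ordIso_ordLeq_trans[OF Fm le(1)])
    then have "|Field m| \<le>o |E'|" by (rule ordLeq_ordIso_trans[OF _ ordIso_symmetric[OF E'(2)]])
    then obtain E1 where E1: "E1 \<subseteq> E'" "|Field m| =o |E1|"
      using internalize_card_of_ordLeq2[of "Field m" E'] by blast
    have "|E1| =o m" by (rule ordIso_transitive[OF ordIso_symmetric[OF E1(2)] Fm])
    moreover have "E1 \<subseteq> E" using E1 E' E0 by blast
    ultimately have "\<Inter>E1 = {}" by (intro E(3))
    then show ?thesis using E1(1) by blast
  qed
  ultimately show ?thesis by (rule regular_ufI[OF order_trans[OF E0(1) E(1)]])
qed

context singular_ordinal
begin

text \<open>A member of \<open>D\<close> is nonempty, and a point of it lies in fewer than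
  \<open>|K|\<close> sets. Each set is therefore repeated at most \<lambda> times, and
  \<open>\<lambda>\<^sup>+\<close> distinct ones remain.\<close>

lemma regular_uf_of_family:
  assumes F: "filter_on I D" and fam: "regular_family {..<T} K I D" and K: "|K| \<le>o |{..<L}|"
    and m: "|K| =o m'" and n: "|{..<T}| =o n"
  shows "regular_uf m' n D"
proof -
  obtain B where B: "\<And>j. j < T \<Longrightarrow> B j \<in> D" "\<And>i. i \<in> I \<Longrightarrow> |{j. j < T \<and> i \<in> B j}| <o |K|"
    using fam unfolding regular_family_def by auto
  define E where "E = B ` {..<T}"
  have E_D: "E \<subseteq> D" unfolding E_def using B(1) by auto
  have E_T: "|E| \<le>o |{..<T}|" unfolding E_def by (rule card_of_image)
  have "\<not> |E| <o |{..<T}|"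
  proof
    assume "|E| <o |{..<T}|"
    then have EL: "|E| \<le>o |{..<L}|" unfolding T_def by (rule card_less_next_card)
    have "|{j. j < T \<and> B j = X}| \<le>o |{..<L}|" if X: "X \<in> E" for X
    proof -
      have "X \<noteq> {}" using X E_D filter_on_empty[OF F] by auto
      then obtain i where i: "i \<in> X" by blast
      have "X \<subseteq> I" using X E_D filter_on_subset[OF F] by blast
      then have "i \<in> I" using i by blast
      have "|{j. j < T \<and> B j = X}| \<le>o |{j. j < T \<and> i \<in> B j}|" by (rule card_of_mono1) (use i in auto)
      also have "|{j. j < T \<and> i \<in> B j}| \<le>o |K|" by (rule ordLess_imp_ordLeq[OF B(2)[OF \<open>i \<in> I\<close>]])
      finally have "|{j. j < T \<and> B j = X}| \<le>o |K|" .
      then show ?thesis by (rule ordLeq_transitive[OF _ K])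
    qed
    then have "|\<Union>X\<in>E. {j. j < T \<and> B j = X}| \<le>o |{..<L}|"
      by (intro card_of_UNION_ordLeq_infinite[OF inf_L EL]) blast
    moreover have "{..<T} \<subseteq> (\<Union>X\<in>E. {j. j < T \<and> B j = X})" unfolding E_def by auto
    ultimately have "|{..<T}| \<le>o |{..<L}|" using card_of_subset_ordLeq by blast
    then show False using next_L unfolding T_def by blast
  qed
  then have "|E| =o |{..<T}|" using iffD1[OF ordLeq_iff_ordLess_or_ordIso E_T] by blast
  then have En: "|E| =o n" by (rule ordIso_transitive[OF _ n])
  have "\<Inter>E' = {}" if E': "E' \<subseteq> E" "|E'| =o m'" for E'
  proof (rule ccontr)
    assume "\<Inter>E' \<noteq> {}"
    then obtain i where i: "\<And>X. X \<in> E' \<Longrightarrow> i \<in> X" by blast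
    have KE: "|K| =o |E'|" by (rule ordIso_transitive[OF m ordIso_symmetric[OF E'(2)]])
    have "\<not> E' \<subseteq> B ` {j. j < T \<and> i \<in> B j} \<or> i \<notin> I"
    proof (rule ccontr)
      assume "\<not> ?thesis"
      then have *: "E' \<subseteq> B ` {j. j < T \<and> i \<in> B j}" "i \<in> I" by auto
      have "|E'| \<le>o |B ` {j. j < T \<and> i \<in> B j}|" by (rule card_of_mono1[OF *(1)])
      also have "|B ` {j. j < T \<and> i \<in> B j}| \<le>o |{j. j < T \<and> i \<in> B j}|" by (rule card_of_image)
      finally have "|E'| <o |K|" by (rule ordLeq_ordLess_trans[OF _ B(2)[OF *(2)]])
      then show False using not_ordLess_ordIso ordIso_symmetric[OF KE] by blast
    qed
    moreover have "E' \<subseteq> B ` {j. j < T \<and> i \<in> B j}" using E'(1) i unfolding E_def by auto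
    \<comment> \<open>For empty \<open>E'\<close> the intersection is everything and
      \<open>i\<close> is arbitrary. That case would force \<open>K\<close> to be empty, but no
      point lies in fewer than zero sets.\<close>
    moreover have "i \<in> I"
    proof (cases "E' = {}")
      case True
      obtain j where j: "j < T" using cof_above_nonempty[OF cof_T] by blast
      have "B j \<noteq> {}" using B(1)[OF j] filter_on_empty[OF F] by auto
      then obtain i' where "i' \<in> B j" by blast
      then have "i' \<in> I" using filter_on_subset[OF F B(1)[OF j]] by blast
      then have "|{j. j < T \<and> i' \<in> B j}| <o |E'|" by (rule ordLess_ordIso_trans[OF B(2) KE])
      then show ?thesis unfolding True using card_of_empty[of "{j. j < T \<and> i' \<in> B j}"] not_ordLess_ordLeq by blast
    next
      case False
      then obtain X where "X \<in> E'" by blast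
      then show ?thesis using i E'(1) E_D filter_on_subset[OF F] by blast
    qed
    ultimately show False by blast
  qed
  then show ?thesis by (rule regular_ufI[OF E_D En])
qed

lemma regular_uf_of_decomposable:
  assumes D: "ultrafilter_on I D" and dec: "set_decomposable {..<L} I D" and n: "|{..<L}| =o n"
  shows "regular_uf n n D"
proof -
  have F: "filter_on I D" using D unfolding ultrafilter_on_def by blast
  obtain f where f: "f ` I \<subseteq> {..<L}" "\<And>X. X \<subseteq> {..<L} \<Longrightarrow> |X| <o |{..<L}| \<Longrightarrow> {i\<in>I. f i \<in> X} \<notin> D"
    using dec unfolding set_decomposable_def by blast
  define B where "B b = {i\<in>I. b \<le> f i}" for b
  \<comment> \<open>Only values taken by \<open>f\<close> index the family, since different
    unattained bounds can give the same set.\<close>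
  define E where "E = B ` f ` I"
  have "B b \<in> D" if "b < L" for b
  proof -
    have "{i\<in>I. f i \<in> {..<b}} \<notin> D" by (rule f(2)) (use that init in auto)
    then have "I - {i\<in>I. f i \<in> {..<b}} \<in> D" by (intro ultrafilter_compl[OF D]) auto
    moreover have "I - {i\<in>I. f i \<in> {..<b}} = B b" unfolding B_def by auto
    ultimately show ?thesis by simp
  qed
  then have E_D: "E \<subseteq> D" unfolding E_def using f(1) by auto
  have inj: "inj_on B (f ` I)"
  proof (rule inj_onI)
    fix x y assume xy: "x \<in> f ` I" "y \<in> f ` I" "B x = B y"
    obtain i j where ij: "i \<in> I" "x = f i" "j \<in> I" "y = f j" using xy by blast
    have "i \<in> B y" "j \<in> B x" using ij xy(3) unfolding B_def by auto
    then show "x = y" using ij unfolding B_def by auto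
  qed
  have "|f ` I| =o |{..<L}|"
  proof -
    have "\<not> |f ` I| <o |{..<L}|"
    proof
      assume "|f ` I| <o |{..<L}|"
      then have "{i\<in>I. f i \<in> f ` I} \<notin> D" by (rule f(2)[OF f(1)])
      moreover have "{i\<in>I. f i \<in> f ` I} = I" by auto
      ultimately show False using F unfolding filter_on_def by simp
    qed
    then show ?thesis using iffD1[OF ordLeq_iff_ordLess_or_ordIso card_of_mono1[OF f(1)]] by blast
  qed
  moreover have "|f ` I| =o |E|"
    using inj unfolding E_def by (intro card_of_ordIsoI[of B]) (simp add: bij_betw_def)
  ultimately have "|E| =o |{..<L}|" using ordIso_transitive ordIso_symmetric by blast
  then have En: "|E| =o n" by (rule ordIso_transitive[OF _ n])
  have "\<Inter>E' = {}" if E': "E' \<subseteq> E" "|E'| =o n" for E'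
  proof (rule ccontr)
    assume "\<Inter>E' \<noteq> {}"
    then obtain i where i: "\<And>X. X \<in> E' \<Longrightarrow> i \<in> X" by blast
    have LE: "|{..<L}| =o |E'|" by (rule ordIso_transitive[OF n ordIso_symmetric[OF E'(2)]])
    have "E' \<noteq> {}" using LE inf_L card_of_ordIso_finite by blast
    then obtain X where "X \<in> E'" by blast
    then have iI: "i \<in> I" using i E'(1) E_D filter_on_subset[OF F] by blast
    have "E' \<subseteq> B ` {..f i}" using E'(1) i unfolding E_def B_def by auto
    then have "|E'| \<le>o |{..f i}|" by (rule ordLeq_transitive[OF card_of_mono1 card_of_image])
    moreover have "f i < L" using f(1) iI by auto
    then have "|{..f i}| <o |{..<L}|" by (rule card_initial_segment[OF inf_L, rotated]) (rule init)
    ultimately have "|E'| <o |{..<L}|" by (rule ordLeq_ordLess_trans)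
    then show False using not_ordLess_ordIso ordIso_symmetric[OF LE] by blast
  qed
  then show ?thesis by (rule regular_ufI[OF E_D En])
qed

end

lemma infinite_unbounded:
  fixes L :: "'o::linorder"
  assumes "x < L" "Z \<subseteq> {..<L}" "\<And>x. x < L \<Longrightarrow> \<exists>z\<in>Z. x < z"
  shows "infinite Z"
proof
  assume fin: "finite Z"
  have "Z \<noteq> {}" using assms(1,3) by blast
  then have "Max Z \<in> Z" using fin by simp
  then have "Max Z < L" using assms(2) by blast
  then obtain z where "z \<in> Z" "Max Z < z" using assms(3) by blast
  then show False using Max_ge[OF fin] by (meson leD)
qed

text \<open>The order of \<open>|W|\<close> need not be the one transported by \<open>g\<close>. Its
  proper initial segments are small, hence bounded in \<open>z\<close>, and a cofinal set of smaller
  size would bound all of these bounds.\<close>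

lemma regular_card_of_regular_ordinal:
  fixes z :: "'o::wellorder"
  assumes z: "regular_ordinal z" and g: "bij_betw g W {..<z}"
  shows "regular_card |W|"
proof -
  have Wz: "|W| =o |{..<z}|" by (rule card_of_ordIsoI[OF g])
  have inf: "infinite W" using z bij_betw_finite[OF g] unfolding regular_ordinal_def by simp
  have small: "\<exists>b<z. \<forall>x\<in>X. g x < b" if X: "X \<subseteq> W" "|X| <o |W|" for X
  proof -
    have "|g ` X| <o |{..<z}|"
      by (rule ordLeq_ordLess_trans[OF card_of_image ordLess_ordIso_trans[OF X(2) Wz]])
    moreover have "g ` X \<subseteq> {..<z}" using X(1) g unfolding bij_betw_def by blast
    ultimately obtain b where "b < z" "\<forall>x\<in>g ` X. x < b" using z unfolding regular_ordinal_def by blast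
    then show ?thesis by blast
  qed
  have "|K| =o |W|" if K: "K \<subseteq> W" "cofinal K |W|" for K
  proof (rule ccontr)
    assume "\<not> |K| =o |W|"
    then have KW: "|K| <o |W|" using iffD1[OF ordLeq_iff_ordLess_or_ordIso card_of_mono1[OF K(1)]] by blast
    have "\<exists>b<z. \<forall>x\<in>underS |W| k. g x < b" if k: "k \<in> W" for k
    proof (rule small)
      show "underS |W| k \<subseteq> W" unfolding underS_def using Field_card_of[of W] by (auto intro: FieldI1)
      show "|underS |W| k| <o |W|" by (rule card_of_underS[OF card_of_Card_order]) (simp add: k Field_card_of)
    qed
    then obtain b where b: "\<And>k. k \<in> W \<Longrightarrow> b k < z" "\<And>k x. k \<in> W \<Longrightarrow> x \<in> underS |W| k \<Longrightarrow> g x < b k"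
      by metis
    have "|b ` K| <o |{..<z}|"
      by (rule ordLeq_ordLess_trans[OF card_of_image ordLess_ordIso_trans[OF KW Wz]])
    moreover have "b ` K \<subseteq> {..<z}" using b(1) K(1) by blast
    ultimately obtain c where c: "c < z" "\<forall>x\<in>b ` K. x < c" using z unfolding regular_ordinal_def by blast
    obtain w where w: "w \<in> W" "g w = c" using c(1) g unfolding bij_betw_def by (metis imageE lessThan_iff)
    obtain k where k: "k \<in> K" "w \<noteq> k" "(w, k) \<in> |W|"
      using K(2) w(1) unfolding cofinal_def by (auto simp: Field_card_of)
    have "g w < b k" by (rule b(2)) (use k K(1) in \<open>auto simp: underS_def\<close>)
    then show False using c(2) k(1) w(2) by (meson imageI less_asym)
  qed
  then have "regularCard |W|" unfolding regularCard_def by (simp add: Field_card_of)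
  moreover have "Cinfinite |W|" using inf by (simp add: cinfinite_def Field_card_of card_of_card_order_on)
  ultimately show ?thesis unfolding regular_card_def by blast
qed

theorem theorem3:
  fixes lam :: "'l rel" and I :: "'i set" and F :: "'i set set"
  assumes "singular_card lam"
    and "filter_on I F"
    and "(\<exists>lam' :: 'l rel. Card_order lam' \<and> lam' <o lam \<and>
            (\<forall>\<kappa> :: 'l rel. regular_card \<kappa> \<and> lam' <o \<kappa> \<and> \<kappa> <o lam \<longrightarrow> decomposable \<kappa> I F))
       \<or> (natLeq <o cofinality lam \<and> stationary lam (succ_decomposable_cards lam I F))"
  shows "(decomposable lam I F \<or> decomposable (cardSuc lam) I F) \<and>
    (ultrafilter_on I F \<longrightarrow>
       regular_uf lam lam F \<and>
       (decomposable lam I F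
        \<or> (\<exists>lam' :: 'l rel. Card_order lam' \<and> lam' <o lam \<and> regular_uf lam' (cardSuc lam) F)
        \<or> (decomposable (cofinality lam) I F \<and> regular_uf lam (cardSuc lam) F)))"
proof -
  have Cinf: "Cinfinite lam" and nreg: "\<not> regularCard lam" using assms(1) unfolding singular_card_def by auto
  have C: "Card_order lam" and infF: "infinite (Field lam)" using Cinf by (auto simp: cinfinite_def)
  have W: "Well_order lam" using C by (rule card_order_on_well_order_on)
  have Fl: "|Field lam| =o lam" by (rule card_of_Field_ordIso[OF C])
  \<comment> \<open>The ordinals must reach \<open>\<lambda>\<^sup>+\<close>. One power set of the
    base type already has size at least \<open>\<lambda>\<^sup>+\<close>; the second makes the
    inequality strict, so that \<open>\<lambda>\<^sup>+\<close> is a proper initial segment.\<close>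
  let ?R = "{(x :: 'l set set ordinal, y). x \<le> y}"
  have "|UNIV :: 'l set set set| \<le>o ?R"
  proof (rule ordLeq_transitive[OF card_ordinal_UNIV])
    show "|UNIV :: 'l set set ordinal set| \<le>o ?R"
      using card_of_least[of UNIV ?R] wellorder_UNIV[where 'o = "'l set set ordinal"] by metis
  qed
  moreover have "cardSuc lam <o |UNIV :: 'l set set set|"
  proof -
    have "|Field lam| <o |UNIV :: 'l set set|"
      using card_of_Pow[of "UNIV :: 'l set"] ordLeq_ordLess_trans[OF card_of_mono1[of "Field lam" UNIV]] by simp
    then have "lam <o |UNIV :: 'l set set|" by (rule ordIso_ordLess_trans[OF ordIso_symmetric[OF Fl]])
    then have "cardSuc lam \<le>o |UNIV :: 'l set set|" by (rule cardSuc_least[OF C card_of_Card_order])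
    moreover have "|UNIV :: 'l set set| <o |UNIV :: 'l set set set|"
      using card_of_Pow[of "UNIV :: 'l set set"] by simp
    ultimately show ?thesis by (rule ordLeq_ordLess_trans)
  qed
  ultimately have sucR: "cardSuc lam <o ?R" by (rule ordLess_ordLeq_trans[rotated])
  have lamR: "lam <o ?R" by (rule ordLess_transitive[OF cardSuc_greater[OF C] sucR])
  obtain L :: "'l set set ordinal" and g where g: "bij_betw g (Field lam) {..<L}"
    and g_le: "\<And>x y. x \<in> Field lam \<Longrightarrow> y \<in> Field lam \<Longrightarrow> (x, y) \<in> lam \<longleftrightarrow> g x \<le> g y"
    by (rule order_type[OF W lamR]) (rule that)
  have WS: "Well_order (cardSuc lam)" by (rule card_order_on_well_order_on[OF cardSuc_Card_order[OF C]])
  \<comment> \<open>An ordinal of cardinality above \<open>L\<close>, which makes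
    \<open>next_card L\<close> the true successor cardinal.\<close>
  obtain T' :: "'l set set ordinal" and g' where g': "bij_betw g' (Field (cardSuc lam)) {..<T'}"
    by (rule order_type[OF WS sucR]) (rule that)
  have L_lam: "|{..<L}| =o lam"
    by (rule ordIso_transitive[OF ordIso_symmetric[OF card_of_ordIsoI[OF g]] Fl])
  have T'_suc: "|{..<T'}| =o cardSuc lam"
    by (rule ordIso_transitive[OF ordIso_symmetric[OF card_of_ordIsoI[OF g']]
          card_of_Field_ordIso[OF cardSuc_Card_order[OF C]]])
  have T'_L: "\<not> |{..<T'}| \<le>o |{..<L}|"
  proof
    assume "|{..<T'}| \<le>o |{..<L}|"
    then have "cardSuc lam \<le>o lam"
      by (rule ordIso_ordLeq_trans[OF ordIso_symmetric[OF T'_suc] ordLeq_ordIso_trans[OF _ L_lam]])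
    then show False using cardSuc_greater[OF C] not_ordLess_ordLeq by blast
  qed
  have T_suc: "|{..<next_card L}| =o cardSuc lam" by (rule card_next_card[OF C L_lam T'_L])
  define h where "h = inv_into (Field lam) g"
  have h: "bij_betw h {..<L} (Field lam)" unfolding h_def by (rule bij_betw_inv_into[OF g])
  have gh: "g (h x) = x" if "x < L" for x
    unfolding h_def using bij_betw_inv_into_right[OF g] that by simp
  have hg: "h (g a) = a" if "a \<in> Field lam" for a
    unfolding h_def using bij_betw_inv_into_left[OF g that] .
  have hF: "h x \<in> Field lam" if "x < L" for x using h that unfolding bij_betw_def by auto
  have gL: "g a < L" if "a \<in> Field lam" for a using g that unfolding bij_betw_def by auto
  have g_inj: "g a = g b \<longleftrightarrow> a = b" if "a \<in> Field lam" "b \<in> Field lam" for a b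
    using hg that by metis
  have underS: "bij_betw g (underS lam a) {..<g a}" if a: "a \<in> Field lam" for a
    unfolding bij_betw_def
  proof
    have sub: "underS lam a \<subseteq> Field lam" unfolding underS_def by (auto intro: FieldI1)
    then show "inj_on g (underS lam a)" using g inj_on_subset unfolding bij_betw_def by blast
    show "g ` underS lam a = {..<g a}"
    proof
      show "g ` underS lam a \<subseteq> {..<g a}"
      proof
        fix x assume "x \<in> g ` underS lam a"
        then obtain b where b: "b \<in> underS lam a" "x = g b" by blast
        then have bF: "b \<in> Field lam" using sub by blast
        then show "x \<in> {..<g a}" using b g_le[OF bF a] g_inj[OF bF a] unfolding underS_def by (auto simp: le_less)
      qed
      show "{..<g a} \<subseteq> g ` underS lam a"
      proof
        fix x assume x: "x \<in> {..<g a}"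
        then have xL: "x < L" using gL[OF a] by (auto intro: less_trans)
        have "h x \<in> underS lam a"
          using g_le[OF hF[OF xL] a] gh[OF xL] x unfolding underS_def by auto
        then show "x \<in> g ` underS lam a" using gh[OF xL] by (metis imageI)
      qed
    qed
  qed
  have init: "|{..<x}| <o |{..<L}|" if x: "x < L" for x
  proof -
    have "|{..<x}| =o |underS lam (h x)|"
      using ordIso_symmetric[OF card_of_ordIsoI[OF underS[OF hF[OF x]]]] gh[OF x] by simp
    then have "|{..<x}| <o lam" using card_of_underS[OF C hF[OF x]] ordIso_ordLess_trans by blast
    then show ?thesis using ordIso_symmetric[OF L_lam] by (rule ordLess_ordIso_trans)
  qed
  have L_inf: "infinite {..<L}" using infF bij_betw_finite[OF g] by simp
  have cofinal_image: "cofinal (h ` X) lam" if X: "X \<subseteq> {..<L}" "\<And>b. b < L \<Longrightarrow> \<exists>x\<in>X. b < x" for X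
    unfolding cofinal_def
  proof
    fix a assume a: "a \<in> Field lam"
    obtain x where x: "x \<in> X" "g a < x" using X(2)[OF gL[OF a]] by blast
    then have xL: "x < L" using X(1) by blast
    then have "(a, h x) \<in> lam" "a \<noteq> h x" using g_le[OF a hF[OF xL]] gh[OF xL] x(2) by auto
    then show "\<exists>b\<in>h ` X. a \<noteq> b \<and> (a, b) \<in> lam" using x(1) by blast
  qed
  have cofinal_less: "\<exists>x\<in>g ` Y. b < x" if Y: "Y \<subseteq> Field lam" "cofinal Y lam" and b: "b < L" for Y b
  proof -
    obtain y where y: "y \<in> Y" "h b \<noteq> y" "(h b, y) \<in> lam" using Y(2) hF[OF b] unfolding cofinal_def by blast
    then have "b \<le> g y" "b \<noteq> g y" using g_le[OF hF[OF b], of y] gh[OF b] hg[of y] Y(1) by auto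
    then have "b < g y" by (simp add: le_less)
    then show ?thesis using y(1) by blast
  qed
  obtain A0 where A0: "cofinality lam = |A0|" "A0 \<subseteq> Field lam" "cofinal A0 lam"
    using cofinality(1)[OF Cinf] by blast
  define Z where "Z = g ` A0"
  have Z_L: "Z \<subseteq> {..<L}" unfolding Z_def using A0(2) gL by auto
  have Z_unb: "\<exists>z\<in>Z. x < z" if "x < L" for x unfolding Z_def by (rule cofinal_less[OF A0(2,3) that])
  have "inj_on g A0" using g A0(2) inj_on_subset unfolding bij_betw_def by blast
  then have A0_Z: "|A0| =o |Z|" unfolding Z_def by (intro card_of_ordIsoI[of g]) (simp add: bij_betw_def)
  have cof_le: "|Z| \<le>o |X|" if X: "X \<subseteq> {..<L}" "\<And>b. b < L \<Longrightarrow> \<exists>x\<in>X. b < x" for X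
  proof -
    have "h ` X \<subseteq> Field lam" using X(1) hF by blast
    then have "|A0| \<le>o |h ` X|" using cofinality(2)[OF Cinf _ cofinal_image[OF X]] A0(1) by simp
    then have "|A0| \<le>o |X|" by (rule ordLeq_transitive[OF _ card_of_image])
    then show ?thesis by (rule ordIso_ordLeq_trans[OF ordIso_symmetric[OF A0_Z]])
  qed
  have "|Z| <o |{..<L}|"
  proof -
    obtain K where K: "K \<subseteq> Field lam" "cofinal K lam" "\<not> |K| =o lam" using nreg unfolding regularCard_def by blast
    have "|K| \<le>o lam" by (rule ordLeq_ordIso_trans[OF card_of_mono1[OF K(1)] Fl])
    then have "|K| <o lam" using K(3) iffD1[OF ordLeq_iff_ordLess_or_ordIso] by blast
    then have KL: "|K| <o |{..<L}|" by (rule ordLess_ordIso_trans[OF _ ordIso_symmetric[OF L_lam]])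
    have "g ` K \<subseteq> {..<L}" using K(1) gL by blast
    then have "|Z| \<le>o |g ` K|" by (rule cof_le) (rule cofinal_less[OF K(1,2)])
    then have "|Z| \<le>o |K|" by (rule ordLeq_transitive[OF _ card_of_image])
    then show ?thesis by (rule ordLeq_ordLess_trans[OF _ KL])
  qed
  then obtain m where m: "m < L" "|Z| =o |{..<m}|" using card_ordinal by blast
  have "{..<L} \<noteq> {}" using L_inf by auto
  then obtain x0 where x0: "x0 < L" by blast
  have "infinite Z" by (rule infinite_unbounded[OF x0 Z_L Z_unb])
  then have m_inf: "infinite {..<m}" using card_of_ordIso_finite[OF m(2)] by simp
  have Zm: "|Z| \<le>o |{..<m}|" using m(2) ordIso_iff_ordLeq by blast
  have next_L: "\<not> |{..<next_card L}| \<le>o |{..<L}|" by (rule next_card_not_le(1)[OF T'_L])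
  interpret singular_ordinal L m Z
    by unfold_locales (use init m_inf m(1) Z_L Zm Z_unb next_L in auto)
  \<comment> \<open>\<open>Z\<close> has the least size of an unbounded subset of \<open>L\<close>,
    so its smaller subsets are bounded.\<close>
  have Zmin: "\<exists>b<L. \<forall>x\<in>X. x \<le> b" if X: "X \<subseteq> Z" "|X| <o |Z|" for X
  proof (rule ccontr)
    assume contr: "\<not> ?thesis"
    have "\<exists>x\<in>X. b < x" if "b < L" for b
    proof (rule ccontr)
      assume "\<not> (\<exists>x\<in>X. b < x)"
      then have "\<forall>x\<in>X. x \<le> b" by (simp add: not_less)
      then show False using contr that by blast
    qed
    then have "|Z| \<le>o |X|" by (intro cof_le) (use X(1) Z_L in auto)
    then show False using X(2) not_ordLess_ordLeq by blast
  qed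
  have dec_lam: "decomposable lam I F \<longleftrightarrow> set_decomposable {..<L} I F"
    unfolding decomposable_iff[OF C]
    using set_decomposable_cong[OF card_of_ordIsoI[OF g]]
      set_decomposable_cong[OF ordIso_symmetric[OF card_of_ordIsoI[OF g]]] by blast
  have suc_F: "|Field (cardSuc lam)| =o |{..<next_card L}|"
    by (rule ordIso_transitive[OF card_of_Field_ordIso[OF cardSuc_Card_order[OF C]] ordIso_symmetric[OF T_suc]])
  have dec_suc: "decomposable (cardSuc lam) I F \<longleftrightarrow> set_decomposable {..<next_card L} I F"
    unfolding decomposable_iff[OF cardSuc_Card_order[OF C]]
    using set_decomposable_cong[OF suc_F] set_decomposable_cong[OF ordIso_symmetric[OF suc_F]] by blast
  have one: "set_decomposable {..<L} I F \<or> set_decomposable {..<next_card L} I F"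
    using assms(3)
  proof
    assume "\<exists>lam' :: 'l rel. Card_order lam' \<and> lam' <o lam \<and>
      (\<forall>\<kappa> :: 'l rel. regular_card \<kappa> \<and> lam' <o \<kappa> \<and> \<kappa> <o lam \<longrightarrow> decomposable \<kappa> I F)"
    then obtain lam' :: "'l rel" where lam': "Card_order lam'" "lam' <o lam"
      "\<And>\<kappa> :: 'l rel. regular_card \<kappa> \<Longrightarrow> lam' <o \<kappa> \<Longrightarrow> \<kappa> <o lam \<Longrightarrow> decomposable \<kappa> I F" by blast
    have F': "|Field lam'| =o lam'" by (rule card_of_Field_ordIso[OF lam'(1)])
    have "|Field lam'| <o |{..<L}|"
      by (rule ordLess_ordIso_trans[OF ordIso_ordLess_trans[OF F' lam'(2)] ordIso_symmetric[OF L_lam]])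
    then obtain l where l: "l < L" "|Field lam'| =o |{..<l}|" using card_ordinal by blast
    have l_lam': "|{..<l}| =o lam'" by (rule ordIso_transitive[OF ordIso_symmetric[OF l(2)] F'])
    show ?thesis
    proof (rule dichotomy_regular[OF assms(2) l(1)])
      fix z assume z: "z < L" "regular_ordinal z" "\<not> |{..<z}| \<le>o |{..<l}|"
      \<comment> \<open>The hypothesis concerns cardinal orders on the original type, so the regular
        ordinal is carried back there.\<close>
      define W where "W = h ` {..<z}"
      have hW: "bij_betw g W {..<z}"
        unfolding W_def bij_betw_def
      proof
        show "inj_on g (h ` {..<z})" using gh z(1) by (auto simp: inj_on_def)
        show "g ` h ` {..<z} = {..<z}" using gh z(1) by (force simp: image_iff)
      qed
      have Wz: "|W| =o |{..<z}|" by (rule card_of_ordIsoI[OF hW])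
      have "decomposable |W| I F"
      proof (rule lam'(3))
        show "regular_card |W|" by (rule regular_card_of_regular_ordinal[OF z(2) hW])
        have "|{..<l}| <o |{..<z}|" using z(3) by (meson card_of_Well_order not_ordLeq_iff_ordLess)
        then have "lam' <o |{..<z}|" by (rule ordIso_ordLess_trans[OF ordIso_symmetric[OF l_lam']])
        then show "lam' <o |W|" by (rule ordLess_ordIso_trans[OF _ ordIso_symmetric[OF Wz]])
        show "|W| <o lam"
          by (rule ordIso_ordLess_trans[OF Wz ordLess_ordIso_trans[OF init[OF z(1)] L_lam]])
      qed
      then have "set_decomposable W I F" unfolding decomposable_iff[OF card_of_Card_order] by (simp add: Field_card_of)
      then show "set_decomposable {..<z} I F" by (rule set_decomposable_cong[OF Wz])
    qed
  next
    assume *: "natLeq <o cofinality lam \<and> stationary lam (succ_decomposable_cards lam I F)"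
    let ?S = "succ_decomposable_cards lam I F"
    have S_F: "?S \<subseteq> Field lam" unfolding succ_decomposable_cards_def by blast
    have cofn: "natLeq <o |Z|"
      by (rule ordLess_ordIso_trans[OF _ A0_Z]) (use * A0(1) in simp)
    have nat: "cof_above L (UNIV :: nat set)"
      unfolding cof_above_def
    proof (intro allI impI)
      fix X assume X: "X \<subseteq> {..<L}" "|X| \<le>o |UNIV :: nat set|"
      show "\<exists>b<L. \<forall>x\<in>X. x < b"
      proof (rule ccontr)
        assume contr: "\<not> ?thesis"
        have "\<exists>x\<in>X. b < x" if b: "b < L" for b
        proof (rule ccontr)
          assume "\<not> (\<exists>x\<in>X. b < x)"
          then have le: "\<forall>x\<in>X. x \<le> b" by (simp add: not_less)
          obtain c where "c \<in> Z" "b < c" using Z_unb[OF b] by blast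
          then have "c < L" "\<forall>x\<in>X. x < c" using Z_L le by (auto intro: le_less_trans)
          then show False using contr by blast
        qed
        then have "|Z| \<le>o |X|" by (rule cof_le[OF X(1)])
        then have "|Z| \<le>o |UNIV :: nat set|" by (rule ordLeq_transitive[OF _ X(2)])
        then have "|Z| \<le>o natLeq" by (rule ordLeq_ordIso_trans[OF _ card_of_nat])
        then show False using cofn not_ordLess_ordLeq by blast
      qed
    qed
    show ?thesis
    proof (rule dichotomy_stationary[OF assms(2) nat])
      fix D assume D: "closed_unbounded L D"
      have D_L: "D \<subseteq> {..<L}" and D_unb: "\<And>x. x < L \<Longrightarrow> \<exists>y\<in>D. x < y"
        and D_cl: "\<And>x. x < L \<Longrightarrow> lim_pt D x \<Longrightarrow> x \<in> D" using D unfolding closed_unbounded_def by auto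
      have "club lam (h ` D)"
        unfolding club_def
      proof (intro conjI ballI impI)
        show "h ` D \<subseteq> Field lam" using D_L hF by auto
        show "cofinal (h ` D) lam" by (rule cofinal_image[OF D_L D_unb])
        fix a assume a: "a \<in> Field lam"
          and lim: "underS lam a \<noteq> {} \<and> cofinal (h ` D \<inter> underS lam a) (initial_part lam a)"
        have sub: "underS lam a \<subseteq> Field lam" unfolding underS_def by (auto intro: FieldI1)
        have refl: "(x, x) \<in> lam" if "x \<in> Field lam" for x using g_le[OF that that] by simp
        have FI: "Field (initial_part lam a) = underS lam a"
          unfolding initial_part_def Field_def using refl sub by auto
        have gu: "g ` underS lam a = {..<g a}" using underS[OF a] unfolding bij_betw_def by blast
        have "lim_pt D (g a)"
          unfolding lim_pt_def
        proof (intro conjI allI impI)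
          have "{..<g a} \<noteq> {}" using lim gu by (metis image_is_empty)
          then show "\<exists>y. y < g a" by auto
          fix y assume "y < g a"
          then obtain b where b: "b \<in> underS lam a" "y = g b" using gu by (metis imageE lessThan_iff)
          then obtain c where c: "c \<in> h ` D \<inter> underS lam a" "b \<noteq> c" "(b, c) \<in> initial_part lam a"
            using lim FI unfolding cofinal_def by blast
          then obtain d where d: "d \<in> D" "c = h d" by blast
          have dL: "d < L" using d(1) D_L by auto
          have "b \<in> Field lam" "c \<in> Field lam" using b(1) c(1) sub by auto
          moreover have "(b, c) \<in> lam" using c(3) unfolding initial_part_def by blast
          ultimately have "g b \<le> g c" "g b \<noteq> g c" using g_le g_inj c(2) by auto
          then have "y < d" using b(2) d(2) gh[OF dL] by simp
          moreover have "d < g a" using c(1) gu d(2) gh[OF dL] by (metis IntD2 imageI lessThan_iff)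
          ultimately show "\<exists>z\<in>D. y < z \<and> z < g a" using d(1) by blast
        qed
        then have "g a \<in> D" by (rule D_cl[OF gL[OF a]])
        then show "a \<in> h ` D" using hg[OF a] by (metis imageI)
      qed
      then have "?S \<inter> h ` D \<noteq> {}" using * unfolding stationary_def by blast
      then obtain d where d: "d \<in> D" "h d \<in> ?S" by blast
      have "d = g (h d)" using gh[of d] d(1) D_L by auto
      then have "d \<in> g ` ?S" by (rule image_eqI[OF _ d(2)])
      then have "d \<in> g ` ?S \<inter> D" using d(1) by blast
      then show "g ` ?S \<inter> D \<noteq> {}" by blast
    next
      fix x assume "x \<in> g ` ?S"
      then obtain a where a: "a \<in> ?S" "x = g a" by blast
      let ?r = "initial_part lam a"
      have aF: "a \<in> Field lam" using a(1) S_F by blast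
      have Cr: "Card_order ?r" and dec: "decomposable (cardSuc ?r) I F"
        using a(1) unfolding succ_decomposable_cards_def by auto
      have sub: "underS lam a \<subseteq> Field lam" unfolding underS_def by (auto intro: FieldI1)
      have refl: "(y, y) \<in> lam" if "y \<in> Field lam" for y using g_le[OF that that] by simp
      have FI: "Field ?r = underS lam a" unfolding initial_part_def Field_def using refl sub by auto
      have "|underS lam a| =o ?r" using card_of_Field_ordIso[OF Cr] unfolding FI .
      then have xr: "|{..<x}| =o ?r"
        using ordIso_transitive[OF ordIso_symmetric[OF card_of_ordIsoI[OF underS[OF aF]]]] a(2) by blast
      have "x < L" using gL[OF aF] a(2) by simp
      then obtain y :: "'l set set ordinal" where "\<not> |{..<y}| \<le>o |{..<x}|"
        using limit_cardinal[of x] by blast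
      then have "|{..<next_card x}| =o cardSuc ?r" by (rule card_next_card[OF Cr xr])
      then have "|Field (cardSuc ?r)| =o |{..<next_card x}|"
        by (rule ordIso_transitive[OF card_of_Field_ordIso[OF cardSuc_Card_order[OF Cr]] ordIso_symmetric])
      then show "set_decomposable {..<next_card x} I F"
        by (rule set_decomposable_cong) (use dec in \<open>simp add: decomposable_iff[OF cardSuc_Card_order[OF Cr]]\<close>)
    qed
  qed
  have "regular_uf lam lam F \<and> (decomposable lam I F
        \<or> (\<exists>lam' :: 'l rel. Card_order lam' \<and> lam' <o lam \<and> regular_uf lam' (cardSuc lam) F)
        \<or> (decomposable (cofinality lam) I F \<and> regular_uf lam (cardSuc lam) F))"
    if U: "ultrafilter_on I F"
  proof (cases "set_decomposable {..<L} I F")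
    case True
    then show ?thesis using regular_uf_of_decomposable[OF U True L_lam] dec_lam by blast
  next
    case False
    have lam_suc: "lam \<le>o cardSuc lam" by (rule ordLess_imp_ordLeq[OF cardSuc_greater[OF C]])
    have T_n: "|{..<T}| =o cardSuc lam" using T_suc unfolding T_def .
    have "(\<exists>z<L. regular_family {..<T} {..<z} I F) \<or>
      (set_decomposable Z I F \<and> regular_family {..<T} {..<L} I F)"
      using ultrafilter_trichotomy[OF U _ Zmin] one False unfolding T_def by blast
    then show ?thesis
    proof
      assume "\<exists>z<L. regular_family {..<T} {..<z} I F"
      then obtain z where z: "z < L" "regular_family {..<T} {..<z} I F" by blast
      have zL: "|{..<z}| \<le>o |{..<L}|" by (rule ordLess_imp_ordLeq[OF init[OF z(1)]])
      have "inj_on h {..<z}" using gh z(1) by (intro inj_on_inverseI[of _ g]) auto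
      then have zW: "|{..<z}| =o |h ` {..<z}|" by (intro card_of_ordIsoI[of h]) (simp add: bij_betw_def)
      have reg: "regular_uf |h ` {..<z}| (cardSuc lam) F"
        by (rule regular_uf_of_family[OF assms(2) z(2) zL zW T_n])
      have "|h ` {..<z}| <o lam"
        by (rule ordIso_ordLess_trans[OF ordIso_symmetric[OF zW] ordLess_ordIso_trans[OF init[OF z(1)] L_lam]])
      then show ?thesis
        using reg regular_uf_mono[OF reg card_of_Card_order C ordLess_imp_ordLeq lam_suc] card_of_Card_order by blast
    next
      assume Z: "set_decomposable Z I F \<and> regular_family {..<T} {..<L} I F"
      have reg: "regular_uf lam (cardSuc lam) F"
        by (rule regular_uf_of_family[OF assms(2) conjunct2[OF Z] ordLeq_refl[OF card_of_Card_order] L_lam T_n])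
      have "set_decomposable A0 I F" by (rule set_decomposable_cong[OF ordIso_symmetric[OF A0_Z] conjunct1[OF Z]])
      then have "decomposable (cofinality lam) I F"
        unfolding A0(1) decomposable_iff[OF card_of_Card_order] by (simp add: Field_card_of)
      then show ?thesis
        using reg regular_uf_mono[OF reg C C ordLeq_refl[OF C] lam_suc] by blast
    qed
  qed
  then show ?thesis using one dec_lam dec_suc by blast
qed

end
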